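(* Let $k\in\mathbb{N}$ and let $\mathcal{A}=\{(1,a_0),\dots,(1,a_N)\}\subset\mathbb{Z}^{n+1}$ be a lattice configuration. Then the following statements are equivalent: (1) $X_{\mathcal{A}}$ is $k$-selfdual. (2) $\dim X_{\mathcal{A}}=\dim X_{\mathcal{A}}^{(k)}$ and $\mathcal{A}$ is $k$nap. (3) There exists a point $\mathbf{p}$ in the torus of $(\mathbb{P}^N)^\vee$ (i.e. with all coordinates nonzero) such that $X_{\mathcal{A}}^{(k)}$ is the Zariski closure of the orbit $\{\mathbf{t}*^\vee_{\mathcal{A}}\mathbf{p} : \mathbf{t}\in(\mathbb{K}^* )^n\}$.
   Context: $\mathbb{K}$ is an algebraically closed field of characteristic zero. The points $a_0,\dots,a_N\in\mathbb{Z}^n$ are distinct and $\mathbb{Z}\mathcal{A}=\mathbb{Z}^{n+1}$. $X_{\mathcal{A}}\subset\mathbb{P}^N$ is the Zariski closure of $\{(\mathbf{t}^{a_0}:\dots:\mathbf{t}^{a_N}) : \mathbf{t}\in(\mathbb{K}^* )^n\}$; it has dimension $n$. Higher duals: let $X\subset\mathbb{P}^N$ be a nondegenerate irreducible projective variety (not contained in a hyperplane). For a smooth point $x\in X$, let $j_{k,x}:\mathbb{K}^{N+1}\to\mathcal{L}_x/\mathfrak{m}_x^{k+1}\mathcal{L}_x$, with $\mathcal{L}=\mathcal{O}_{\mathbb{P}^N}(1)|_X$, be the linear map sending a linear form to the Taylor expansion up to order $k$ at $x$ of its restriction to $X$. The $k$-th osculating space is $\mathbb{T}^k_{X,x}=\mathbb{P}(\operatorname{Im}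 j_{k,x})\subset\mathbb{P}^N$; thus a hyperplane contains $\mathbb{T}^k_{X,x}$ iff its equation restricted to $X$ vanishes to order at least $k+1$ at $x$. Let $X_{k\text{-cst}}$ be the open dense subset of $X$ where the rank of $j_k$ is constant. The $k$-th dual variety $X^{(k)}\subset(\mathbb{P}^N)^\vee$ is the Zariski closure of $\{H : H\supseteq\mathbb{T}^k_{X,x}\text{ for some }x\in X_{k\text{-cst}}\}$. $X$ is $k$-selfdual if there is a linear isomorphism $\varphi:\mathbb{P}^N\to(\mathbb{P}^N)^\vee$ with $\varphi(X)=X^{(k)}$. Let $A^{(k)}$ be the $\binom{n+k}{k}\times(N+1)$ integer matrix whose rows are the vectors $(a_0^\beta,\dots,a_N^\beta)$ for $\beta\in\mathbb{N}^n$, $|\beta|\le k$. $\mathcal{A}$ is $k$nap if no canonical basis vector $e_i$, $i=0,\dots,N$, of $\mathbb{R}^{N+1}$ lies in the row span of $A^{(k)}$. Using dual bases to give coordinates on $(\mathbb{P}^N)^\vee$, the action of the $n$-torus on it is $\mathbf{t}*^\vee_{\mathcal{A}}\mathbf{y}=(\mathbf{t}^{-a_0}y_0:\dots:\mathbf{t}^{-a_N}y_N)$. *)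

theory Defs
  imports "HOL-Analysis.Analysis" "HOL-Computational_Algebra.Polynomial"
begin

text \<open>
  Homogeneous coordinates on projective \<open>N\<close>-space are indexed by a finite type \<open>'i\<close> with
  \<open>N + 1\<close> elements.  A point is given by any of its nonzero representatives in \<open>'a ^ 'i\<close>, and a
  subset of projective space by the set of all representatives of its points.  The dual
  projective space has the dual coordinates: a nonzero \<open>y\<close> stands for the hyperplane
  \<open>{v. pairing y v = 0}\<close>.
\<close>

definition pairing :: "'a::field ^ 'i::finite \<Rightarrow> 'a ^ 'i \<Rightarrow> 'a" where
  "pairing y v = (\<Sum>i\<in>UNIV. y $ i * v $ i)"


subsection \<open>Zariski topology and dimension\<close>

text \<open>Homogeneous polynomials are identified with the functions they define, and this loses
  nothing over an infinite field.\<close>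

definition form :: "nat \<Rightarrow> ('a::field ^ 'i::finite \<Rightarrow> 'a) \<Rightarrow> bool" where
  "form d f \<longleftrightarrow>
     (\<exists>c. f = (\<lambda>v. \<Sum>\<alpha> | (\<Sum>i\<in>UNIV. \<alpha> i) = d. c \<alpha> * (\<Prod>i\<in>UNIV. v $ i ^ \<alpha> i)))"

text \<open>The open sets below are invariant under nonzero scalars and correspond one-to-one to the
  Zariski open subsets of projective space.\<close>

definition zariski :: "('a::field ^ 'i::finite) topology" where
  "zariski = topology_generated_by {{v. v \<noteq> 0 \<and> f v \<noteq> 0} | f. \<exists>d. form d f}"

definition zariski_irreducible :: "('a::field ^ 'i::finite) set \<Rightarrow> bool" where
  "zariski_irreducible S \<longleftrightarrow>
     S \<noteq> {} \<and> (\<forall>C D. closedin zariski C \<longrightarrow> closedin zariski D \<longrightarrow> S \<subseteq> C \<union> D \<longrightarrow> S \<subseteq> C \<or> S \<subseteq> D)"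

text \<open>The empty set has dimension \<open>-\<infinity>\<close>.\<close>

definition zariski_dim :: "('a::field ^ 'i::finite) set \<Rightarrow> ereal" where
  "zariski_dim X = Sup {ereal (real m) | m. \<exists>Z.
     (\<forall>q\<le>m. closedin (subtopology zariski X) (Z q) \<and> zariski_irreducible (Z q)) \<and>
     (\<forall>q<m. Z q \<subset> Z (Suc q))}"


subsection \<open>Local rings and smooth points\<close>

text \<open>The stalk at \<open>x\<close> of \<open>\<O>(d)\<close> restricted to \<open>X\<close>.  A germ is represented by any function
  agreeing near \<open>x\<close>, on the cone over \<open>X\<close>, with a quotient of forms whose degrees differ by
  \<open>d\<close>; the values elsewhere are irrelevant.\<close>

definition stalk :: "('a::field ^ 'i::finite) set \<Rightarrow> nat \<Rightarrow> 'a ^ 'i \<Rightarrow> ('a ^ 'i \<Rightarrow> 'a) set" where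
  "stalk X d x = {s. \<exists>e F G U. form (d + e) F \<and> form e G \<and> openin zariski U \<and> x \<in> U \<and>
     (\<forall>v\<in>U \<inter> X. G v \<noteq> 0 \<and> s v = F v / G v)}"

definition max_ideal :: "('a::field ^ 'i::finite) set \<Rightarrow> 'a ^ 'i \<Rightarrow> ('a ^ 'i \<Rightarrow> 'a) set" where
  "max_ideal X x = {f \<in> stalk X 0 x. f x = 0}"

text \<open>The submodule \<open>\<mm>\<^sub>x\<^sup>q \<O>(d)\<^sub>x\<close> of \<open>\<O>(d)\<^sub>x\<close>, again up to equality near \<open>x\<close>.\<close>

definition max_ideal_power ::
    "('a::field ^ 'i::finite) set \<Rightarrow> nat \<Rightarrow> nat \<Rightarrow> 'a ^ 'i \<Rightarrow> ('a ^ 'i \<Rightarrow> 'a) set" where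
  "max_ideal_power X q d x = {s. \<exists>(m::nat) f l U.
     (\<forall>r<m. (\<forall>p<q. f r p \<in> max_ideal X x) \<and> l r \<in> stalk X d x) \<and>
     openin zariski U \<and> x \<in> U \<and>
     (\<forall>v\<in>U \<inter> X. s v = (\<Sum>r<m. (\<Prod>p<q. f r p v) * l r v))}"

text \<open>The quotient vector space \<open>V/W\<close> has dimension \<open>d\<close>: the classes of \<open>b 0, \<dots>, b (d-1)\<close> are a
  basis of it.\<close>

definition quotient_dim :: "('v \<Rightarrow> 'a::field) set \<Rightarrow> ('v \<Rightarrow> 'a) set \<Rightarrow> nat \<Rightarrow> bool" where
  "quotient_dim V W d \<longleftrightarrow> (\<exists>b. (\<forall>q<d. b q \<in> V) \<and>
     (\<forall>g\<in>V. \<exists>c. (\<lambda>v. g v - (\<Sum>q<d. c q * b q v)) \<in> W) \<and>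
     (\<forall>c. (\<lambda>v. \<Sum>q<d. c q * b q v) \<in> W \<longrightarrow> (\<forall>q<d. c q = 0)))"

text \<open>For irreducible closed \<open>X\<close>, every local ring of \<open>X\<close> has dimension \<open>dim X\<close>, so this is
  regularity of the local ring at \<open>x\<close>.\<close>

definition smooth_point :: "('a::field ^ 'i::finite) set \<Rightarrow> 'a ^ 'i \<Rightarrow> bool" where
  "smooth_point X x \<longleftrightarrow> x \<in> X \<and>
     (\<exists>d. quotient_dim (max_ideal X x) (max_ideal_power X 2 0 x) d \<and>
          zariski_dim X = ereal (real d))"


subsection \<open>Osculating spaces and higher duals\<close>

text \<open>The Taylor expansion up to order \<open>k\<close> at \<open>x\<close> of the linear form with coefficients \<open>h\<close>: an
  element of \<open>\<L>\<^sub>x/\<mm>\<^sub>x\<^sup>k\<^sup>+\<^sup>1\<L>\<^sub>x\<close>, as a coset.\<close>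

definition jet ::
    "('a::field ^ 'i::finite) set \<Rightarrow> nat \<Rightarrow> 'a ^ 'i \<Rightarrow> 'a ^ 'i \<Rightarrow> ('a ^ 'i \<Rightarrow> 'a) set" where
  "jet X k x h = {s \<in> stalk X 1 x. (\<lambda>v. s v - pairing h v) \<in> max_ideal_power X (k + 1) 1 x}"

text \<open>The image of \<open>jet X k x\<close> is a quotient of the space of linear forms, and its
  projectivisation is the linear subspace of projective space cut out by the kernel.  The
  following is the underlying vector subspace (including \<open>0\<close>); it is dual to the image of
  \<open>jet X k x\<close>, so its dimension is the rank of \<open>jet X k x\<close>.\<close>

definition osculating_space ::
    "('a::field ^ 'i::finite) set \<Rightarrow> nat \<Rightarrow> 'a ^ 'i \<Rightarrow> ('a ^ 'i) set" where
  "osculating_space X k x = {v. \<forall>h. jet X k x h = jet X k x 0 \<longrightarrow> pairing h v = 0}"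

definition jet_rank :: "('a::field ^ 'i::finite) set \<Rightarrow> nat \<Rightarrow> 'a ^ 'i \<Rightarrow> nat" where
  "jet_rank X k x = vec.dim (osculating_space X k x)"

text \<open>For irreducible \<open>X\<close> any two nonempty open subsets meet, so the union of all open sets of
  smooth points on which the rank is constant is itself such a set, and it is dense.\<close>

definition constant_rank_locus :: "('a::field ^ 'i::finite) set \<Rightarrow> nat \<Rightarrow> ('a ^ 'i) set" where
  "constant_rank_locus X k = \<Union>{U. openin (subtopology zariski X) U \<and>
     (\<forall>x\<in>U. smooth_point X x) \<and> (\<exists>r. \<forall>x\<in>U. jet_rank X k x = r)}"

definition dual_variety :: "('a::field ^ 'i::finite) set \<Rightarrow> nat \<Rightarrow> ('a ^ 'i) set" where
  "dual_variety X k = zariski closure_of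
     {y. y \<noteq> 0 \<and> (\<exists>x\<in>constant_rank_locus X k. osculating_space X k x \<subseteq> {v. pairing y v = 0})}"

definition selfdual :: "('a::field ^ 'i::finite) set \<Rightarrow> nat \<Rightarrow> bool" where
  "selfdual X k \<longleftrightarrow>
     (\<exists>\<phi>. Vector_Spaces.linear (*s) (*s) \<phi> \<and> bij \<phi> \<and> \<phi> ` X = dual_variety X k)"


subsection \<open>Lattice configurations\<close>

text \<open>The point \<open>a\<^sub>i\<close> is given by its coordinates \<open>a i j\<close> with \<open>j < n\<close>; other values of \<open>a i\<close> are
  ignored.  Coordinate \<open>0\<close> of the homogenised point is the leading \<open>1\<close>.\<close>

definition homogenised :: "('i \<Rightarrow> nat \<Rightarrow> int) \<Rightarrow> 'i \<Rightarrow> nat \<Rightarrow> int" where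
  "homogenised a i j = (case j of 0 \<Rightarrow> 1 | Suc j' \<Rightarrow> a i j')"

definition lattice_configuration :: "nat \<Rightarrow> ('i::finite \<Rightarrow> nat \<Rightarrow> int) \<Rightarrow> bool" where
  "lattice_configuration n a \<longleftrightarrow>
     (\<forall>i i'. i \<noteq> i' \<longrightarrow> (\<exists>j<n. a i j \<noteq> a i' j)) \<and>
     (\<forall>w::nat \<Rightarrow> int. \<exists>c::'i \<Rightarrow> int. \<forall>j\<le>n. w j = (\<Sum>i\<in>UNIV. c i * homogenised a i j))"

definition torus :: "nat \<Rightarrow> (nat \<Rightarrow> 'a::field) set" where
  "torus n = {t. \<forall>j<n. t j \<noteq> 0}"

definition toric_variety :: "nat \<Rightarrow> ('i \<Rightarrow> nat \<Rightarrow> int) \<Rightarrow> ('a::field ^ 'i::finite) set" where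
  "toric_variety n a =
     zariski closure_of {(\<chi> i. \<Prod>j<n. t j powi a i j) | t. t \<in> torus n}"

definition dual_action ::
    "nat \<Rightarrow> ('i \<Rightarrow> nat \<Rightarrow> int) \<Rightarrow> (nat \<Rightarrow> 'a::field) \<Rightarrow> 'a ^ 'i::finite \<Rightarrow> 'a ^ 'i" where
  "dual_action n a t y = (\<chi> i. (\<Prod>j<n. t j powi (- a i j)) * y $ i)"

definition knap :: "nat \<Rightarrow> nat \<Rightarrow> ('i::finite \<Rightarrow> nat \<Rightarrow> int) \<Rightarrow> bool" where
  "knap k n a \<longleftrightarrow> (\<forall>i. (axis i 1 :: real ^ 'i) \<notin>
     span {(\<chi> i'. real_of_int (\<Prod>j<n. a i' j ^ \<beta> j)) | \<beta>. (\<Sum>j<n. \<beta> j) \<le> k})"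

end

theory Submission
  imports Defs
begin

text \<open>
  Write \<open>X\<close> for the cone over the toric variety and \<open>S\<close> for its torus orbit.  Over \<open>S\<close> the
  osculating spaces can be computed with the Euler fields \<open>a\<^sub>i\<^sub>j x\<^sub>i \<partial>\<^sub>i\<close>: a hyperplane \<open>h\<close> has contact of
  order \<open>k + 1\<close> at \<open>s\<close> iff the vector \<open>(h\<^sub>i s\<^sub>i)\<close> lies in the kernel of the matrix of powers.  The
  main point is that the constant rank locus outside \<open>S\<close> contributes nothing new to the dual variety.
  At a smooth point \<open>x\<close>, polynomial vector fields tangent to \<open>X\<close> that span the tangent space at \<open>x\<close> are
  obtained from the equations of \<open>X\<close> by Cramer's rule; Euler's identity then shows that the order of
  vanishing at \<open>x\<close> is detected by iterating these fields.  Hence near \<open>x\<close> the contact hyperplanes are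
  the kernel of a polynomial matrix of constant rank, and every kernel vector extends to a polynomial
  section, so it is a limit of contact hyperplanes over \<open>S\<close>.  The dual variety is therefore
  the closure of the dual torus orbits of the kernel vectors, in particular irreducible.

  Given this, (3) implies (1) by a diagonal map; (1) implies (2) since \<open>X\<close> lies in no hyperplane; and
  under (2) the kernel contains a vector with nonzero coordinates, whose orbit closure is isomorphic to \<open>X\<close>,
  so it fills the irreducible dual variety for dimension reasons.  The dimension of \<open>X\<close> is bounded by
  the growth of its Hilbert function.
\<close>

section \<open>Polynomial functions and forms\<close>

text \<open>The definitions speak of local rings of a projective variety, whereas derivatives and
  curves need functions on the affine cone. The bridge is \<open>vanish_order\<close>: a power of
  the maximal ideal, up to a polynomial factor that is nonzero at the point and up to functions
  vanishing on \<open>X\<close>, so that no fraction is ever differentiated. On a cone each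
  homogeneous component of a vanishing polynomial vanishes as well; for this reason the torus gets
  an extra parameter \<open>t 0\<close> that scales. The obstacle is a smooth point outside the
  orbit, which no parametrization reaches. Two comparisons of ranks connect it with the orbit:
  smoothness bounds the rank of the gradients of equations from below by its value on the orbit, and
  constancy of the jet rank fixes the dimension of the space of contact hyperplanes. Density
  arguments rest on rational curves inside the orbit: a product of polynomials vanishes on the orbit
  only if a factor does. The lattice hypothesis supplies integral monomials that read off the torus
  parameters. They identify the orbit inside \<open>X\<close>, give \<open>n + 1\<close> independent
  tangent directions, and separate the subtori that bound the dimension from below.\<close>

inductive polyfun :: "('a::field ^ 'i::finite \<Rightarrow> 'a) \<Rightarrow> bool" where
  polyfun_const: "polyfun (\<lambda>v. c)"
| polyfun_coord: "polyfun (\<lambda>v. v $ i)"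
| polyfun_add: "polyfun f \<Longrightarrow> polyfun g \<Longrightarrow> polyfun (\<lambda>v. f v + g v)"
| polyfun_mult: "polyfun f \<Longrightarrow> polyfun g \<Longrightarrow> polyfun (\<lambda>v. f v * g v)"

lemma polyfun_minus: "polyfun f \<Longrightarrow> polyfun (\<lambda>v. - f v)"
  using polyfun_mult[OF polyfun_const[of "-1"], of f] by simp

lemma polyfun_diff: "polyfun f \<Longrightarrow> polyfun g \<Longrightarrow> polyfun (\<lambda>v. f v - g v)"
  using polyfun_add[OF _ polyfun_minus, of f g] by simp

lemma polyfun_sum: "(\<And>j. j \<in> A \<Longrightarrow> polyfun (f j)) \<Longrightarrow> polyfun (\<lambda>v. \<Sum>j\<in>A. f j v)"
  by (induction A rule: infinite_finite_induct) (auto intro: polyfun.intros)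

lemma polyfun_prod: "(\<And>j. j \<in> A \<Longrightarrow> polyfun (f j)) \<Longrightarrow> polyfun (\<lambda>v. \<Prod>j\<in>A. f j v)"
  by (induction A rule: infinite_finite_induct) (auto intro: polyfun.intros)

lemma polyfun_power: "polyfun f \<Longrightarrow> polyfun (\<lambda>v. f v ^ m)"
  by (induction m) (auto intro: polyfun.intros)

lemmas polyfun_intros = polyfun_const polyfun_coord polyfun_add polyfun_mult polyfun_minus
  polyfun_diff polyfun_sum polyfun_prod polyfun_power

lemma polyfun_compose:
  assumes "polyfun f" and "\<And>i. polyfun (\<lambda>v. g v $ i)"
  shows "polyfun (\<lambda>v. f (g v))"
  using assms(1) by induction (auto intro: polyfun_intros assms(2))

lemma polyfun_pairing: "polyfun (pairing h)"
  unfolding pairing_def by (intro polyfun_intros)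

lemma polyfun_det:
  assumes "\<And>i j. polyfun (\<lambda>v. M v $ i $ j)"
  shows "polyfun (\<lambda>v. det (M v))"
  unfolding det_def by (intro polyfun_intros assms)

lemma finite_exponents: "finite {\<alpha>::'i::finite \<Rightarrow> nat. (\<Sum>i\<in>UNIV. \<alpha> i) = d}"
proof (rule finite_subset)
  show "{\<alpha>::'i \<Rightarrow> nat. (\<Sum>i\<in>UNIV. \<alpha> i) = d} \<subseteq> (UNIV \<rightarrow>\<^sub>E {..d})"
    by (auto simp: PiE_def Pi_def extensional_def intro: member_le_sum)
  show "finite ((UNIV::'i set) \<rightarrow>\<^sub>E {..d})"
    by (intro finite_PiE) auto
qed

lemma form_monomial: 
  fixes \<alpha> :: "'i::finite \<Rightarrow> nat"
  shows "form (\<Sum>i\<in>UNIV. \<alpha> i) (\<lambda>v::'a::field ^ 'i. \<Prod>i\<in>UNIV. v $ i ^ \<alpha> i)"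
proof -
  let ?S = "{\<beta>::'i \<Rightarrow> nat. (\<Sum>i\<in>UNIV. \<beta> i) = (\<Sum>i\<in>UNIV. \<alpha> i)}"
  have "(\<Prod>i\<in>UNIV. v $ i ^ \<alpha> i) = (\<Sum>\<beta>\<in>?S. (if \<beta> = \<alpha> then 1 else 0) * (\<Prod>i\<in>UNIV. v $ i ^ \<beta> i))"
    for v :: "'a ^ 'i"
  proof -
    have "(\<Sum>\<beta>\<in>?S. (if \<beta> = \<alpha> then 1 else 0) * (\<Prod>i\<in>UNIV. v $ i ^ \<beta> i))
        = (\<Sum>\<beta>\<in>?S. if \<beta> = \<alpha> then (\<Prod>i\<in>UNIV. v $ i ^ \<alpha> i) else 0)"
      by (intro sum.cong) auto
    then show ?thesis by (simp add: finite_exponents)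
  qed
  then show ?thesis unfolding form_def by (intro exI[of _ "\<lambda>\<beta>. if \<beta> = \<alpha> then 1 else 0"]) auto
qed

lemma form_zero: "form d (\<lambda>v. 0)"
  unfolding form_def by (intro exI[of _ "\<lambda>_. 0"]) simp

lemma form_add: "form d f \<Longrightarrow> form d g \<Longrightarrow> form d (\<lambda>v. f v + g v)"
proof -
  assume "form d f" "form d g"
  then obtain c c' where "f = (\<lambda>v. \<Sum>\<alpha> | (\<Sum>i\<in>UNIV. \<alpha> i) = d. c \<alpha> * (\<Prod>i\<in>UNIV. v $ i ^ \<alpha> i))"
    "g = (\<lambda>v. \<Sum>\<alpha> | (\<Sum>i\<in>UNIV. \<alpha> i) = d. c' \<alpha> * (\<Prod>i\<in>UNIV. v $ i ^ \<alpha> i))"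
    unfolding form_def by auto
  then show ?thesis unfolding form_def
    by (intro exI[of _ "\<lambda>\<alpha>. c \<alpha> + c' \<alpha>"]) (auto simp: sum.distrib algebra_simps)
qed

lemma form_scale: "form d f \<Longrightarrow> form d (\<lambda>v. b * f v)"
proof -
  assume "form d f"
  then obtain c where "f = (\<lambda>v. \<Sum>\<alpha> | (\<Sum>i\<in>UNIV. \<alpha> i) = d. c \<alpha> * (\<Prod>i\<in>UNIV. v $ i ^ \<alpha> i))"
    unfolding form_def by auto
  then show ?thesis unfolding form_def
    by (intro exI[of _ "\<lambda>\<alpha>. b * c \<alpha>"]) (auto simp: sum_distrib_left algebra_simps)
qed

lemma form_sum: "(\<And>j. j \<in> A \<Longrightarrow> form d (f j)) \<Longrightarrow> form d (\<lambda>v. \<Sum>j\<in>A. f j v)"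
  by (induction A rule: infinite_finite_induct) (auto intro: form_zero form_add)

lemma form_mult:
  assumes "form d f" "form e g"
  shows "form (d + e) (\<lambda>v. f v * g v)"
proof -
  obtain c where c: "f = (\<lambda>v. \<Sum>\<alpha> | (\<Sum>i\<in>UNIV. \<alpha> i) = d. c \<alpha> * (\<Prod>i\<in>UNIV. v $ i ^ \<alpha> i))"
    using assms(1) unfolding form_def by auto
  obtain c' where c': "g = (\<lambda>v. \<Sum>\<alpha> | (\<Sum>i\<in>UNIV. \<alpha> i) = e. c' \<alpha> * (\<Prod>i\<in>UNIV. v $ i ^ \<alpha> i))"
    using assms(2) unfolding form_def by auto
  have eq: "(\<lambda>v. f v * g v) = (\<lambda>v. \<Sum>\<alpha> | (\<Sum>i\<in>UNIV. \<alpha> i) = d. \<Sum>\<beta> | (\<Sum>i\<in>UNIV. \<beta> i) = e.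
      (c \<alpha> * c' \<beta>) * (\<Prod>i\<in>UNIV. v $ i ^ (\<alpha> i + \<beta> i)))"
    unfolding c c' sum_product power_add prod.distrib
    by (intro ext sum.cong refl) (simp only: mult.assoc mult.left_commute)
  show ?thesis unfolding eq
  proof (intro form_sum form_scale)
    fix \<alpha> \<beta> :: "'b \<Rightarrow> nat"
    assume "\<alpha> \<in> {\<alpha>. sum \<alpha> UNIV = d}" "\<beta> \<in> {\<beta>. sum \<beta> UNIV = e}"
    then show "form (d + e) (\<lambda>v::'a^'b. \<Prod>i\<in>UNIV. v $ i ^ (\<alpha> i + \<beta> i))"
      using form_monomial[of "\<lambda>i. \<alpha> i + \<beta> i"] by (simp add: sum.distrib)
  qed
qed

lemma form_const: "form 0 (\<lambda>v. c)"
  using form_scale[OF form_monomial[of "\<lambda>_. 0"], of c] by simp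

lemma form_coord: "form 1 (\<lambda>v. v $ i)"
proof -
  have "(\<Prod>j\<in>UNIV. v $ j ^ (if j = i then 1 else 0)) = v $ i" for v :: "'a ^ 'b"
  proof -
    have "(\<Prod>j\<in>UNIV. v $ j ^ (if j = i then 1 else 0)) = (\<Prod>j\<in>UNIV. if j = i then v $ i else 1)"
      by (intro prod.cong) auto
    then show ?thesis by simp
  qed
  then show ?thesis using form_monomial[of "\<lambda>j. if j = i then 1 else 0", where 'a = 'a] by (simp add: fun_eq_iff cong: if_cong)
qed

lemma form_power: "form d f \<Longrightarrow> form (m * d) (\<lambda>v. f v ^ m)"
  by (induction m) (auto simp: form_const intro: form_mult)

lemma form_pairing: "form 1 (pairing h)"
  unfolding pairing_def by (intro form_sum form_scale form_coord)

lemma form_polyfun: "form d f \<Longrightarrow> polyfun f"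
  unfolding form_def by (auto intro!: polyfun_intros)

lemma form_homogeneous:
  assumes "form d f"
  shows "f (c *s v) = c ^ d * f v"
proof -
  obtain b where b: "f = (\<lambda>v. \<Sum>\<alpha> | (\<Sum>i\<in>UNIV. \<alpha> i) = d. b \<alpha> * (\<Prod>i\<in>UNIV. v $ i ^ \<alpha> i))"
    using assms unfolding form_def by auto
  have "(\<Prod>i\<in>UNIV. (c * v $ i) ^ \<alpha> i) = c ^ d * (\<Prod>i\<in>UNIV. v $ i ^ \<alpha> i)"
    if "(\<Sum>i\<in>UNIV. \<alpha> i) = d" for \<alpha> :: "'b \<Rightarrow> nat"
    using that by (auto simp: power_mult_distrib prod.distrib power_sum)
  then show ?thesis unfolding b by (simp add: sum_distrib_left algebra_simps)
qed

lemma polyfun_form_decomposition: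
  assumes "polyfun f"
  shows "\<exists>g m. (\<forall>d. form d (g d)) \<and> f = (\<lambda>v. \<Sum>d\<le>m. g d v)"
proof -
  \<comment> \<open>The induction also records that the components above \<open>m\<close> are zero,
    so that sums of different lengths can be padded in the additive case.\<close>
  have "\<exists>m g. (\<forall>d. form d (g d)) \<and> (\<forall>d>m. g d = (\<lambda>v. 0)) \<and> f = (\<lambda>v. \<Sum>d\<le>m. g d v)"
    using assms
  proof induction
    case (polyfun_const c)
    show ?case
      by (intro exI[of _ 0] exI[of _ "\<lambda>d. if d = 0 then (\<lambda>v. c) else (\<lambda>v. 0)"])
        (auto simp: form_const form_zero)
  next
    case (polyfun_coord i)
    show ?case
      by (intro exI[of _ 1] exI[of _ "\<lambda>d. if d = 1 then (\<lambda>v. v $ i) else (\<lambda>v. 0)"])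
        (use form_coord form_zero in \<open>auto\<close>)
  next
    case (polyfun_add f g)
    then obtain m m' h h' where h: "\<forall>d. form d (h d)" "\<forall>d>m. h d = (\<lambda>v. 0)" "f = (\<lambda>v. \<Sum>d\<le>m. h d v)"
      and h': "\<forall>d. form d (h' d)" "\<forall>d>m'. h' d = (\<lambda>v. 0)" "g = (\<lambda>v. \<Sum>d\<le>m'. h' d v)"
      by auto
    have "(\<Sum>d\<le>m. h d v) = (\<Sum>d\<le>max m m'. h d v)" "(\<Sum>d\<le>m'. h' d v) = (\<Sum>d\<le>max m m'. h' d v)" for v
      using h(2) h'(2) by (auto intro!: sum.mono_neutral_left) (metis not_le)+
    then show ?case
      by (intro exI[of _ "max m m'"] exI[of _ "\<lambda>d v. h d v + h' d v"])
        (use h h' in \<open>auto simp: sum.distrib intro: form_add\<close>)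
  next
    case (polyfun_mult f g)
    then obtain m m' h h' where h: "\<forall>d. form d (h d)" "\<forall>d>m. h d = (\<lambda>v. 0)" "f = (\<lambda>v. \<Sum>d\<le>m. h d v)"
      and h': "\<forall>d. form d (h' d)" "\<forall>d>m'. h' d = (\<lambda>v. 0)" "g = (\<lambda>v. \<Sum>d\<le>m'. h' d v)"
      by auto
    let ?P = "{..m} \<times> {..m'}"
    define k where "k d v = (\<Sum>p | p \<in> ?P \<and> fst p + snd p = d. h (fst p) v * h' (snd p) v)" for d v
    have "f v * g v = (\<Sum>d\<le>m + m'. k d v)" for v
    proof -
      have "f v * g v = (\<Sum>p\<in>?P. h (fst p) v * h' (snd p) v)"
        unfolding h(3) h'(3) by (simp add: sum_product sum.cartesian_product case_prod_beta)
      also have "\<dots> = (\<Sum>d\<le>m + m'. k d v)" unfolding k_def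
        by (rule sum.group[symmetric]) auto
      finally show ?thesis .
    qed
    moreover have "form d (k d)" for d
    proof -
      have "form d (\<lambda>v. h (fst p) v * h' (snd p) v)" if "p \<in> {p \<in> ?P. fst p + snd p = d}" for p
        using form_mult[of "fst p" "h (fst p)" "snd p" "h' (snd p)"] h h' that by auto
      then show ?thesis unfolding k_def by (intro form_sum) auto
    qed
    moreover have "k d = (\<lambda>v. 0)" if "d > m + m'" for d
    proof -
      have e: "{p. p \<in> ?P \<and> fst p + snd p = d} = {}" using that by auto
      show ?thesis unfolding k_def e by simp
    qed
    ultimately show ?case by (intro exI[of _ "m + m'"] exI[of _ k]) auto
  qed
  then show ?thesis by blast
qed

text \<open>The sum is a polynomial in \<open>c\<close> with coefficients \<open>f d\<close>; in
  characteristic zero the nonzero scalars are infinitely many roots, so all coefficients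
  vanish.\<close>

lemma homogeneous_sum_eq_zero:
  fixes f :: "nat \<Rightarrow> 'a::field_char_0"
  assumes "\<And>c. c \<noteq> 0 \<Longrightarrow> (\<Sum>d\<le>m. c ^ d * f d) = 0" "d \<le> m"
  shows "f d = 0"
proof -
  define p where "p = (\<Sum>d\<le>m. monom (f d) d)"
  have "poly p c = 0" if "c \<noteq> 0" for c
    using assms(1)[OF that] by (simp add: p_def poly_sum poly_monom mult.commute)
  then have "infinite {c. poly p c = 0}"
    by (metis (mono_tags, lifting) finite_subset infinite_UNIV_char_0 finite_Diff2 finite.emptyI
        finite_insert Diff_subset mem_Collect_eq insertCI subsetI DiffE DiffI UNIV_I)
  then have "p = 0" using poly_roots_finite by blast
  then have "coeff p d = 0" by simp
  then show ?thesis using assms(2) by (simp add: p_def coeff_sum)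
qed

text \<open>Recognising forms by their behaviour under scaling saves the computation of
  coefficients, as after a linear substitution. Comparing \<open>f (c *s v)\<close> with the
  decomposition of \<open>f\<close> leaves only the component of degree \<open>d\<close>.\<close>

lemma form_iff_homogeneous:
  fixes f :: "'a::field_char_0 ^ 'i::finite \<Rightarrow> 'a"
  shows "form d f \<longleftrightarrow> polyfun f \<and> (\<forall>c v. f (c *s v) = c ^ d * f v)"
proof
  assume *: "polyfun f \<and> (\<forall>c v. f (c *s v) = c ^ d * f v)"
  then have "polyfun f" by simp
  from polyfun_form_decomposition[OF this]
  obtain g m where g: "\<And>e. form e (g e)" "f = (\<lambda>v. \<Sum>e\<le>m. g e v)" by auto
  \<comment> \<open>The coefficient of \<open>c ^ e\<close> in the difference between the
    decomposition and \<open>c ^ d * f v\<close>; both are padded by zero so that one summation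
    range serves.\<close>
  define G where "G v e = (if e \<le> m then g e v else 0) - (if e = d then f v else 0)" for v e
  have "(\<Sum>e\<le>max m d. c ^ e * G v e) = 0" for c v
  proof -
    have "(\<Sum>e\<le>max m d. c ^ e * G v e) = (\<Sum>e\<le>max m d. if e \<le> m then c ^ e * g e v else 0)
        - (\<Sum>e\<le>max m d. if e = d then c ^ e * f v else 0)"
      unfolding G_def sum_subtractf[symmetric] by (intro sum.cong) (auto simp: algebra_simps)
    also have "(\<Sum>e\<le>max m d. if e \<le> m then c ^ e * g e v else 0) = (\<Sum>e\<le>m. c ^ e * g e v)"
      by (intro sum.mono_neutral_cong_right) auto
    also have "\<dots> = f (c *s v)" unfolding g(2) by (simp add: form_homogeneous[OF g(1)])
    also have "(\<Sum>e\<le>max m d. if e = d then c ^ e * f v else 0) = c ^ d * f v"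
      by simp
    finally show ?thesis using * by simp
  qed
  then have "G v d = 0" for v by (rule homogeneous_sum_eq_zero[where m = "max m d" and f = "G v"]) auto
  then have "f v = (if d \<le> m then g d v else 0)" for v by (simp add: G_def)
  then have "f = (if d \<le> m then g d else (\<lambda>v. 0))" by auto
  then show "form d f" using g form_zero by (cases "d \<le> m") auto
qed (auto simp: form_polyfun form_homogeneous)


section \<open>The Zariski topology\<close>

lemma topspace_zariski: "topspace (zariski :: ('a::field ^ 'i::finite) topology) = {v. v \<noteq> 0}"
proof -
  have "{v::'a^'i. v \<noteq> 0} = {v. v \<noteq> 0 \<and> (\<lambda>v. 1::'a) v \<noteq> 0}" by simp
  then have "{v::'a^'i. v \<noteq> 0} \<in> {{v. v \<noteq> 0 \<and> f v \<noteq> 0} | f. \<exists>d. form d f}"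
    by (intro CollectI exI[of _ "\<lambda>v. 1"] conjI exI[of _ 0] form_const)
  then show ?thesis unfolding zariski_def topology_generated_by_topspace by auto
qed

lemma openin_zariski_basic: "form d f \<Longrightarrow> openin zariski {v. v \<noteq> 0 \<and> f v \<noteq> 0}"
  unfolding zariski_def by (rule topology_generated_by_Basis) auto

text \<open>The generating sets are a basis and not only a subbasis: intersecting two of them
  multiplies the forms.\<close>

lemma openin_zariski_nbhd:
  assumes "openin zariski U" "x \<in> U"
  shows "x \<noteq> 0 \<and> (\<exists>d h. form d h \<and> h x \<noteq> 0 \<and> {v. v \<noteq> 0 \<and> h v \<noteq> 0} \<subseteq> U)"
proof -
  have "generate_topology_on {{v. v \<noteq> 0 \<and> f v \<noteq> 0} | f. \<exists>d. form d f} U"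
    using assms(1) unfolding zariski_def by (rule openin_topology_generated_by)
  then have "\<forall>x\<in>U. x \<noteq> 0 \<and> (\<exists>d h. form d h \<and> h x \<noteq> 0 \<and> {v. v \<noteq> 0 \<and> h v \<noteq> 0} \<subseteq> U)"
  proof induction
    case (Int A B)
    show ?case
    proof
      fix x assume "x \<in> A \<inter> B"
      then have "x \<in> A" "x \<in> B" by auto
      from bspec[OF Int.IH(1) this(1)] bspec[OF Int.IH(2) this(2)]
      obtain d h e g where h: "x \<noteq> 0" "form d h" "h x \<noteq> 0" "{v. v \<noteq> 0 \<and> h v \<noteq> 0} \<subseteq> A"
        "form e g" "g x \<noteq> 0" "{v. v \<noteq> 0 \<and> g v \<noteq> 0} \<subseteq> B" by auto
      show "x \<noteq> 0 \<and> (\<exists>d h. form d h \<and> h x \<noteq> 0 \<and> {v. v \<noteq> 0 \<and> h v \<noteq> 0} \<subseteq> A \<inter> B)"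
        by (intro conjI exI[of _ "d + e"] exI[of _ "\<lambda>v. h v * g v"])
          (use h form_mult[OF h(2,5)] in auto)
    qed
  next
    case (UN K)
    show ?case
    proof
      fix x assume "x \<in> \<Union>K"
      then obtain k where k: "k \<in> K" "x \<in> k" by auto
      from bspec[OF UN.IH[OF k(1)] k(2)]
      obtain d h where h: "x \<noteq> 0" "form d h" "h x \<noteq> 0" "{v. v \<noteq> 0 \<and> h v \<noteq> 0} \<subseteq> k" by auto
      show "x \<noteq> 0 \<and> (\<exists>d h. form d h \<and> h x \<noteq> 0 \<and> {v. v \<noteq> 0 \<and> h v \<noteq> 0} \<subseteq> \<Union>K)"
        by (intro conjI exI[of _ d] exI[of _ h]) (use h k in auto)
    qed
  next
    case (Basis s)
    then obtain d f where f: "form d f" "s = {v. v \<noteq> 0 \<and> f v \<noteq> 0}" by auto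
    show ?case unfolding f(2)
      by (intro ballI conjI exI[of _ d] exI[of _ f]) (use f in auto)
  qed simp
  from bspec[OF this assms(2)] show ?thesis .
qed

lemma closedin_zariski_separate:
  assumes "closedin zariski C" "x \<noteq> 0" "x \<notin> C"
  shows "\<exists>d h. form d h \<and> h x \<noteq> 0 \<and> (\<forall>v\<in>C. h v = 0)"
proof -
  have "openin zariski (topspace zariski - C)" using assms(1) by (simp add: closedin_def)
  moreover have "x \<in> topspace zariski - C" using assms by (simp add: topspace_zariski)
  ultimately obtain d h where h: "form d h" "h x \<noteq> 0" "{v. v \<noteq> 0 \<and> h v \<noteq> 0} \<subseteq> topspace zariski - C"
    using openin_zariski_nbhd[of "topspace zariski - C" x] by auto
  have "v \<noteq> 0" if "v \<in> C" for v
    using closedin_subset[OF assms(1)] that by (auto simp: topspace_zariski)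
  then have "\<forall>v\<in>C. h v = 0" using h(3) by auto
  then show ?thesis using h(1,2) by (intro exI[of _ d] exI[of _ h]) simp
qed

lemma closedin_zariski_zeros: "form d f \<Longrightarrow> closedin zariski {v. v \<noteq> 0 \<and> f v = 0}"
proof -
  assume "form d f"
  have "topspace zariski - {v. v \<noteq> 0 \<and> f v = 0} = {v. v \<noteq> 0 \<and> f v \<noteq> 0}"
    by (auto simp: topspace_zariski)
  then show ?thesis using openin_zariski_basic[OF \<open>form d f\<close>] by (simp add: closedin_def topspace_zariski) auto
qed

text \<open>A point outside the closure has a basic neighbourhood that misses \<open>S\<close>, and
  its form separates. The guard \<open>s \<noteq> 0\<close> ignores the zero vector, which is not a
  point of the space although \<open>S\<close> may contain it.\<close>

lemma zariski_closure_eq: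
  "zariski closure_of S = {v. v \<noteq> 0 \<and> (\<forall>d f. form d f \<longrightarrow> (\<forall>s\<in>S. s \<noteq> 0 \<longrightarrow> f s = 0) \<longrightarrow> f v = 0)}"
proof (intro equalityI subsetI)
  fix v assume v: "v \<in> zariski closure_of S"
  have "v \<noteq> 0" using v by (auto simp: in_closure_of topspace_zariski)
  moreover have "f v = 0" if f: "form d f" "\<forall>s\<in>S. s \<noteq> 0 \<longrightarrow> f s = 0" for d f
  proof (rule ccontr)
    assume "f v \<noteq> 0"
    have "\<forall>T. v \<in> T \<and> openin zariski T \<longrightarrow> (\<exists>y. y \<in> S \<and> y \<in> T)"
      using v by (simp add: in_closure_of)
    from spec[OF this, of "{v. v \<noteq> 0 \<and> f v \<noteq> 0}"]
    obtain y where "y \<in> S" "y \<noteq> 0" "f y \<noteq> 0"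
      using \<open>v \<noteq> 0\<close> \<open>f v \<noteq> 0\<close> openin_zariski_basic[OF f(1)] by auto
    then show False using that by auto
  qed
  ultimately show "v \<in> {v. v \<noteq> 0 \<and> (\<forall>d f. form d f \<longrightarrow> (\<forall>s\<in>S. s \<noteq> 0 \<longrightarrow> f s = 0) \<longrightarrow> f v = 0)}"
    by (intro CollectI conjI allI impI)
next
  fix v assume v: "v \<in> {v. v \<noteq> 0 \<and> (\<forall>d f. form d f \<longrightarrow> (\<forall>s\<in>S. s \<noteq> 0 \<longrightarrow> f s = 0) \<longrightarrow> f v = 0)}"
  have "\<exists>y. y \<in> S \<and> y \<in> T" if T: "v \<in> T" "openin zariski T" for T
  proof -
    obtain d h where "form d h" "h v \<noteq> 0" "{v. v \<noteq> 0 \<and> h v \<noteq> 0} \<subseteq> T"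
      using openin_zariski_nbhd[OF T(2,1)] by auto
    then show ?thesis using v by (simp add: subset_iff) metis
  qed
  then show "v \<in> zariski closure_of S" using v by (auto simp: in_closure_of topspace_zariski)
qed

definition cone :: "('a::field ^ 'i::finite) set \<Rightarrow> bool" where
  "cone S \<longleftrightarrow> (\<forall>v\<in>S. \<forall>c. c \<noteq> 0 \<longrightarrow> c *s v \<in> S)"

lemma closedin_cone:
  assumes "closedin zariski C"
  shows "cone C"
  unfolding cone_def
proof (intro ballI allI impI)
  fix v and c :: 'a assume "v \<in> C" "c \<noteq> 0"
  have "v \<noteq> 0" using closedin_subset[OF assms] \<open>v \<in> C\<close> by (auto simp: topspace_zariski)
  show "c *s v \<in> C"
  proof (rule ccontr)
    assume "c *s v \<notin> C"
    have "c *s v \<noteq> 0" using \<open>v \<noteq> 0\<close> \<open>c \<noteq> 0\<close> by (simp add: vec_eq_iff)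
    obtain d h where "form d h" "h (c *s v) \<noteq> 0" "\<forall>v\<in>C. h v = 0"
      using closedin_zariski_separate[OF assms \<open>c *s v \<noteq> 0\<close> \<open>c *s v \<notin> C\<close>] by auto
    then show False using \<open>v \<in> C\<close> by (simp add: form_homogeneous)
  qed
qed

text \<open>On a cone the values at all multiples of a point force every homogeneous component of
  \<open>f\<close> to vanish. This admits inhomogeneous functions, such as determinants and iterated
  derivatives, in density arguments.\<close>

lemma polyfun_vanishing_closure:
  fixes f :: "'a::field_char_0 ^ 'i::finite \<Rightarrow> 'a"
  assumes "polyfun f" "cone S" "\<And>v. v \<in> S \<Longrightarrow> f v = 0" "x \<in> zariski closure_of S"
  shows "f x = 0"
proof -
  from polyfun_form_decomposition[OF assms(1)]
  obtain g m where g: "\<And>e. form e (g e)" "f = (\<lambda>v. \<Sum>e\<le>m. g e v)" by auto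
  have "g e s = 0" if "s \<in> S" "e \<le> m" for s e
  proof (rule homogeneous_sum_eq_zero[where m = m])
    fix c :: 'a assume "c \<noteq> 0"
    then have "f (c *s s) = 0" using assms(2,3) that by (auto simp: cone_def)
    then show "(\<Sum>d\<le>m. c ^ d * g d s) = 0" unfolding g(2) by (simp add: form_homogeneous[OF g(1)])
  qed (fact that)
  then have "g e x = 0" if "e \<le> m" for e
    using assms(4) g(1)[of e] that unfolding zariski_closure_eq by simp
  then show ?thesis unfolding g(2) by simp
qed


section \<open>Polynomial curves and derivatives\<close>

definition curve :: "('i::finite \<Rightarrow> 'a::field poly) \<Rightarrow> 'a \<Rightarrow> 'a ^ 'i" where
  "curve \<gamma> s = (\<chi> i. poly (\<gamma> i) s)"

text \<open>Polynomial functions carry no coefficients; over an infinite field the polynomial in the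
  curve parameter is nevertheless unique, and its formal derivative is available.\<close>

definition restr :: "('a::field ^ 'i::finite \<Rightarrow> 'a) \<Rightarrow> ('i \<Rightarrow> 'a poly) \<Rightarrow> 'a poly" where
  "restr f \<gamma> = (THE p. \<forall>s. poly p s = f (curve \<gamma> s))"

lemma restr_unique:
  fixes p :: "'a::field_char_0 poly"
  assumes "\<And>s. poly p s = f (curve \<gamma> s)"
  shows "restr f \<gamma> = p"
  unfolding restr_def
proof (rule the_equality)
  fix q :: "'a poly" assume "\<forall>s. poly q s = f (curve \<gamma> s)"
  then have "poly q = poly p" using assms by auto
  then show "q = p" by (simp add: poly_eq_poly_eq_iff)
qed (use assms in simp)

lemma ex_restr:
  fixes f :: "'a::field ^ 'i::finite \<Rightarrow> 'a"
  assumes "polyfun f"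
  shows "\<exists>p. \<forall>s. poly p s = f (curve \<gamma> s)"
  using assms
proof induction
  case (polyfun_const c)
  show ?case by (rule exI[of _ "[:c:]"]) simp
next
  case (polyfun_coord i)
  show ?case by (rule exI[of _ "\<gamma> i"]) (simp add: curve_def)
next
  case (polyfun_add f g)
  then obtain p q where "\<forall>s. poly p s = f (curve \<gamma> s)" "\<forall>s. poly q s = g (curve \<gamma> s)" by auto
  then show ?case by (intro exI[of _ "p + q"]) simp
next
  case (polyfun_mult f g)
  then obtain p q where "\<forall>s. poly p s = f (curve \<gamma> s)" "\<forall>s. poly q s = g (curve \<gamma> s)" by auto
  then show ?case by (intro exI[of _ "p * q"]) simp
qed

lemma poly_restr:
  fixes f :: "'a::field_char_0 ^ 'i::finite \<Rightarrow> 'a"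
  assumes "polyfun f"
  shows "poly (restr f \<gamma>) s = f (curve \<gamma> s)"
proof -
  obtain p where "\<forall>s. poly p s = f (curve \<gamma> s)" using ex_restr[OF assms] by auto
  then show ?thesis using restr_unique[of p f \<gamma>] by simp
qed

lemma restr_const: "restr (\<lambda>v. c) \<gamma> = [:c::'a::field_char_0:]"
  by (rule restr_unique) simp

lemma restr_coord: "restr (\<lambda>v. v $ i) \<gamma> = (\<gamma> i :: 'a::field_char_0 poly)"
  by (rule restr_unique) (simp add: curve_def)

lemma restr_add: 
  "polyfun f \<Longrightarrow> polyfun g \<Longrightarrow> restr (\<lambda>v. f v + g v) \<gamma> = restr f \<gamma> + (restr g \<gamma> :: 'a::field_char_0 poly)"
  by (rule restr_unique) (simp add: poly_restr)

lemma restr_mult: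
  "polyfun f \<Longrightarrow> polyfun g \<Longrightarrow> restr (\<lambda>v. f v * g v) \<gamma> = restr f \<gamma> * (restr g \<gamma> :: 'a::field_char_0 poly)"
  by (rule restr_unique) (simp add: poly_restr)

text \<open>The usual partial derivative; the pairs of coefficients describe the line through
  \<open>v\<close> parallel to axis \<open>i\<close>.\<close>

definition pd :: "'i::finite \<Rightarrow> ('a::field_char_0 ^ 'i \<Rightarrow> 'a) \<Rightarrow> 'a ^ 'i \<Rightarrow> 'a" where
  "pd i f v = poly (pderiv (restr f (\<lambda>j. [:v $ j, if j = i then 1 else 0:]))) 0"

lemma curve_line_0: "curve (\<lambda>j. [:v $ j, c j:]) 0 = v"
  by (simp add: curve_def vec_eq_iff)

lemma pd_const: "pd i (\<lambda>v. c) = (\<lambda>v. 0)"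
  by (auto simp: pd_def restr_const pderiv_pCons)

lemma pd_coord: "pd i (\<lambda>v. v $ j) = (\<lambda>v. if j = i then 1 else 0)"
  by (auto simp: pd_def restr_coord pderiv_pCons)

lemma pd_add: "polyfun f \<Longrightarrow> polyfun g \<Longrightarrow> pd i (\<lambda>v. f v + g v) = (\<lambda>v. pd i f v + pd i g v)"
  by (auto simp: pd_def restr_add pderiv_add)

lemma pd_mult: "polyfun f \<Longrightarrow> polyfun g \<Longrightarrow> pd i (\<lambda>v. f v * g v) = (\<lambda>v. f v * pd i g v + g v * pd i f v)"
  by (auto simp: pd_def restr_mult pderiv_mult poly_restr curve_line_0)

lemma polyfun_pd: "polyfun f \<Longrightarrow> polyfun (pd i f)"
proof (induction rule: polyfun.induct)
  case (polyfun_coord j) show ?case unfolding pd_coord by (rule polyfun_intros)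
qed (auto simp: pd_const pd_add pd_mult intro: polyfun_intros)

text \<open>The chain rule, by induction over the construction of \<open>f\<close>. It turns curves
  inside a set into tangent vectors.\<close>

lemma pderiv_restr:
  fixes f :: "'a::field_char_0 ^ 'i::finite \<Rightarrow> 'a"
  assumes "polyfun f"
  shows "poly (pderiv (restr f \<gamma>)) s = (\<Sum>i\<in>UNIV. pd i f (curve \<gamma> s) * poly (pderiv (\<gamma> i)) s)"
  using assms
proof induction
  case (polyfun_const c)
  show ?case by (simp add: restr_const pd_const pderiv_pCons)
next
  case (polyfun_coord j)
  have "(\<Sum>i\<in>UNIV. (if j = i then 1 else 0) * poly (pderiv (\<gamma> i)) s)
      = (\<Sum>i\<in>UNIV. if j = i then poly (pderiv (\<gamma> i)) s else 0)" by (rule sum.cong) auto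
  then show ?case by (simp add: restr_coord pd_coord)
next
  case (polyfun_add f g)
  then show ?case by (simp add: restr_add pd_add pderiv_add sum.distrib distrib_right)
next
  case (polyfun_mult f g)
  then show ?case
    by (simp add: restr_mult pd_mult pderiv_mult poly_restr sum.distrib distrib_right sum_distrib_left mult.assoc)
qed

text \<open>Two points of \<open>S\<close> can be joined by a rational curve almost all of whose points lie in \<open>S\<close>;
  this replaces irreducibility of the parameter space.\<close>

definition rationally_connected :: "('a::field ^ 'i::finite) set \<Rightarrow> bool" where
  "rationally_connected S \<longleftrightarrow>
     (\<forall>x\<in>S. \<forall>y\<in>S. \<exists>\<gamma>. curve \<gamma> 0 = x \<and> curve \<gamma> 1 = y \<and> finite {s. curve \<gamma> s \<notin> S})"

text \<open>Along a curve from a point where \<open>f\<close> is nonzero to one where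
  \<open>g\<close> is, both restrictions are nonzero polynomials, whereas almost every parameter is
  a root of their product.\<close>

lemma prime_vanishing:
  fixes f g :: "'a::field_char_0 ^ 'i::finite \<Rightarrow> 'a"
  assumes S: "rationally_connected S" and f: "polyfun f" and g: "polyfun g"
    and 0: "\<And>v. v \<in> S \<Longrightarrow> f v * g v = 0"
  shows "(\<forall>v\<in>S. f v = 0) \<or> (\<forall>v\<in>S. g v = 0)"
proof (rule ccontr)
  assume "\<not> ?thesis"
  then obtain x y where xy: "x \<in> S" "y \<in> S" "f x \<noteq> 0" "g y \<noteq> 0" by auto
  then obtain \<gamma> where \<gamma>: "curve \<gamma> 0 = x" "curve \<gamma> 1 = y" "finite {s. curve \<gamma> s \<notin> S}"
    using S unfolding rationally_connected_def by meson
  let ?p = "restr f \<gamma> * restr g \<gamma>"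
  have "poly (restr f \<gamma>) 0 \<noteq> 0" "poly (restr g \<gamma>) 1 \<noteq> 0"
    using xy \<gamma> by (simp_all add: poly_restr f g)
  then have "?p \<noteq> 0" by auto
  then have "finite {s. poly ?p s = 0}" by (rule poly_roots_finite)
  moreover have "UNIV \<subseteq> {s. poly ?p s = 0} \<union> {s. curve \<gamma> s \<notin> S}"
    using 0 by (auto simp: poly_restr f g)
  ultimately have "finite (UNIV :: 'a set)" using \<gamma>(3) by (meson finite_Un finite_subset)
  then show False using infinite_UNIV_char_0 by blast
qed

lemma irreducible_closure:
  fixes S :: "('a::field_char_0 ^ 'i::finite) set"
  assumes S: "rationally_connected S" "S \<noteq> {}" "0 \<notin> S"
  shows "zariski_irreducible (zariski closure_of S)"
  unfolding zariski_irreducible_def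
proof (intro conjI allI impI)
  have sub: "S \<subseteq> zariski closure_of S"
    using S(3) by (intro closure_of_subset) (auto simp: topspace_zariski)
  then show "zariski closure_of S \<noteq> {}" using S(2) by auto
  fix C D :: "('a ^ 'i) set"
  assume C: "closedin zariski C" and D: "closedin zariski D" and CD: "zariski closure_of S \<subseteq> C \<union> D"
  have "S \<subseteq> C \<or> S \<subseteq> D"
  proof (rule ccontr)
    assume "\<not> ?thesis"
    then obtain x y where xy: "x \<in> S" "x \<notin> C" "y \<in> S" "y \<notin> D" by auto
    have nz: "x \<noteq> 0" "y \<noteq> 0" using xy S(3) by auto
    obtain d f where f: "form d f" "f x \<noteq> 0" "\<forall>v\<in>C. f v = 0"
      using closedin_zariski_separate[OF C nz(1) xy(2)] by auto
    obtain e g where g: "form e g" "g y \<noteq> 0" "\<forall>v\<in>D. g v = 0"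
      using closedin_zariski_separate[OF D nz(2) xy(4)] by auto
    have "f v * g v = 0" if "v \<in> S" for v using that f(3) g(3) CD sub by auto
    then have "(\<forall>v\<in>S. f v = 0) \<or> (\<forall>v\<in>S. g v = 0)"
      by (rule prime_vanishing[OF S(1) form_polyfun[OF f(1)] form_polyfun[OF g(1)]])
    then show False using f(2) g(2) xy by auto
  qed
  then show "zariski closure_of S \<subseteq> C \<or> zariski closure_of S \<subseteq> D"
    using C D closure_of_minimal by blast
qed


section \<open>Polynomial vector fields\<close>

definition vf :: "('i::finite \<Rightarrow> 'a::field_char_0 ^ 'i \<Rightarrow> 'a) \<Rightarrow> ('a ^ 'i \<Rightarrow> 'a) \<Rightarrow> 'a ^ 'i \<Rightarrow> 'a" where
  "vf P f v = (\<Sum>i\<in>UNIV. P i v * pd i f v)"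

lemma vf_const: "vf P (\<lambda>v. c) = (\<lambda>v. 0)"
  by (auto simp: vf_def pd_const)

lemma vf_coord: "vf P (\<lambda>v. v $ j) = P j"
proof -
  have "(\<Sum>i\<in>UNIV. P i v * (if j = i then 1 else 0)) = (\<Sum>i\<in>UNIV. if j = i then P i v else 0)" for v
    by (rule sum.cong) auto
  then show ?thesis by (auto simp: vf_def pd_coord)
qed

lemma vf_add: "polyfun f \<Longrightarrow> polyfun g \<Longrightarrow> vf P (\<lambda>v. f v + g v) = (\<lambda>v. vf P f v + vf P g v)"
  by (auto simp: vf_def pd_add sum.distrib algebra_simps)

lemma vf_mult: "polyfun f \<Longrightarrow> polyfun g \<Longrightarrow> vf P (\<lambda>v. f v * g v) = (\<lambda>v. f v * vf P g v + g v * vf P f v)"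
  by (auto simp: vf_def pd_mult sum.distrib sum_distrib_left algebra_simps)

lemma polyfun_vf: "(\<And>i. polyfun (P i)) \<Longrightarrow> polyfun f \<Longrightarrow> polyfun (vf P f)"
  unfolding vf_def[abs_def] by (intro polyfun_intros polyfun_pd)

lemma vf_scale: "polyfun f \<Longrightarrow> vf P (\<lambda>v. c * f v) = (\<lambda>v. c * vf P f v)"
  by (simp add: vf_mult polyfun_const vf_const)

lemma vf_minus: "polyfun f \<Longrightarrow> vf P (\<lambda>v. - f v) = (\<lambda>v. - vf P f v)"
  using vf_scale[of f P "-1"] by simp

lemma vf_diff: "polyfun f \<Longrightarrow> polyfun g \<Longrightarrow> vf P (\<lambda>v. f v - g v) = (\<lambda>v. vf P f v - vf P g v)"
  using vf_add[of f "\<lambda>v. - g v" P] by (simp add: vf_minus polyfun_minus)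

lemma vf_sum:
  assumes "\<And>j. j \<in> A \<Longrightarrow> polyfun (f j)"
  shows "vf P (\<lambda>v. \<Sum>j\<in>A. f j v) = (\<lambda>v. \<Sum>j\<in>A. vf P (f j) v)"
  using assms
proof (induction A rule: infinite_finite_induct)
  case (insert x F)
  then show ?case by (simp add: vf_add polyfun_sum)
qed (simp_all add: vf_const)

lemma vf_pairing: "vf P (pairing h) = (\<lambda>v. \<Sum>i\<in>UNIV. h $ i * P i v)"
proof -
  have "vf P (pairing h) = (\<lambda>v. \<Sum>i\<in>UNIV. vf P (\<lambda>v. h $ i * v $ i) v)"
    unfolding pairing_def by (rule vf_sum) (intro polyfun_intros)
  then show ?thesis by (simp add: vf_scale polyfun_coord vf_coord)
qed

definition grad :: "('a::field_char_0 ^ 'i::finite \<Rightarrow> 'a) \<Rightarrow> 'a ^ 'i \<Rightarrow> 'a ^ 'i" where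
  "grad f v = (\<chi> i. pd i f v)"

lemma vf_eq_grad: "vf P f v = pairing (grad f v) (\<chi> i. P i v)"
  by (simp add: vf_def grad_def pairing_def mult.commute)

lemma grad_const: "grad (\<lambda>v. c) x = 0"
  by (simp add: grad_def pd_const vec_eq_iff)

lemma grad_add: "polyfun f \<Longrightarrow> polyfun g \<Longrightarrow> grad (\<lambda>v. f v + g v) x = grad f x + grad g x"
  by (simp add: grad_def pd_add vec_eq_iff)

lemma grad_mult: "polyfun f \<Longrightarrow> polyfun g \<Longrightarrow> grad (\<lambda>v. f v * g v) x = f x *s grad g x + g x *s grad f x"
  by (simp add: grad_def pd_mult vec_eq_iff)

lemma grad_scale: "polyfun f \<Longrightarrow> grad (\<lambda>v. c * f v) x = c *s grad f x"
  by (simp add: grad_mult polyfun_const grad_const)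

lemma grad_diff: "polyfun f \<Longrightarrow> polyfun g \<Longrightarrow> grad (\<lambda>v. f v - g v) x = grad f x - grad g x"
  using grad_add[of f "\<lambda>v. (-1) * g v" x] grad_scale[of g "-1" x]
  by (simp add: polyfun_mult polyfun_const polyfun_minus vec_eq_iff)

lemma grad_pairing: "grad (pairing h) x = h"
proof -
  have "pd i (pairing h) x = vf (\<lambda>j v. if j = i then 1 else 0) (pairing h) x" for i
  proof -
    have "(\<Sum>j\<in>UNIV. (if j = i then 1 else 0) * pd j (pairing h) x)
       = (\<Sum>j\<in>UNIV. if j = i then pd j (pairing h) x else 0)" by (rule sum.cong) auto
    then show ?thesis by (simp add: vf_def)
  qed
  moreover have "(\<Sum>j\<in>UNIV. h $ j * (if j = i then 1 else 0)) = h $ i" for i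
  proof -
    have "(\<Sum>j\<in>UNIV. h $ j * (if j = i then 1 else 0)) = (\<Sum>j\<in>UNIV. if j = i then h $ j else 0)"
      by (rule sum.cong) auto
    then show ?thesis by simp
  qed
  ultimately show ?thesis by (simp add: grad_def vec_eq_iff vf_pairing)
qed

text \<open>Differentiate the restriction of \<open>f\<close> to the line
  \<open>(1 + s) *s x\<close>, which is \<open>(1 + s) ^ d * f x\<close>, at
  \<open>s = 0\<close>.\<close>

lemma euler_form:
  assumes "form d f"
  shows "pairing (grad f x) x = of_nat d * f x"
proof -
  let ?\<gamma> = "\<lambda>i. [:x $ i, x $ i:]"
  have c: "curve ?\<gamma> s = (1 + s) *s x" for s by (simp add: curve_def vec_eq_iff algebra_simps)
  have "restr f ?\<gamma> = smult (f x) ([:1, 1:] ^ d)"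
    by (rule restr_unique) (subst c, subst form_homogeneous[OF assms], simp add: mult.commute)
  then have "poly (pderiv (restr f ?\<gamma>)) 0 = of_nat d * f x"
    by (simp add: pderiv_smult pderiv_power pderiv_pCons)
  moreover have "poly (pderiv (restr f ?\<gamma>)) 0 = pairing (grad f x) x"
    using pderiv_restr[OF form_polyfun[OF assms], of ?\<gamma> 0] curve_line_0[of x "\<lambda>i. x $ i"]
    by (simp add: pairing_def grad_def pderiv_pCons)
  ultimately show ?thesis by simp
qed


section \<open>Order of vanishing along a cone\<close>

text \<open>Powers of the maximal ideal of a point \<open>x\<close> of affine space.\<close>

inductive mpow :: "'a::field ^ 'i::finite \<Rightarrow> nat \<Rightarrow> ('a ^ 'i \<Rightarrow> 'a) \<Rightarrow> bool" for x where
  mpow_0: "polyfun f \<Longrightarrow> mpow x 0 f"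
| mpow_Suc: "polyfun f \<Longrightarrow> f x = 0 \<Longrightarrow> mpow x q g \<Longrightarrow> mpow x (Suc q) (\<lambda>v. f v * g v)"
| mpow_add: "mpow x q f \<Longrightarrow> mpow x q g \<Longrightarrow> mpow x q (\<lambda>v. f v + g v)"

lemma mpow_polyfun: "mpow x q f \<Longrightarrow> polyfun f"
  by (induction rule: mpow.induct) (auto intro: polyfun_intros)

lemma mpow_mult_polyfun: "mpow x q g \<Longrightarrow> polyfun f \<Longrightarrow> mpow x q (\<lambda>v. f v * g v)"
proof (induction arbitrary: f rule: mpow.induct)
  case (mpow_0 g) then show ?case by (auto intro: mpow.mpow_0 polyfun_intros)
next
  case (mpow_Suc h q g)
  then have "mpow x (Suc q) (\<lambda>v. h v * (f v * g v))" by (intro mpow.mpow_Suc) auto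
  moreover have "(\<lambda>v. h v * (f v * g v)) = (\<lambda>v. f v * (h v * g v))" by (simp add: mult.left_commute)
  ultimately show ?case by simp
next
  case (mpow_add q g h)
  then have "mpow x q (\<lambda>v. f v * g v + f v * h v)" by (intro mpow.mpow_add) auto
  then show ?case by (simp add: distrib_left)
qed

lemma mpow_SucD: "mpow x (Suc q) f \<Longrightarrow> mpow x q f"
proof (induction "Suc q" f rule: mpow.induct)
  case (mpow_Suc f g) then show ?case by (auto intro: mpow_mult_polyfun)
qed (auto intro: mpow.mpow_add)

lemma mpow_mult: "mpow x p f \<Longrightarrow> mpow x q g \<Longrightarrow> mpow x (p + q) (\<lambda>v. f v * g v)"
proof (induction rule: mpow.induct)
  case (mpow_0 f) then show ?case by (auto intro: mpow_mult_polyfun)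
next
  case (mpow_Suc h p f)
  then have "mpow x (Suc (p + q)) (\<lambda>v. h v * (f v * g v))" by (intro mpow.mpow_Suc) auto
  then show ?case by (simp add: mult.assoc)
next
  case (mpow_add p f h)
  then have "mpow x (p + q) (\<lambda>v. f v * g v + h v * g v)" by (intro mpow.mpow_add) auto
  then show ?case by (simp add: distrib_right)
qed

lemma mpow_1: "polyfun f \<Longrightarrow> f x = 0 \<Longrightarrow> mpow x (Suc 0) f"
  using mpow_Suc[OF _ _ mpow_0[OF polyfun_const[of 1]], of f x] by simp

lemma mpow_eval: "mpow x (Suc q) f \<Longrightarrow> f x = 0"
  by (induction "Suc q" f rule: mpow.induct) auto

text \<open>By the product rule a derivation costs at most one factor vanishing at \<open>x\<close>;
  the truncated subtraction covers \<open>q = 0\<close>.\<close>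

lemma mpow_vf:
  assumes P: "\<And>i. polyfun (P i)"
  shows "mpow x q f \<Longrightarrow> mpow x (q - 1) (vf P f)"
proof (induction rule: mpow.induct)
  case (mpow_0 f) then show ?case by (auto intro: mpow.mpow_0 polyfun_vf P)
next
  case (mpow_Suc f q g)
  have g: "polyfun g" using mpow_Suc by (auto dest: mpow_polyfun)
  have "mpow x q (\<lambda>v. f v * vf P g v)"
  proof (cases q)
    case 0 then show ?thesis using mpow_Suc g by (auto intro!: mpow.mpow_0 polyfun_intros polyfun_vf P)
  next
    case (Suc q') then show ?thesis using mpow_Suc by (auto intro: mpow.mpow_Suc)
  qed
  moreover have "mpow x q (\<lambda>v. vf P f v * g v)"
    using mpow_Suc by (auto intro: mpow_mult_polyfun polyfun_vf P)
  ultimately have "mpow x q (\<lambda>v. f v * vf P g v + vf P f v * g v)" by (rule mpow_add)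
  then show ?case using mpow_Suc g by (simp add: vf_mult mult.commute)
next
  case (mpow_add q f g)
  have "polyfun f" "polyfun g" using mpow_add by (auto dest: mpow_polyfun)
  then show ?case using mpow.mpow_add[OF mpow_add.IH] by (simp add: vf_add)
qed

text \<open>Membership in the \<open>q\<close>-th power of the maximal ideal of the local ring of
  the affine set \<open>X\<close> at \<open>x\<close>: \<open>H\<close> is a denominator, and
  equality on \<open>X\<close> works modulo the ideal of \<open>X\<close>.\<close>

definition vanish_order :: "('a::field ^ 'i::finite) set \<Rightarrow> 'a ^ 'i \<Rightarrow> nat \<Rightarrow> ('a ^ 'i \<Rightarrow> 'a) \<Rightarrow> bool" where
  "vanish_order X x q F \<longleftrightarrow> polyfun F \<and>
     (\<exists>H G. polyfun H \<and> H x \<noteq> 0 \<and> mpow x q G \<and> (\<forall>v\<in>X. H v * F v = G v))"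

lemma vanish_orderI:
  "polyfun F \<Longrightarrow> polyfun H \<Longrightarrow> H x \<noteq> 0 \<Longrightarrow> mpow x q G \<Longrightarrow> (\<And>v. v \<in> X \<Longrightarrow> H v * F v = G v) \<Longrightarrow> vanish_order X x q F"
  unfolding vanish_order_def by auto

lemma vanish_orderE:
  assumes "vanish_order X x q F"
  obtains H G where "polyfun F" "polyfun H" "H x \<noteq> 0" "mpow x q G" "\<forall>v\<in>X. H v * F v = G v"
  using assms unfolding vanish_order_def by auto

lemma mpow_vanish_order: "mpow x q F \<Longrightarrow> vanish_order X x q F"
  by (rule vanish_orderI[where H = "\<lambda>v. 1" and G = F]) (auto intro: polyfun_const mpow_polyfun)

lemma vanish_order_add:
  assumes "vanish_order X x q f" "vanish_order X x q g"
  shows "vanish_order X x q (\<lambda>v. f v + g v)"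
proof -
  obtain H G where 1: "polyfun f" "polyfun H" "H x \<noteq> 0" "mpow x q G" "\<forall>v\<in>X. H v * f v = G v"
    using assms(1) by (rule vanish_orderE)
  obtain K L where 2: "polyfun g" "polyfun K" "K x \<noteq> 0" "mpow x q L" "\<forall>v\<in>X. K v * g v = L v"
    using assms(2) by (rule vanish_orderE)
  show ?thesis
  proof (rule vanish_orderI[where H = "\<lambda>v. H v * K v" and G = "\<lambda>v. K v * G v + H v * L v"])
    show "mpow x q (\<lambda>v. K v * G v + H v * L v)"
      using 1 2 by (intro mpow_add mpow_mult_polyfun)
    show "H v * K v * (f v + g v) = K v * G v + H v * L v" if "v \<in> X" for v
      using bspec[OF 1(5) that, symmetric] bspec[OF 2(5) that, symmetric] by (simp add: algebra_simps)
  qed (use 1 2 in \<open>auto intro: polyfun_intros\<close>)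
qed

lemma vanish_order_mult:
  assumes "vanish_order X x p f" "vanish_order X x q g"
  shows "vanish_order X x (p + q) (\<lambda>v. f v * g v)"
proof -
  obtain H G where 1: "polyfun f" "polyfun H" "H x \<noteq> 0" "mpow x p G" "\<forall>v\<in>X. H v * f v = G v"
    using assms(1) by (rule vanish_orderE)
  obtain K L where 2: "polyfun g" "polyfun K" "K x \<noteq> 0" "mpow x q L" "\<forall>v\<in>X. K v * g v = L v"
    using assms(2) by (rule vanish_orderE)
  show ?thesis
  proof (rule vanish_orderI[where H = "\<lambda>v. H v * K v" and G = "\<lambda>v. G v * L v"])
    show "mpow x (p + q) (\<lambda>v. G v * L v)" using 1 2 by (intro mpow_mult)
    show "H v * K v * (f v * g v) = G v * L v" if "v \<in> X" for v
      using bspec[OF 1(5) that, symmetric] bspec[OF 2(5) that, symmetric] by (simp add: algebra_simps)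
  qed (use 1 2 in \<open>auto intro: polyfun_intros\<close>)
qed

lemma vanish_order_0: "polyfun f \<Longrightarrow> vanish_order X x 0 f"
  by (intro mpow_vanish_order mpow_0)

lemma vanish_order_1: "polyfun f \<Longrightarrow> f x = 0 \<Longrightarrow> vanish_order X x (Suc 0) f"
  by (intro mpow_vanish_order mpow_1)

lemma vanish_order_polyfun_mult: "polyfun f \<Longrightarrow> vanish_order X x q g \<Longrightarrow> vanish_order X x q (\<lambda>v. f v * g v)"
  using vanish_order_mult[OF vanish_order_0, of f X x q g] by simp

lemma vanish_order_minus: "vanish_order X x q g \<Longrightarrow> vanish_order X x q (\<lambda>v. - g v)"
  using vanish_order_polyfun_mult[OF polyfun_const[of "-1"], of X x q g] by simp

lemma vanish_order_diff: "vanish_order X x q f \<Longrightarrow> vanish_order X x q g \<Longrightarrow> vanish_order X x q (\<lambda>v. f v - g v)"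
  using vanish_order_add[OF _ vanish_order_minus, of X x q f g] by simp

lemma mpow_zero: "mpow x q (\<lambda>v. 0)"
proof (induction q)
  case 0 show ?case by (intro mpow_0 polyfun_const)
next
  case (Suc q) then show ?case using mpow_Suc[OF polyfun_const[of 0], of x q "\<lambda>v. 0"] by simp
qed

lemma vanish_order_vanishing:
  assumes "polyfun f" "\<And>v. v \<in> X \<Longrightarrow> f v = 0"
  shows "vanish_order X x q f"
  by (rule vanish_orderI[where H = "\<lambda>v. 1" and G = "\<lambda>v. 0"])
    (use assms mpow_zero in \<open>auto intro: polyfun_const\<close>)

lemma vanish_order_cong:
  assumes "vanish_order X x q f" "polyfun g" "\<And>v. v \<in> X \<Longrightarrow> f v = g v"
  shows "vanish_order X x q g"
  using assms unfolding vanish_order_def by auto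

lemma vanish_order_sum:
  "(\<And>j. j \<in> A \<Longrightarrow> vanish_order X x q (f j)) \<Longrightarrow> vanish_order X x q (\<lambda>v. \<Sum>j\<in>A. f j v)"
  by (induction A rule: infinite_finite_induct)
    (auto intro: vanish_order_add vanish_order_vanishing polyfun_const)

lemma vanish_order_cancel_unit:
  assumes "vanish_order X x q (\<lambda>v. h v * f v)" "polyfun f" "polyfun h" "h x \<noteq> 0"
  shows "vanish_order X x q f"
proof -
  obtain H G where "polyfun H" "H x \<noteq> 0" "mpow x q G" "\<forall>v\<in>X. H v * (h v * f v) = G v"
    using assms(1) by (rule vanish_orderE)
  then show ?thesis
    using assms by (intro vanish_orderI[where H = "\<lambda>v. H v * h v" and G = G]) (auto intro: polyfun_intros simp: mult.assoc)
qed

lemma vanish_order_eval: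
  assumes "vanish_order X x (Suc q) f" "x \<in> X"
  shows "f x = 0"
proof -
  obtain H G where "H x \<noteq> 0" "mpow x (Suc q) G" "\<forall>v\<in>X. H v * f v = G v"
    using assms(1) by (rule vanish_orderE)
  then show ?thesis using mpow_eval[of x q G] assms(2) by (metis mult_eq_0_iff)
qed

text \<open>Derivations that preserve the ideal of \<open>X\<close>. Tangency is asked along all of
  \<open>X\<close>, not only at one point, because the fields are to be iterated.\<close>

definition tangent_field :: "('a::field_char_0 ^ 'i::finite) set \<Rightarrow> ('i \<Rightarrow> 'a ^ 'i \<Rightarrow> 'a) \<Rightarrow> bool" where
  "tangent_field X P \<longleftrightarrow> (\<forall>i. polyfun (P i)) \<and>
     (\<forall>f. polyfun f \<longrightarrow> (\<forall>v\<in>X. f v = 0) \<longrightarrow> (\<forall>v\<in>X. vf P f v = 0))"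

lemma tangent_fieldD:
  assumes "tangent_field X P"
  shows "polyfun (P i)"
    and "polyfun f \<Longrightarrow> (\<And>v. v \<in> X \<Longrightarrow> f v = 0) \<Longrightarrow> v \<in> X \<Longrightarrow> vf P f v = 0"
  using assms unfolding tangent_field_def by auto

lemma vanish_order_vf:
  assumes P: "tangent_field X P" and f: "vanish_order X x q f"
  shows "vanish_order X x (q - 1) (vf P f)"
proof -
  note pP = tangent_fieldD(1)[OF P]
  obtain H G where 1: "polyfun f" "polyfun H" "H x \<noteq> 0" "mpow x q G" "\<forall>v\<in>X. H v * f v = G v"
    using f by (rule vanish_orderE)
  have G: "polyfun G" using 1 mpow_polyfun by blast
  have D: "H v * vf P f v + f v * vf P H v = vf P G v" if "v \<in> X" for v
  proof -
    have "vf P (\<lambda>v. H v * f v - G v) v = 0"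
      by (rule tangent_fieldD(2)[OF P _ _ that]) (use 1 G in \<open>auto intro: polyfun_intros\<close>)
    then show ?thesis using 1 G by (simp add: vf_diff vf_mult polyfun_mult)
  qed
  \<comment> \<open>Quotient rule: on \<open>X\<close> the identity \<open>D\<close> expresses
    \<open>H * vf P f\<close>; multiplying it by \<open>H\<close> once more replaces
    \<open>H * f\<close> by \<open>G\<close>.\<close>
  show ?thesis
  proof (rule vanish_orderI[where H = "\<lambda>v. H v * H v" and G = "\<lambda>v. H v * vf P G v + (- vf P H v) * G v"])
    show "mpow x (q - 1) (\<lambda>v. H v * vf P G v + (- vf P H v) * G v)"
    proof (intro mpow_add mpow_mult_polyfun)
      show "mpow x (q - 1) (vf P G)" by (rule mpow_vf[OF pP 1(4)])
      show "mpow x (q - 1) G" using 1(4) mpow_SucD by (cases q) auto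
    qed (use 1 pP in \<open>auto intro: polyfun_intros polyfun_vf\<close>)
    show "H v * H v * vf P f v = H v * vf P G v + - vf P H v * G v" if "v \<in> X" for v
    proof -
      have "G v = H v * f v" using 1(5) that by simp
      then show ?thesis unfolding D[OF that, symmetric] by (simp add: algebra_simps)
    qed
  qed (use 1 pP in \<open>auto intro: polyfun_intros polyfun_vf\<close>)
qed

primrec iter_vf :: "('l \<Rightarrow> 'i::finite \<Rightarrow> 'a::field_char_0 ^ 'i \<Rightarrow> 'a) \<Rightarrow> 'l list \<Rightarrow> ('a ^ 'i \<Rightarrow> 'a) \<Rightarrow> 'a ^ 'i \<Rightarrow> 'a" where
  "iter_vf P [] f = f"
| "iter_vf P (l # w) f = iter_vf P w (vf (P l) f)"

lemma polyfun_iter_vf: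
  "(\<And>l i. l \<in> set w \<Longrightarrow> polyfun (P l i)) \<Longrightarrow> polyfun f \<Longrightarrow> polyfun (iter_vf P w f)"
  by (induction w arbitrary: f) (auto intro: polyfun_vf)

lemma iter_vf_vanish_order:
  assumes "\<And>l. l \<in> set w \<Longrightarrow> tangent_field X (P l)" "vanish_order X x q f"
  shows "vanish_order X x (q - length w) (iter_vf P w f)"
  using assms
proof (induction w arbitrary: f q)
  case (Cons l w)
  have "vanish_order X x (q - 1) (vf (P l) f)" using Cons.prems by (intro vanish_order_vf) auto
  then have "vanish_order X x (q - 1 - length w) (iter_vf P w (vf (P l) f))"
    using Cons.prems by (intro Cons.IH) auto
  then show ?case by simp
qed simp

lemma iter_vf_eval:
  assumes "\<And>l. l \<in> set w \<Longrightarrow> tangent_field X (P l)" "vanish_order X x q f" "length w < q" "x \<in> X"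
  shows "iter_vf P w f x = 0"
proof -
  have "Suc (q - length w - 1) = q - length w" using assms(3) by simp
  then have "vanish_order X x (Suc (q - length w - 1)) (iter_vf P w f)"
    using iter_vf_vanish_order[where P = P, OF assms(1,2)] by simp
  then show ?thesis using vanish_order_eval assms(4) by blast
qed

text \<open>Vector fields \<open>P l\<close> with coefficient functions \<open>u l\<close> that reconstruct every coordinate to first
  order at \<open>x\<close>; they play the role of the partial derivatives with respect to local parameters \<open>u l\<close>.\<close>

locale local_frame =
  fixes X :: "('a::field_char_0 ^ 'i::finite) set" and x :: "'a ^ 'i"
    and L :: "'l set" and P :: "'l \<Rightarrow> 'i \<Rightarrow> 'a ^ 'i \<Rightarrow> 'a" and u :: "'l \<Rightarrow> 'a ^ 'i \<Rightarrow> 'a"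
  assumes fin: "finite L" and xX: "x \<in> X"
    and tangent: "\<And>l. l \<in> L \<Longrightarrow> tangent_field X (P l)"
    and u: "\<And>l. l \<in> L \<Longrightarrow> polyfun (u l)" "\<And>l. l \<in> L \<Longrightarrow> u l x = 0"
    and frame: "\<And>i. vanish_order X x 2 (\<lambda>v. v $ i - x $ i - (\<Sum>l\<in>L. u l v * P l i x))"
begin

lemma pP: "l \<in> L \<Longrightarrow> polyfun (P l i)"
  using tangent tangent_fieldD(1) by blast

lemma polyfun_uD: "polyfun f \<Longrightarrow> polyfun (\<lambda>v. \<Sum>l\<in>L. u l v * vf (P l) f v)"
  by (intro polyfun_sum polyfun_mult u(1) polyfun_vf pP)

text \<open>Taylor's formula to first order, with the derivatives taken at the moving point
  \<open>v\<close> instead of \<open>x\<close>. This changes the sum only by terms of order 2, since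
  each \<open>u l\<close> vanishes at \<open>x\<close>.\<close>

lemma first_order:
  assumes "polyfun f"
  shows "vanish_order X x 2 (\<lambda>v. f v - f x - (\<Sum>l\<in>L. u l v * vf (P l) f v))"
  using assms
proof induction
  case (polyfun_const c)
  show ?case by (simp add: vf_const) (intro vanish_order_vanishing polyfun.polyfun_const refl)
next
  case (polyfun_coord i)
  have "vanish_order X x (1 + 1) (\<lambda>v. u l v * (P l i v - P l i x))" if "l \<in> L" for l
    using that u pP by (intro vanish_order_mult) (auto intro!: vanish_order_1 polyfun_intros)
  then have "vanish_order X x 2 (\<lambda>v. \<Sum>l\<in>L. u l v * (P l i v - P l i x))"
    by (intro vanish_order_sum) (simp add: numeral_2_eq_2)
  from vanish_order_diff[OF frame[of i] this]
  show ?case by (simp add: vf_coord algebra_simps sum.distrib sum_subtractf)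
next
  case (polyfun_add f g)
  from vanish_order_add[OF polyfun_add.IH]
  show ?case using polyfun_add.hyps by (simp add: vf_add algebra_simps sum.distrib)
next
  case (polyfun_mult f g)
  have 1: "vanish_order X x 2 (\<lambda>v. f v * (g v - g x - (\<Sum>l\<in>L. u l v * vf (P l) g v)))"
    by (intro vanish_order_polyfun_mult polyfun_mult)
  have 2: "vanish_order X x 2 (\<lambda>v. g v * (f v - f x - (\<Sum>l\<in>L. u l v * vf (P l) f v)))"
    by (intro vanish_order_polyfun_mult polyfun_mult)
  have "vanish_order X x (1 + 1) (\<lambda>v. (f v - f x) * (g v - g x))"
    using polyfun_mult.hyps by (intro vanish_order_mult) (auto intro!: vanish_order_1 polyfun_intros)
  then have 3: "vanish_order X x 2 (\<lambda>v. (f v - f x) * (g v - g x))" by (simp add: numeral_2_eq_2)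
  \<comment> \<open>The last term corrects the product rule, whose factors \<open>f v\<close> and
    \<open>g v\<close> are values at \<open>v\<close> and not at \<open>x\<close>.\<close>
  have eq: "f v * g v - f x * g x - (\<Sum>l\<in>L. u l v * vf (P l) (\<lambda>v. f v * g v) v)
     = (f v * (g v - g x - (\<Sum>l\<in>L. u l v * vf (P l) g v)) + g v * (f v - f x - (\<Sum>l\<in>L. u l v * vf (P l) f v)))
       - (f v - f x) * (g v - g x)" for v
  proof -
    have "(\<Sum>l\<in>L. u l v * vf (P l) (\<lambda>v. f v * g v) v)
      = f v * (\<Sum>l\<in>L. u l v * vf (P l) g v) + g v * (\<Sum>l\<in>L. u l v * vf (P l) f v)"
      using polyfun_mult.hyps
      by (simp add: vf_mult sum_distrib_left sum.distrib[symmetric] algebra_simps)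
    then show ?thesis by (simp add: algebra_simps)
  qed
  show ?case unfolding eq by (rule vanish_order_diff[OF vanish_order_add[OF 1 2] 3])
qed

text \<open>Euler's identity for functions of order \<open>q\<close>, modulo higher order.\<close>

lemma euler_mpow:
  assumes "mpow x q f"
  shows "vanish_order X x (Suc q) (\<lambda>v. of_nat q * f v - (\<Sum>l\<in>L. u l v * vf (P l) f v))"
  using assms
proof induction
  case (mpow_0 f)
  have "vanish_order X x (Suc 0) (\<lambda>v. \<Sum>l\<in>L. u l v * vf (P l) f v)"
    by (intro vanish_order_1 polyfun_uD mpow_0) (simp add: u)
  from vanish_order_minus[OF this] show ?case by simp
next
  case (mpow_Suc f q g)
  have g: "polyfun g" using mpow_Suc by (auto dest: mpow_polyfun)
  have "vanish_order X x (1 + Suc q) (\<lambda>v. f v * (of_nat q * g v - (\<Sum>l\<in>L. u l v * vf (P l) g v)))"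
    using mpow_Suc by (intro vanish_order_mult) (auto intro: vanish_order_1)
  then have 1: "vanish_order X x (Suc (Suc q)) (\<lambda>v. f v * (of_nat q * g v - (\<Sum>l\<in>L. u l v * vf (P l) g v)))"
    by simp
  have "vanish_order X x (q + 2) (\<lambda>v. g v * (f v - f x - (\<Sum>l\<in>L. u l v * vf (P l) f v)))"
    using mpow_Suc by (intro vanish_order_mult first_order mpow_vanish_order)
  then have 2: "vanish_order X x (Suc (Suc q)) (\<lambda>v. g v * (f v - f x - (\<Sum>l\<in>L. u l v * vf (P l) f v)))"
    by simp
  have eq: "of_nat (Suc q) * (f v * g v) - (\<Sum>l\<in>L. u l v * vf (P l) (\<lambda>v. f v * g v) v)
     = f v * (of_nat q * g v - (\<Sum>l\<in>L. u l v * vf (P l) g v)) + g v * (f v - f x - (\<Sum>l\<in>L. u l v * vf (P l) f v))" for v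
  proof -
    have "(\<Sum>l\<in>L. u l v * vf (P l) (\<lambda>v. f v * g v) v)
      = f v * (\<Sum>l\<in>L. u l v * vf (P l) g v) + g v * (\<Sum>l\<in>L. u l v * vf (P l) f v)"
      using mpow_Suc.hyps g
      by (simp add: vf_mult sum_distrib_left sum.distrib[symmetric] algebra_simps)
    then show ?thesis using mpow_Suc.hyps by (simp add: algebra_simps)
  qed
  show ?case unfolding eq by (rule vanish_order_add[OF 1 2])
next
  case (mpow_add q f g)
  have "polyfun f" "polyfun g" using mpow_add by (auto dest: mpow_polyfun)
  then show ?case using vanish_order_add[OF mpow_add.IH]
    by (simp add: vf_add algebra_simps sum.distrib)
qed

text \<open>Reduces to the numerator \<open>G\<close> of \<open>f\<close>. Differentiating the
  denominator \<open>H\<close> produces terms in which \<open>f\<close> is multiplied by some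
  \<open>u l\<close>, and these gain one order.\<close>

lemma euler_vanish_order:
  assumes "vanish_order X x q f"
  shows "vanish_order X x (Suc q) (\<lambda>v. of_nat q * f v - (\<Sum>l\<in>L. u l v * vf (P l) f v))"
proof -
  obtain H G where 1: "polyfun f" "polyfun H" "H x \<noteq> 0" "mpow x q G" "\<forall>v\<in>X. H v * f v = G v"
    using assms by (rule vanish_orderE)
  have G: "polyfun G" using 1 mpow_polyfun by blast
  have D: "H v * vf (P l) f v + f v * vf (P l) H v = vf (P l) G v" if "v \<in> X" "l \<in> L" for v l
  proof -
    have "vf (P l) (\<lambda>v. H v * f v - G v) v = 0"
      by (rule tangent_fieldD(2)[OF tangent[OF that(2)] _ _ that(1)]) (use 1 G in \<open>auto intro: polyfun_intros\<close>)
    then show ?thesis using 1 G by (simp add: vf_diff vf_mult polyfun_mult)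
  qed
  have "vanish_order X x (1 + q) (\<lambda>v. (\<Sum>l\<in>L. u l v * vf (P l) H v) * f v)"
  proof (rule vanish_order_mult[OF _ assms])
    show "vanish_order X x 1 (\<lambda>v. \<Sum>l\<in>L. u l v * vf (P l) H v)"
      unfolding One_nat_def by (intro vanish_order_1 polyfun_uD 1) (simp add: u)
  qed
  then have 2: "vanish_order X x (Suc q) (\<lambda>v. (\<Sum>l\<in>L. u l v * vf (P l) H v) * f v)" by simp
  have "vanish_order X x (Suc q) (\<lambda>v. H v * (of_nat q * f v - (\<Sum>l\<in>L. u l v * vf (P l) f v)))"
  proof (rule vanish_order_cong[OF vanish_order_add[OF euler_mpow[OF 1(4)] 2]])
    fix v assume v: "v \<in> X"
    have "(\<Sum>l\<in>L. u l v * vf (P l) G v) = (\<Sum>l\<in>L. u l v * (H v * vf (P l) f v + f v * vf (P l) H v))"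
      using D[OF v] by (intro sum.cong) auto
    also have "\<dots> = H v * (\<Sum>l\<in>L. u l v * vf (P l) f v) + (\<Sum>l\<in>L. u l v * vf (P l) H v) * f v"
      by (simp add: sum_distrib_left sum_distrib_right sum.distrib[symmetric] algebra_simps)
    finally show "of_nat q * G v - (\<Sum>l\<in>L. u l v * vf (P l) G v) + (\<Sum>l\<in>L. u l v * vf (P l) H v) * f v
      = H v * (of_nat q * f v - (\<Sum>l\<in>L. u l v * vf (P l) f v))"
      using bspec[OF 1(5) v, symmetric] by (simp add: algebra_simps)
  qed (intro polyfun_mult polyfun_diff polyfun_const polyfun_uD 1)
  then show ?thesis
    by (rule vanish_order_cancel_unit) (intro 1 polyfun_mult polyfun_diff polyfun_const polyfun_uD)+
qed

text \<open>Necessity: each derivative loses one order. Sufficiency: if all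
  \<open>vf (P l) f\<close> have order \<open>q\<close>, their products with \<open>u l\<close> have
  order \<open>q + 1\<close>, and Euler's identity leaves \<open>of_nat q * f\<close>, where
  \<open>q\<close> can be cancelled in characteristic zero.\<close>

theorem vanish_order_iff:
  assumes "polyfun f"
  shows "vanish_order X x q f \<longleftrightarrow> (\<forall>w\<in>lists L. length w < q \<longrightarrow> iter_vf P w f x = 0)"
proof
  assume "vanish_order X x q f"
  then show "\<forall>w\<in>lists L. length w < q \<longrightarrow> iter_vf P w f x = 0"
    using iter_vf_eval[OF _ _ _ xX, of _ P q f] tangent by (auto simp: in_lists_conv_set)
next
  assume "\<forall>w\<in>lists L. length w < q \<longrightarrow> iter_vf P w f x = 0"
  then show "vanish_order X x q f"
    using assms
  proof (induction q arbitrary: f)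
    case 0 then show ?case by (auto intro: vanish_order_0)
  next
    case (Suc q)
    show ?case
    \<comment> \<open>For \<open>q = 0\<close> the factor \<open>of_nat q\<close> cannot be
      cancelled; order 1 just follows from vanishing at \<open>x\<close>.\<close>
    proof (cases "q = 0")
      case True
      have "f x = 0" using bspec[OF Suc.prems(1), of "[]"] by simp
      then show ?thesis using True Suc.prems(2) by (auto intro: vanish_order_1)
    next
      case False
      have f: "vanish_order X x q f" using Suc.prems by (intro Suc.IH) auto
      have "vanish_order X x (1 + q) (\<lambda>v. u l v * vf (P l) f v)" if l: "l \<in> L" for l
      proof (rule vanish_order_mult)
        show "vanish_order X x 1 (u l)" unfolding One_nat_def by (intro vanish_order_1 u l)
        show "vanish_order X x q (vf (P l) f)"
        proof (rule Suc.IH)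
          show "\<forall>w\<in>lists L. length w < q \<longrightarrow> iter_vf P w (vf (P l) f) x = 0"
          proof (intro ballI impI)
            fix w assume "w \<in> lists L" "length w < q"
            then show "iter_vf P w (vf (P l) f) x = 0"
              using bspec[OF Suc.prems(1), of "l # w"] l by simp
          qed
        qed (intro polyfun_vf pP l Suc.prems)
      qed
      then have "vanish_order X x (Suc q) (\<lambda>v. \<Sum>l\<in>L. u l v * vf (P l) f v)"
        by (intro vanish_order_sum) simp
      from vanish_order_add[OF euler_vanish_order[OF f] this]
      have "vanish_order X x (Suc q) (\<lambda>v. of_nat q * f v)" by simp
      then show ?thesis
        by (rule vanish_order_cancel_unit) (use False Suc.prems in \<open>auto intro: polyfun_const\<close>)
    qed
  qed
qed

end


section \<open>Powers of the maximal ideal of a point\<close>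

lemma stalkI:
  "form (d + e) F \<Longrightarrow> form e G \<Longrightarrow> openin zariski U \<Longrightarrow> x \<in> U \<Longrightarrow>
    (\<And>v. v \<in> U \<Longrightarrow> v \<in> X \<Longrightarrow> G v \<noteq> 0 \<and> s v = F v / G v) \<Longrightarrow> s \<in> stalk X d x"
  unfolding stalk_def by (intro CollectI exI[of _ e] exI[of _ F] exI[of _ G] exI[of _ U]) auto

lemma stalkE:
  assumes "s \<in> stalk X d x"
  obtains e F G U where "form (d + e) F" "form e G" "openin zariski U" "x \<in> U"
    "\<forall>v\<in>U \<inter> X. G v \<noteq> 0 \<and> s v = F v / G v"
  using assms unfolding stalk_def by auto

lemma stalk_add:
  assumes "s \<in> stalk X d x" "t \<in> stalk X d x"
  shows "(\<lambda>v. s v + t v) \<in> stalk X d x"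
proof -
  obtain e F G U where 1: "form (d + e) F" "form e G" "openin zariski U" "x \<in> U"
    "\<forall>v\<in>U \<inter> X. G v \<noteq> 0 \<and> s v = F v / G v" using assms(1) by (rule stalkE)
  obtain e' F' G' U' where 2: "form (d + e') F'" "form e' G'" "openin zariski U'" "x \<in> U'"
    "\<forall>v\<in>U' \<inter> X. G' v \<noteq> 0 \<and> t v = F' v / G' v" using assms(2) by (rule stalkE)
  show ?thesis
  proof (rule stalkI[where e = "e + e'" and F = "\<lambda>v. F v * G' v + F' v * G v" and U = "U \<inter> U'"])
    show "form (d + (e + e')) (\<lambda>v. F v * G' v + F' v * G v)"
      using form_mult[OF 1(1) 2(2)] form_mult[OF 2(1) 1(2)] by (intro form_add) (auto simp: ac_simps)
    show "form (e + e') (\<lambda>v. G v * G' v)" using 1 2 by (intro form_mult)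
    show "G v * G' v \<noteq> 0 \<and> s v + t v = (F v * G' v + F' v * G v) / (G v * G' v)" if "v \<in> U \<inter> U'" "v \<in> X" for v
      using 1(5) 2(5) that by (auto simp: add_frac_eq)
  qed (use 1 2 in auto)
qed

lemma stalk_mult:
  assumes "s \<in> stalk X d x" "t \<in> stalk X d' x"
  shows "(\<lambda>v. s v * t v) \<in> stalk X (d + d') x"
proof -
  obtain e F G U where 1: "form (d + e) F" "form e G" "openin zariski U" "x \<in> U"
    "\<forall>v\<in>U \<inter> X. G v \<noteq> 0 \<and> s v = F v / G v" using assms(1) by (rule stalkE)
  obtain e' F' G' U' where 2: "form (d' + e') F'" "form e' G'" "openin zariski U'" "x \<in> U'"
    "\<forall>v\<in>U' \<inter> X. G' v \<noteq> 0 \<and> t v = F' v / G' v" using assms(2) by (rule stalkE)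
  show ?thesis
  proof (rule stalkI[where e = "e + e'" and F = "\<lambda>v. F v * F' v" and U = "U \<inter> U'"])
    show "form (d + d' + (e + e')) (\<lambda>v. F v * F' v)"
      using form_mult[OF 1(1) 2(1)] by (simp add: ac_simps)
    show "form (e + e') (\<lambda>v. G v * G' v)" using 1 2 by (intro form_mult)
    show "G v * G' v \<noteq> 0 \<and> s v * t v = (F v * F' v) / (G v * G' v)" if "v \<in> U \<inter> U'" "v \<in> X" for v
      using 1(5) 2(5) that by auto
  qed (use 1 2 in auto)
qed

lemma stalk_inverse:
  assumes "s \<in> stalk X 0 x" "s x \<noteq> 0" "x \<in> X"
  shows "(\<lambda>v. inverse (s v)) \<in> stalk X 0 x"
proof -
  obtain e F G U where 1: "form (0 + e) F" "form e G" "openin zariski U" "x \<in> U"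
    "\<forall>v\<in>U \<inter> X. G v \<noteq> 0 \<and> s v = F v / G v" using assms(1) by (rule stalkE)
  have "x \<noteq> 0" using openin_zariski_nbhd[OF 1(3,4)] by simp
  show ?thesis
  proof (rule stalkI[where e = e and F = G and G = F and U = "U \<inter> {v. v \<noteq> 0 \<and> F v \<noteq> 0}"])
    show "openin zariski (U \<inter> {v. v \<noteq> 0 \<and> F v \<noteq> 0})"
      using 1 by (intro openin_Int openin_zariski_basic[of e]) auto
    show "x \<in> U \<inter> {v. v \<noteq> 0 \<and> F v \<noteq> 0}" using 1 assms \<open>x \<noteq> 0\<close> by auto
  qed (use 1 in auto)
qed

lemma openin_zariski_space: "openin zariski {v. v \<noteq> 0}"
  using openin_topspace[of zariski] by (simp add: topspace_zariski)

lemma form_stalk: "form d F \<Longrightarrow> x \<noteq> 0 \<Longrightarrow> F \<in> stalk X d x"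
  by (rule stalkI[where e = 0 and F = F and G = "\<lambda>v. 1" and U = "{v. v \<noteq> 0}"])
    (auto simp: form_const openin_zariski_space)

lemma max_ideal_powerI:
  "(\<And>r. r < m \<Longrightarrow> (\<forall>p<q. f r p \<in> max_ideal X x) \<and> l r \<in> stalk X d x) \<Longrightarrow> openin zariski U \<Longrightarrow> x \<in> U \<Longrightarrow>
    (\<And>v. v \<in> U \<Longrightarrow> v \<in> X \<Longrightarrow> s v = (\<Sum>r<(m::nat). (\<Prod>p<q. f r p v) * l r v)) \<Longrightarrow> s \<in> max_ideal_power X q d x"
  unfolding max_ideal_power_def
  by (intro CollectI exI[of _ m] exI[of _ f] exI[of _ l] exI[of _ U]) auto

lemma max_ideal_powerE:
  assumes "s \<in> max_ideal_power X q d x"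
  obtains m f l U where "\<forall>r<(m::nat). (\<forall>p<q. f r p \<in> max_ideal X x) \<and> l r \<in> stalk X d x"
    "openin zariski U" "x \<in> U" "\<forall>v\<in>U \<inter> X. s v = (\<Sum>r<m. (\<Prod>p<q. f r p v) * l r v)"
  using assms unfolding max_ideal_power_def by auto

lemma max_ideal_power_0: "s \<in> stalk X d x \<Longrightarrow> x \<noteq> 0 \<Longrightarrow> s \<in> max_ideal_power X 0 d x"
  by (rule max_ideal_powerI[where m = 1 and l = "\<lambda>_. s" and U = "{v. v \<noteq> 0}" and f = "\<lambda>_ _ _. 0"])
    (auto simp: openin_zariski_space)

lemma max_ideal_power_add:
  assumes "s \<in> max_ideal_power X q d x" "t \<in> max_ideal_power X q d x"
  shows "(\<lambda>v. s v + t v) \<in> max_ideal_power X q d x"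
proof -
  obtain m f l U where 1: "\<forall>r<(m::nat). (\<forall>p<q. f r p \<in> max_ideal X x) \<and> l r \<in> stalk X d x"
    "openin zariski U" "x \<in> U" "\<forall>v\<in>U \<inter> X. s v = (\<Sum>r<m. (\<Prod>p<q. f r p v) * l r v)"
    using assms(1) by (rule max_ideal_powerE)
  obtain m' f' l' U' where 2: "\<forall>r<(m'::nat). (\<forall>p<q. f' r p \<in> max_ideal X x) \<and> l' r \<in> stalk X d x"
    "openin zariski U'" "x \<in> U'" "\<forall>v\<in>U' \<inter> X. t v = (\<Sum>r<m'. (\<Prod>p<q. f' r p v) * l' r v)"
    using assms(2) by (rule max_ideal_powerE)
  let ?f = "\<lambda>r. if r < m then f r else f' (r - m)" and ?l = "\<lambda>r. if r < m then l r else l' (r - m)"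
  have "(\<Sum>r<m + m'. (\<Prod>p<q. ?f r p v) * ?l r v) =
      (\<Sum>r<m. (\<Prod>p<q. f r p v) * l r v) + (\<Sum>r<m'. (\<Prod>p<q. f' r p v) * l' r v)" for v
  proof -
    have "(\<Sum>r<m + m'. (\<Prod>p<q. ?f r p v) * ?l r v) = (\<Sum>r<m. (\<Prod>p<q. ?f r p v) * ?l r v)
      + (\<Sum>r\<in>{m..<m + m'}. (\<Prod>p<q. ?f r p v) * ?l r v)"
      by (subst sum.union_disjoint[symmetric]) (auto intro!: sum.cong)
    also have "(\<Sum>r\<in>{m..<m + m'}. (\<Prod>p<q. ?f r p v) * ?l r v) = (\<Sum>r<m'. (\<Prod>p<q. f' r p v) * l' r v)"
      by (rule sum.reindex_bij_witness[of _ "\<lambda>r. r + m" "\<lambda>r. r - m"]) auto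
    finally show ?thesis by simp
  qed
  then show ?thesis
    by (intro max_ideal_powerI[where m = "m + m'" and f = ?f and l = ?l and U = "U \<inter> U'"])
      (use 1 2 in auto)
qed

lemma max_ideal_power_mult_stalk:
  assumes "s \<in> max_ideal_power X q d x" "t \<in> stalk X d' x"
  shows "(\<lambda>v. s v * t v) \<in> max_ideal_power X q (d + d') x"
proof -
  obtain m f l U where 1: "\<forall>r<(m::nat). (\<forall>p<q. f r p \<in> max_ideal X x) \<and> l r \<in> stalk X d x"
    "openin zariski U" "x \<in> U" "\<forall>v\<in>U \<inter> X. s v = (\<Sum>r<m. (\<Prod>p<q. f r p v) * l r v)"
    using assms(1) by (rule max_ideal_powerE)
  show ?thesis
    by (rule max_ideal_powerI[where m = m and f = f and l = "\<lambda>r v. l r v * t v" and U = U])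
      (use 1 in \<open>auto simp: sum_distrib_right mult.assoc intro: stalk_mult assms\<close>)
qed

lemma max_ideal_power_Suc:
  assumes "s \<in> max_ideal_power X q d x" "g \<in> max_ideal X x"
  shows "(\<lambda>v. g v * s v) \<in> max_ideal_power X (Suc q) d x"
proof -
  obtain m f l U where 1: "\<forall>r<(m::nat). (\<forall>p<q. f r p \<in> max_ideal X x) \<and> l r \<in> stalk X d x"
    "openin zariski U" "x \<in> U" "\<forall>v\<in>U \<inter> X. s v = (\<Sum>r<m. (\<Prod>p<q. f r p v) * l r v)"
    using assms(1) by (rule max_ideal_powerE)
  let ?f = "\<lambda>r p. if p < q then f r p else g"
  have "(\<Prod>p<Suc q. ?f r p v) = g v * (\<Prod>p<q. f r p v)" for r v
    by (simp add: mult.commute)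
  then show ?thesis
    by (intro max_ideal_powerI[where m = m and f = ?f and l = l and U = U])
      (use 1 assms(2) in \<open>auto simp del: prod.lessThan_Suc simp: sum_distrib_left mult.assoc\<close>)
qed

lemma max_ideal_power_cong:
  assumes "s \<in> max_ideal_power X q d x" "openin zariski U" "x \<in> U" "\<And>v. v \<in> U \<Longrightarrow> v \<in> X \<Longrightarrow> t v = s v"
  shows "t \<in> max_ideal_power X q d x"
proof -
  obtain m f l V where 1: "\<forall>r<(m::nat). (\<forall>p<q. f r p \<in> max_ideal X x) \<and> l r \<in> stalk X d x"
    "openin zariski V" "x \<in> V" "\<forall>v\<in>V \<inter> X. s v = (\<Sum>r<m. (\<Prod>p<q. f r p v) * l r v)"
    using assms(1) by (rule max_ideal_powerE)
  show ?thesis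
    by (rule max_ideal_powerI[where m = m and f = f and l = l and U = "V \<inter> U"]) (use 1 assms in auto)
qed

text \<open>The analogue of \<open>vanish_order\<close> for a germ, whose values away from
  \<open>x\<close> are arbitrary: the relation is asked only on a neighbourhood.\<close>

definition germ_order :: "('a::field ^ 'i::finite) set \<Rightarrow> 'a ^ 'i \<Rightarrow> nat \<Rightarrow> ('a ^ 'i \<Rightarrow> 'a) \<Rightarrow> bool" where
  "germ_order X x q s \<longleftrightarrow> (\<exists>H A U. polyfun H \<and> H x \<noteq> 0 \<and> mpow x q A \<and> openin zariski U \<and> x \<in> U \<and>
     (\<forall>v\<in>U \<inter> X. H v * s v = A v))"

lemma germ_orderI:
  "polyfun H \<Longrightarrow> H x \<noteq> 0 \<Longrightarrow> mpow x q A \<Longrightarrow> openin zariski U \<Longrightarrow> x \<in> U \<Longrightarrow>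
     (\<And>v. v \<in> U \<Longrightarrow> v \<in> X \<Longrightarrow> H v * s v = A v) \<Longrightarrow> germ_order X x q s"
  unfolding germ_order_def by auto

lemma germ_orderE:
  assumes "germ_order X x q s"
  obtains H A U where "polyfun H" "H x \<noteq> 0" "mpow x q A" "openin zariski U" "x \<in> U"
     "\<forall>v\<in>U \<inter> X. H v * s v = A v"
  using assms unfolding germ_order_def by auto

lemma germ_order_mult:
  assumes "germ_order X x p s" "germ_order X x q t"
  shows "germ_order X x (p + q) (\<lambda>v. s v * t v)"
proof -
  obtain H A U where 1: "polyfun H" "H x \<noteq> 0" "mpow x p A" "openin zariski U" "x \<in> U"
     "\<forall>v\<in>U \<inter> X. H v * s v = A v" using assms(1) by (rule germ_orderE)
  obtain H' A' U' where 2: "polyfun H'" "H' x \<noteq> 0" "mpow x q A'" "openin zariski U'" "x \<in> U'"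
     "\<forall>v\<in>U' \<inter> X. H' v * t v = A' v" using assms(2) by (rule germ_orderE)
  show ?thesis
  proof (rule germ_orderI[where H = "\<lambda>v. H v * H' v" and A = "\<lambda>v. A v * A' v" and U = "U \<inter> U'"])
    show "mpow x (p + q) (\<lambda>v. A v * A' v)" using 1 2 by (intro mpow_mult)
    fix v assume v: "v \<in> U \<inter> U'" "v \<in> X"
    have "A v = H v * s v" "A' v = H' v * t v" using 1(6) 2(6) v by auto
    then show "H v * H' v * (s v * t v) = A v * A' v" by (simp add: ac_simps)
  qed (use 1 2 in \<open>auto intro: polyfun_intros\<close>)
qed

lemma germ_order_add:
  assumes "germ_order X x q s" "germ_order X x q t"
  shows "germ_order X x q (\<lambda>v. s v + t v)"
proof -
  obtain H A U where 1: "polyfun H" "H x \<noteq> 0" "mpow x q A" "openin zariski U" "x \<in> U"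
     "\<forall>v\<in>U \<inter> X. H v * s v = A v" using assms(1) by (rule germ_orderE)
  obtain H' A' U' where 2: "polyfun H'" "H' x \<noteq> 0" "mpow x q A'" "openin zariski U'" "x \<in> U'"
     "\<forall>v\<in>U' \<inter> X. H' v * t v = A' v" using assms(2) by (rule germ_orderE)
  show ?thesis
  proof (rule germ_orderI[where H = "\<lambda>v. H v * H' v" and A = "\<lambda>v. H' v * A v + H v * A' v" and U = "U \<inter> U'"])
    show "mpow x q (\<lambda>v. H' v * A v + H v * A' v)" using 1 2 by (intro mpow_add mpow_mult_polyfun)
    fix v assume v: "v \<in> U \<inter> U'" "v \<in> X"
    have "A v = H v * s v" "A' v = H' v * t v" using 1(6) 2(6) v by auto
    then show "H v * H' v * (s v + t v) = H' v * A v + H v * A' v" by (simp add: algebra_simps)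
  qed (use 1 2 in \<open>auto intro: polyfun_intros\<close>)
qed

lemma stalk_germ_order:
  assumes "s \<in> stalk X d x" "x \<in> X"
  shows "germ_order X x 0 s" "s x = 0 \<Longrightarrow> germ_order X x 1 s"
proof -
  obtain e F G U where 1: "form (d + e) F" "form e G" "openin zariski U" "x \<in> U"
    "\<forall>v\<in>U \<inter> X. G v \<noteq> 0 \<and> s v = F v / G v" using assms(1) by (rule stalkE)
  have F: "polyfun F" "polyfun G" using 1(1,2) by (auto intro: form_polyfun)
  show "germ_order X x 0 s"
    by (rule germ_orderI[where H = G and A = F and U = U]) (use 1 F assms mpow_0 in auto)
  assume "s x = 0"
  then have "F x = 0" using 1 assms by auto
  then show "germ_order X x 1 s"
    by (intro germ_orderI[where H = G and A = F and U = U]) (use 1 F assms mpow_1 in auto)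
qed

lemma germ_order_prod:
  "x \<noteq> 0 \<Longrightarrow> (\<And>p. p < q \<Longrightarrow> germ_order X x 1 (f p)) \<Longrightarrow> germ_order X x q (\<lambda>v. \<Prod>p<(q::nat). f p v)"
proof (induction q)
  case 0
  then show ?case
    by (intro germ_orderI[where H = "\<lambda>v. 1" and A = "\<lambda>v. 1" and U = "{v. v \<noteq> 0}"])
      (auto intro: polyfun_const mpow_0 openin_zariski_space)
next
  case (Suc q)
  have "germ_order X x (q + 1) (\<lambda>v. (\<Prod>p<q. f p v) * f q v)"
    using Suc by (intro germ_order_mult) auto
  then show ?case by simp
qed

lemma germ_order_sum:
  "x \<noteq> 0 \<Longrightarrow> (\<And>r. r < m \<Longrightarrow> germ_order X x q (f r)) \<Longrightarrow> germ_order X x q (\<lambda>v. \<Sum>r<(m::nat). f r v)"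
proof (induction m)
  case 0
  then show ?case
    by (intro germ_orderI[where H = "\<lambda>v. 1" and A = "\<lambda>v. 0" and U = "{v. v \<noteq> 0}"])
      (auto intro: polyfun_const mpow_zero openin_zariski_space)
next
  case (Suc m)
  then show ?case using germ_order_add[of X x q "\<lambda>v. \<Sum>r<m. f r v" "f m"] by simp
qed

lemma max_ideal_power_germ_order:
  assumes "s \<in> max_ideal_power X q d x" "x \<in> X" "x \<noteq> 0"
  shows "germ_order X x q s"
proof -
  obtain m f l U where 1: "\<forall>r<(m::nat). (\<forall>p<q. f r p \<in> max_ideal X x) \<and> l r \<in> stalk X d x"
    "openin zariski U" "x \<in> U" "\<forall>v\<in>U \<inter> X. s v = (\<Sum>r<m. (\<Prod>p<q. f r p v) * l r v)"
    using assms(1) by (rule max_ideal_powerE)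
  have "germ_order X x 1 (f r p)" if "r < m" "p < q" for r p
    using 1(1) that assms by (intro stalk_germ_order(2)[where d = 0]) (auto simp: max_ideal_def)
  then have "germ_order X x (q + 0) (\<lambda>v. (\<Prod>p<q. f r p v) * l r v)" if "r < m" for r
    using 1(1) that assms by (intro germ_order_mult germ_order_prod stalk_germ_order(1)[of _ X d]) auto
  then have "germ_order X x q (\<lambda>v. \<Sum>r<m. (\<Prod>p<q. f r p v) * l r v)"
    using assms(3) by (intro germ_order_sum) auto
  then obtain H A V where 2: "polyfun H" "H x \<noteq> 0" "mpow x q A" "openin zariski V" "x \<in> V"
     "\<forall>v\<in>V \<inter> X. H v * (\<Sum>r<m. (\<Prod>p<q. f r p v) * l r v) = A v" by (rule germ_orderE)
  show ?thesis
    by (rule germ_orderI[where H = H and A = A and U = "U \<inter> V"]) (use 1 2 in auto)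
qed

section \<open>Passage between germs and polynomial functions on the cone\<close>

text \<open>A polynomial function becomes a germ of degree \<open>0\<close> after rescaling its argument into the affine
  chart through \<open>x\<close> on which coordinate \<open>j\<close> is constant.\<close>

definition rescale :: "'a::field ^ 'i::finite \<Rightarrow> 'i \<Rightarrow> 'a ^ 'i \<Rightarrow> 'a ^ 'i" where
  "rescale x j v = (x $ j / v $ j) *s v"

lemma polyfun_rescale_stalk:
  assumes "polyfun f" "x $ j \<noteq> 0"
  shows "(\<lambda>v. f (rescale x j v)) \<in> stalk X 0 x"
  using assms(1)
proof induction
  have "x \<noteq> 0" using assms(2) by auto
  {
    case (polyfun_const c)
    show ?case by (rule form_stalk[OF form_const \<open>x \<noteq> 0\<close>])
  next
    case (polyfun_coord i)
    show ?case
    proof (rule stalkI[where e = 1 and F = "\<lambda>v. x $ j * v $ i" and G = "\<lambda>v. v $ j" and U = "{v. v \<noteq> 0 \<and> v $ j \<noteq> 0}"])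
      show "form (0 + 1) (\<lambda>v. x $ j * v $ i)" using form_scale[OF form_coord] by simp
      show "openin zariski {v. v \<noteq> 0 \<and> v $ j \<noteq> 0}" by (rule openin_zariski_basic[OF form_coord])
    qed (use assms(2) \<open>x \<noteq> 0\<close> form_coord in \<open>auto simp: rescale_def simp del: One_nat_def\<close>)
  next
    case (polyfun_add f g)
    then show ?case using stalk_add by blast
  next
    case (polyfun_mult f g)
    then show ?case using stalk_mult[of _ X 0 x _ 0] by auto
  }
qed

lemma rescale_self: "x $ j \<noteq> 0 \<Longrightarrow> rescale x j x = x"
  by (simp add: rescale_def vec_eq_iff)

lemma mpow_rescale:
  assumes "mpow x q A" "x $ j \<noteq> 0"
  shows "(\<lambda>v. A (rescale x j v)) \<in> max_ideal_power X q 0 x"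
  using assms(1)
proof induction
  have "x \<noteq> 0" using assms(2) by auto
  {
    case (mpow_0 f) then show ?case
      using \<open>x \<noteq> 0\<close> assms(2) by (intro max_ideal_power_0 polyfun_rescale_stalk) auto
  next
    case (mpow_Suc f q g) then show ?case
      using assms(2) by (intro max_ideal_power_Suc) (auto simp: max_ideal_def rescale_self polyfun_rescale_stalk)
  next
    case (mpow_add q f g) then show ?case by (intro max_ideal_power_add)
  }
qed

text \<open>The dictionary between the projective local ring and the cone. Forward, denominators are
  cleared near \<open>x\<close>; backward, \<open>rescale\<close> turns polynomial functions into
  germs of degree 0.\<close>

theorem max_ideal_power_iff:
  fixes X :: "('a::field ^ 'i::finite) set"
  assumes X: "cone X" "0 \<notin> X" "x \<in> X"
    and s: "form (d + e) F" "form e G" "openin zariski U" "x \<in> U" "\<And>v. v \<in> U \<Longrightarrow> v \<in> X \<Longrightarrow> G v \<noteq> 0 \<and> s v = F v / G v"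
  shows "s \<in> max_ideal_power X q d x \<longleftrightarrow> vanish_order X x q F"
proof
  have x0: "x \<noteq> 0" using X by auto
  have pF: "polyfun F" "polyfun G" using s by (auto intro: form_polyfun)
  have Gx: "G x \<noteq> 0" using s X by auto
  {
    assume "s \<in> max_ideal_power X q d x"
    from max_ideal_power_germ_order[OF this X(3) x0]
    obtain H A V where 1: "polyfun H" "H x \<noteq> 0" "mpow x q A" "openin zariski V" "x \<in> V"
       "\<forall>v\<in>V \<inter> X. H v * s v = A v" by (rule germ_orderE)
    have "openin zariski (U \<inter> V)" "x \<in> U \<inter> V" using s(3,4) 1(4,5) by auto
    from openin_zariski_nbhd[OF this]
    obtain c h where h: "form c h" "h x \<noteq> 0" "{v. v \<noteq> 0 \<and> h v \<noteq> 0} \<subseteq> U \<inter> V" by auto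
    have ph: "polyfun h" using h(1) by (rule form_polyfun)
    \<comment> \<open>The factor \<open>h\<close> vanishes at all points of \<open>X\<close> outside
      the neighbourhood, where nothing is known about \<open>s\<close>, so the identity extends to
      all of \<open>X\<close>.\<close>
    show "vanish_order X x q F"
    proof (rule vanish_orderI[where H = "\<lambda>v. h v * H v" and G = "\<lambda>v. (h v * G v) * A v"])
      show "mpow x q (\<lambda>v. h v * G v * A v)" by (intro mpow_mult_polyfun polyfun_mult 1 ph pF)
      show "h v * H v * F v = h v * G v * A v" if "v \<in> X" for v
      proof (cases "h v = 0")
        case False
        have "v \<noteq> 0" using that X(2) by auto
        then have "v \<in> U" "v \<in> V" using h(3) False by auto
        then have "G v \<noteq> 0 \<and> s v = F v / G v" "H v * s v = A v" using s(5)[of v] 1(6) that by blast+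
        then show ?thesis by (auto simp: field_simps)
      qed simp
    qed (use pF 1 h ph in \<open>auto intro: polyfun_intros\<close>)
  }
  {
    assume "vanish_order X x q F"
    then obtain H A where 1: "polyfun H" "H x \<noteq> 0" "mpow x q A" "\<forall>v\<in>X. H v * F v = A v"
      by (rule vanish_orderE)
    obtain j where j: "x $ j \<noteq> 0" using x0 by (auto simp: vec_eq_iff)
    let ?\<rho> = "rescale x j"
    have H1: "(\<lambda>v. inverse (H (?\<rho> v))) \<in> stalk X 0 x"
      using 1 j X by (intro stalk_inverse polyfun_rescale_stalk) (auto simp: rescale_self)
    \<comment> \<open>Passing from \<open>F\<close> at the rescaled point back to \<open>F v\<close>
      costs the factor \<open>(v $ j / x $ j) ^ (d + e)\<close>; divided by \<open>G v\<close> it is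
      a germ of degree \<open>d\<close>.\<close>
    have K: "(\<lambda>v. (1 / x $ j) ^ (d + e) * v $ j ^ (d + e) / G v) \<in> stalk X d x"
    proof (rule stalkI[where e = e and F = "\<lambda>v. (1 / x $ j) ^ (d + e) * v $ j ^ (d + e)" and G = G and U = U])
      show "form (d + e) (\<lambda>v. (1 / x $ j) ^ (d + e) * v $ j ^ (d + e))"
        using form_scale[OF form_power[OF form_coord, of "d + e"]] by simp
    qed (use s in auto)
    have A1: "(\<lambda>v. A (?\<rho> v) * (inverse (H (?\<rho> v)) * ((1 / x $ j) ^ (d + e) * v $ j ^ (d + e) / G v)))
       \<in> max_ideal_power X q d x"
      using max_ideal_power_mult_stalk[OF mpow_rescale[OF 1(3) j] stalk_mult[OF H1 K]] by simp
    have "\<exists>V. openin zariski V \<and> x \<in> V \<and> (\<forall>v\<in>V \<inter> X. H (?\<rho> v) \<noteq> 0)"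
    proof -
      obtain e' F' G' V where 2: "form (0 + e') F'" "form e' G'" "openin zariski V" "x \<in> V"
        "\<forall>v\<in>V \<inter> X. G' v \<noteq> 0 \<and> H (?\<rho> v) = F' v / G' v"
        using polyfun_rescale_stalk[OF 1(1) j] by (rule stalkE)
      have "H x = F' x / G' x" using bspec[OF 2(5), of x] 2(4) X(3) j by (simp add: rescale_self)
      then have Fx: "F' x \<noteq> 0" using 1(2) by auto
      show ?thesis
      proof (intro exI[of _ "V \<inter> {v. v \<noteq> 0 \<and> F' v \<noteq> 0}"] conjI ballI)
        show "openin zariski (V \<inter> {v. v \<noteq> 0 \<and> F' v \<noteq> 0})"
          using 2(1,3) by (intro openin_Int openin_zariski_basic[of e']) simp_all
        show "x \<in> V \<inter> {v. v \<noteq> 0 \<and> F' v \<noteq> 0}" using 2(4) Fx x0 by simp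
        fix v assume v: "v \<in> V \<inter> {v. v \<noteq> 0 \<and> F' v \<noteq> 0} \<inter> X"
        then have "G' v \<noteq> 0 \<and> H (?\<rho> v) = F' v / G' v" by (intro bspec[OF 2(5)]) simp
        then show "H (?\<rho> v) \<noteq> 0" using v by simp
      qed
    qed
    then obtain V where V: "openin zariski V" "x \<in> V" "\<And>v. v \<in> V \<Longrightarrow> v \<in> X \<Longrightarrow> H (?\<rho> v) \<noteq> 0"
      by auto
    show "s \<in> max_ideal_power X q d x"
    proof (rule max_ideal_power_cong[OF A1, where U = "(U \<inter> V) \<inter> {v. v \<noteq> 0 \<and> v $ j \<noteq> 0}"])
      fix v assume v: "v \<in> U \<inter> V \<inter> {v. v \<noteq> 0 \<and> v $ j \<noteq> 0}" "v \<in> X"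
      have "?\<rho> v \<in> X" using v X(1) j unfolding rescale_def cone_def by auto
      then have "A (?\<rho> v) = H (?\<rho> v) * F (?\<rho> v)" using 1(4) by auto
      also have "F (?\<rho> v) = (x $ j / v $ j) ^ (d + e) * F v"
        unfolding rescale_def by (rule form_homogeneous[OF s(1)])
      finally have A: "A (?\<rho> v) = H (?\<rho> v) * ((x $ j / v $ j) ^ (d + e) * F v)" .
      have "H (?\<rho> v) \<noteq> 0" "G v \<noteq> 0" "s v = F v / G v" using V(3) s(5) v by auto
      then show "s v = A (?\<rho> v) * (inverse (H (?\<rho> v)) * ((1 / x $ j) ^ (d + e) * v $ j ^ (d + e) / G v))"
        unfolding A using j v by (simp add: field_simps)
    next
      show "openin zariski ((U \<inter> V) \<inter> {v. v \<noteq> 0 \<and> v $ j \<noteq> 0})"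
        using s(3) V(1) by (intro openin_Int openin_zariski_basic[OF form_coord])
      show "x \<in> (U \<inter> V) \<inter> {v. v \<noteq> 0 \<and> v $ j \<noteq> 0}" using s(4) V(2) x0 j by simp
    qed
  }
qed

lemma max_ideal_power_pairing_iff:
  assumes "cone X" "0 \<notin> X" "x \<in> X"
  shows "pairing h \<in> max_ideal_power X q 1 x \<longleftrightarrow> vanish_order X x q (pairing h)"
proof (rule max_ideal_power_iff[where e = 0 and G = "\<lambda>v. 1" and U = "{v. v \<noteq> 0}"])
  show "form (1 + 0) (pairing h)" using form_pairing by simp
qed (use assms in \<open>auto simp: form_const openin_zariski_space\<close>)

lemma pairing_diff: "pairing (g - h) v = pairing g v - pairing h v"
  by (simp add: pairing_def left_diff_distrib sum_subtractf)

lemma pairing_add: "pairing (g + h) v = pairing g v + pairing h v"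
  by (simp add: pairing_def distrib_right sum.distrib)

lemma pairing_scale: "pairing (c *s h) v = c * pairing h v"
  by (simp add: pairing_def sum_distrib_left mult.assoc)

lemma pairing_0: "pairing 0 v = 0"
  by (simp add: pairing_def)

lemma pairing_commute: "pairing h v = pairing v h"
  by (simp add: pairing_def mult.commute)

lemma max_ideal_power_minus:
  assumes "s \<in> max_ideal_power X q d x" "x \<noteq> 0"
  shows "(\<lambda>v. - s v) \<in> max_ideal_power X q d x"
proof -
  have "(\<lambda>v. s v * (-1)) \<in> max_ideal_power X q (d + 0) x"
    by (rule max_ideal_power_mult_stalk[OF assms(1) form_stalk[OF form_const assms(2)]])
  then show ?thesis by simp
qed

lemma jet_eq_jet_0_iff:
  fixes X :: "('a::field ^ 'i::finite) set"
  assumes X: "cone X" "0 \<notin> X" "x \<in> X"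
  shows "jet X k x h = jet X k x 0 \<longleftrightarrow> vanish_order X x (Suc k) (pairing h)"
proof -
  have x0: "x \<noteq> 0" using X by auto
  have h: "pairing h \<in> stalk X 1 x" by (rule form_stalk[OF form_pairing x0])
  have 0: "(\<lambda>v. 0) \<in> max_ideal_power X (k + 1) 1 x"
    by (rule max_ideal_powerI[where m = 0 and U = "{v. v \<noteq> 0}"])
      (use x0 in \<open>auto simp: openin_zariski_space\<close>)
  have "jet X k x h = jet X k x 0 \<longleftrightarrow> pairing h \<in> max_ideal_power X (k + 1) 1 x"
  proof
    assume "jet X k x h = jet X k x 0"
    moreover have "pairing h \<in> jet X k x h" using h 0 by (simp add: jet_def)
    ultimately show "pairing h \<in> max_ideal_power X (k + 1) 1 x" by (simp add: jet_def pairing_0)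
  next
    assume *: "pairing h \<in> max_ideal_power X (k + 1) 1 x"
    have "(\<lambda>v. s v - pairing h v) \<in> max_ideal_power X (k + 1) 1 x \<longleftrightarrow> s \<in> max_ideal_power X (k + 1) 1 x" for s
    proof
      assume "(\<lambda>v. s v - pairing h v) \<in> max_ideal_power X (k + 1) 1 x"
      from max_ideal_power_add[OF this *] show "s \<in> max_ideal_power X (k + 1) 1 x" by simp
    next
      assume "s \<in> max_ideal_power X (k + 1) 1 x"
      from max_ideal_power_add[OF this max_ideal_power_minus[OF * x0]]
      show "(\<lambda>v. s v - pairing h v) \<in> max_ideal_power X (k + 1) 1 x" by simp
    qed
    then show "jet X k x h = jet X k x 0" unfolding jet_def pairing_0 by simp
  qed
  then show ?thesis using max_ideal_power_pairing_iff[OF X, of h "k + 1"] by simp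
qed


section \<open>Orthogonal complements\<close>

definition perp :: "('a::field ^ 'i::finite) set \<Rightarrow> ('a ^ 'i) set" where
  "perp V = {h. \<forall>v\<in>V. pairing v h = 0}"

lemma matrix_vector_pairing: "(M *v h) $ i = pairing (M $ i) h"
  by (simp add: matrix_vector_mult_def pairing_def)

lemma pairing_add_right: "pairing h (v + w) = pairing h v + pairing h w"
  by (simp add: pairing_commute[of h] pairing_add)

lemma pairing_scale_right: "pairing h (c *s v) = c * pairing h v"
  by (simp add: pairing_commute[of h] pairing_scale)

lemma pairing_0_right: "pairing h 0 = 0"
  by (simp add: pairing_def)

lemma pairing_sum_right: "pairing h (\<Sum>j\<in>A. f j) = (\<Sum>j\<in>A. pairing h (f j))"
  by (induction A rule: infinite_finite_induct) (simp_all add: pairing_0_right pairing_add_right)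

lemma pairing_axis: "pairing (axis i 1) v = v $ i"
proof -
  have "(\<Sum>j\<in>UNIV. axis i 1 $ j * v $ j) = (\<Sum>j\<in>UNIV. if j = i then v $ i else 0)"
    by (rule sum.cong) (auto simp: axis_def)
  then show ?thesis by (simp add: pairing_def)
qed

lemma subspace_perp: "vec.subspace (perp V)"
  unfolding vec.subspace_def perp_def by (auto simp: pairing_add_right pairing_scale_right pairing_0_right)

lemma perp_mono: "V \<subseteq> W \<Longrightarrow> perp W \<subseteq> perp V"
  by (auto simp: perp_def)

lemma perp_span: "perp (vec.span V) = perp V"
proof
  show "perp V \<subseteq> perp (vec.span V)"
  proof
    fix h assume "h \<in> perp V"
    have "vec.subspace {v. pairing v h = 0}"
      unfolding vec.subspace_def by (auto simp: pairing_add pairing_scale pairing_0)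
    with \<open>h \<in> perp V\<close> have "vec.span V \<subseteq> {v. pairing v h = 0}"
      by (intro vec.span_minimal) (auto simp: perp_def)
    then show "h \<in> perp (vec.span V)" by (auto simp: perp_def)
  qed
qed (auto simp: perp_def vec.span_base)

text \<open>\<open>k\<close> is the dual basis of \<open>b\<close>, read off from the columns of the
  inverse matrix. Indexing by the coordinate type makes \<open>b\<close> a square matrix, as
  Cramer's rule requires.\<close>

lemma adapted_basis:
  fixes G :: "('a::field ^ 'i::finite) set"
  obtains b k :: "'i \<Rightarrow> 'a ^ 'i" and J
  where "b ` J \<subseteq> G" "G \<subseteq> vec.span (b ` J)" "inj b" "vec.independent (range b)" "card J = vec.dim G"
    "invertible (\<chi> i. b i)" "\<forall>v. v = (\<Sum>j\<in>UNIV. pairing (k j) v *s b j)"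
    "\<forall>i j. pairing (k i) (b j) = (if i = j then 1 else 0)"
proof -
  obtain B where B: "B \<subseteq> G" "vec.independent B" "G \<subseteq> vec.span B"
    using vec.maximal_independent_subset by blast
  define E where "E = vec.extend_basis B"
  have E: "B \<subseteq> E" "vec.independent E" "vec.span E = UNIV"
    using vec.extend_basis_superset[OF B(2)] vec.independent_extend_basis[OF B(2)]
      vec.span_extend_basis[OF B(2)] by (auto simp: E_def)
  have "finite E" using E vec.finiteI_independent by blast
  have "card E = CARD('i)" using vec.dim_eq_card[of E UNIV] E vec_dim_card[where 'a='a and 'n='i] by simp
  then obtain b :: "'i \<Rightarrow> 'a ^ 'i" where b: "bij_betw b UNIV E"
    using finite_same_card_bij[of "UNIV :: 'i set" E] \<open>finite E\<close> by auto
  define J where "J = b -` B"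
  have rb: "range b = E" and inj: "inj b" using b by (auto simp: bij_betw_def)
  have J: "b ` J = B" using rb E(1) by (auto simp: J_def)
  let ?C = "\<chi> i. b i"
  have "rows ?C = range b" by (auto simp: rows_def row_def)
  then obtain N where N: "N ** ?C = mat 1" "invertible ?C"
    using E(3) matrix_left_invertible_span_rows_gen[of ?C] rb invertible_left_inverse[of ?C] by auto
  have N': "?C ** N = mat 1" using N(1) matrix_left_right_inverse by auto
  define k where "k j = (\<chi> i. N $ i $ j)" for j
  have "pairing (k i) (b j) = (if i = j then 1 else 0)" for i j
  proof -
    have "pairing (k i) (b j) = (?C ** N) $ j $ i"
      by (simp add: pairing_def k_def matrix_matrix_mult_def mult.commute)
    then show ?thesis unfolding N' by (auto simp: mat_def)
  qed
  moreover have "v = (\<Sum>j\<in>UNIV. pairing (k j) v *s b j)" for v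
  proof -
    have "(\<Sum>j\<in>UNIV. pairing (k j) v *s b j) $ l = v $ l" for l
    proof -
      have "(\<Sum>j\<in>UNIV. pairing (k j) v *s b j) $ l = (\<Sum>j\<in>UNIV. (\<Sum>i\<in>UNIV. N $ i $ j * v $ i) * b j $ l)"
        by (simp add: pairing_def k_def)
      also have "\<dots> = (\<Sum>i\<in>UNIV. (\<Sum>j\<in>UNIV. N $ i $ j * b j $ l) * v $ i)"
        by (simp add: sum_distrib_right, subst sum.swap) (simp add: ac_simps)
      also have "\<dots> = (\<Sum>i\<in>UNIV. (N ** ?C) $ i $ l * v $ i)"
        by (simp add: matrix_matrix_mult_def)
      also have "\<dots> = (\<Sum>i\<in>UNIV. if i = l then v $ l else 0)"
        unfolding N(1) by (intro sum.cong) (auto simp: mat_def)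
      finally show ?thesis by simp
    qed
    then show ?thesis by (simp add: vec_eq_iff)
  qed
  moreover have "card J = vec.dim G"
    using vec.basis_card_eq_dim[OF B(1,3,2)] card_image[OF inj_on_subset[OF inj subset_UNIV, of J]] J by simp
  ultimately show ?thesis using that[of b J k] B E J rb inj N(2) by auto
qed

lemma adapted_basis_span:
  assumes "v \<in> vec.span (b ` J)" "\<forall>i j. pairing (k i) (b j) = (if i = j then 1 else 0)" "j \<notin> J"
  shows "pairing (k j) v = 0"
proof -
  have "vec.subspace {v. pairing (k j) v = 0}"
    unfolding vec.subspace_def by (auto simp: pairing_add_right pairing_scale_right pairing_0_right)
  then have "vec.span (b ` J) \<subseteq> {v. pairing (k j) v = 0}"
    by (intro vec.span_minimal) (use assms in auto)
  then show ?thesis using assms(1) by auto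
qed

text \<open>In the coordinates given by the adapted basis the complement is cut out by the vanishing
  of the coordinates in \<open>J\<close>.\<close>

lemma dim_perp:
  fixes V :: "('a::field ^ 'i::finite) set"
  shows "vec.dim V + vec.dim (perp V) = CARD('i)"
proof -
  obtain b k :: "'i \<Rightarrow> 'a ^ 'i" and J
    where b: "b ` J \<subseteq> V" "V \<subseteq> vec.span (b ` J)" "card J = vec.dim V" "invertible (\<chi> i. b i)"
    by (rule adapted_basis[of V])
  let ?C = "\<chi> i. b i"
  have inj: "inj ((*v) ?C)" and surj: "surj ((*v) ?C)"
    using b(4) by (auto simp: inj_matrix_vector_mult matrix_right_invertible_surjective[symmetric] invertible_right_inverse)
  have "perp V = perp (b ` J)"
    using perp_mono[OF b(1)] perp_mono[OF b(2)] unfolding perp_span by (rule equalityI)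
  then have "perp V = (*v) ?C -` {w. \<forall>i. i \<notin> - J \<longrightarrow> w $ i = 0}"
    by (auto simp: perp_def matrix_vector_pairing)
  then have I1: "(*v) ?C ` perp V = {w. \<forall>i. i \<notin> - J \<longrightarrow> w $ i = 0}"
    by (simp only: surj_image_vimage_eq[OF surj])
  have I2: "vec.dim ((*v) ?C ` perp V) = vec.dim (perp V)"
    by (rule vec.dim_image_eq[OF matrix_vector_mul_linear_gen inj_on_subset[OF inj]]) simp
  have "vec.dim (perp V) = card (- J)" unfolding I2[symmetric] I1 by (rule dim_substandard_cart)
  moreover have "card J + card (- J) = CARD('i)"
    using card_Un_disjoint[of J "- J"] by (simp add: Compl_partition)
  ultimately show ?thesis using b(3) by simp
qed

lemma subset_perp_perp: "V \<subseteq> perp (perp V)"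
  by (auto simp: perp_def pairing_commute)

lemma perp_perp:
  assumes "vec.subspace V"
  shows "perp (perp V) = V"
proof -
  have "V = perp (perp V)"
    using dim_perp[of V] dim_perp[of "perp V"]
    by (intro vec.subspace_dim_equal assms subspace_perp subset_perp_perp) simp
  then show ?thesis by simp
qed

lemma span_image_sum:
  assumes "v \<in> vec.span (f ` L)" "finite L"
  shows "\<exists>c. v = (\<Sum>l\<in>L. c l *s f l)"
proof -
  have "vec.subspace {v. \<exists>c. v = (\<Sum>l\<in>L. c l *s f l)}"
    unfolding vec.subspace_def
  proof (intro conjI allI ballI)
    show "0 \<in> {v. \<exists>c. v = (\<Sum>l\<in>L. c l *s f l)}" by (auto intro!: exI[of _ "\<lambda>_. 0"])
  next
    fix x y assume "x \<in> {v. \<exists>c. v = (\<Sum>l\<in>L. c l *s f l)}" "y \<in> {v. \<exists>c. v = (\<Sum>l\<in>L. c l *s f l)}"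
    then obtain c d where "x = (\<Sum>l\<in>L. c l *s f l)" "y = (\<Sum>l\<in>L. d l *s f l)" by auto
    then show "x + y \<in> {v. \<exists>c. v = (\<Sum>l\<in>L. c l *s f l)}"
      by (auto intro!: exI[of _ "\<lambda>l. c l + d l"] simp: vec.scale_left_distrib sum.distrib)
  next
    fix a x assume "x \<in> {v. \<exists>c. v = (\<Sum>l\<in>L. c l *s f l)}"
    then obtain c where "x = (\<Sum>l\<in>L. c l *s f l)" by auto
    then show "a *s x \<in> {v. \<exists>c. v = (\<Sum>l\<in>L. c l *s f l)}"
      by (auto intro!: exI[of _ "\<lambda>l. a * c l"] simp: vec.scale_sum_right)
  qed
  moreover have "f ` L \<subseteq> {v. \<exists>c. v = (\<Sum>l\<in>L. c l *s f l)}"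
  proof clarsimp
    fix l assume "l \<in> L"
    have "(\<Sum>m\<in>L. (if m = l then 1 else 0) *s f m) = (\<Sum>m\<in>L. if m = l then f l else 0)"
      by (rule sum.cong) auto
    then show "\<exists>c. f l = (\<Sum>l\<in>L. c l *s f l)"
      using \<open>l \<in> L\<close> assms(2) by (intro exI[of _ "\<lambda>m. if m = l then 1 else 0"]) simp
  qed
  ultimately show ?thesis using vec.span_minimal[of "f ` L"] assms(1) by blast
qed

text \<open>Polynomial extension of a vector orthogonal to a family of polynomial covectors: complete a
  basis chosen from the family by constant covectors and solve by Cramer's rule.\<close>

lemma polynomial_section:
  fixes \<G> :: "('a::field ^ 'i::finite \<Rightarrow> 'a ^ 'i) set" and x0 y :: "'a ^ 'i"
  defines "V \<equiv> \<lambda>x. (\<lambda>\<gamma>. \<gamma> x) ` \<G>"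
  assumes poly: "\<And>\<gamma> i. \<gamma> \<in> \<G> \<Longrightarrow> polyfun (\<lambda>v. \<gamma> v $ i)" and y: "y \<in> perp (V x0)"
  obtains Y \<Delta> where "\<forall>i. polyfun (\<lambda>v. Y v $ i)" "polyfun \<Delta>" "\<Delta> x0 \<noteq> 0" "Y x0 = \<Delta> x0 *s y"
    "\<forall>x. \<Delta> x \<noteq> 0 \<longrightarrow> vec.dim (V x) \<le> vec.dim (V x0) \<longrightarrow> Y x \<in> perp (V x)"
    "\<forall>x. \<Delta> x \<noteq> 0 \<longrightarrow> vec.dim (V x0) \<le> vec.dim (V x)"
proof -
  obtain b k :: "'i \<Rightarrow> 'a ^ 'i" and J
    where b: "b ` J \<subseteq> V x0" "inj b" "card J = vec.dim (V x0)" "invertible (\<chi> i. b i)"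
    by (rule adapted_basis[of "V x0"])
  have "\<forall>i\<in>J. \<exists>\<gamma>\<in>\<G>. b i = \<gamma> x0" using b(1) by (auto simp: V_def)
  then obtain g where g: "\<And>i. i \<in> J \<Longrightarrow> g i \<in> \<G>" "\<And>i. i \<in> J \<Longrightarrow> g i x0 = b i" by metis
  \<comment> \<open>At \<open>x0\<close> this is the adapted basis. Elsewhere only the rows in
    \<open>J\<close> move; the constant rows keep the matrix square.\<close>
  define M where "M x = (\<chi> i. if i \<in> J then g i x else b i)" for x
  define \<Delta> where "\<Delta> x = det (M x)" for x
  \<comment> \<open>Since \<open>y\<close> is orthogonal to the rows in \<open>J\<close>, this
    right-hand side is supported outside \<open>J\<close>; it stays fixed while \<open>M\<close>
    moves.\<close>
  define w where "w = M x0 *v y"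
  \<comment> \<open>The numerators of Cramer's rule. Leaving out the division keeps them polynomial
    and puts the factor \<open>\<Delta> x\<close> on the right-hand side in
    \<open>solve\<close>.\<close>
  define Y where "Y x = (\<chi> l. det (\<chi> i j. if j = l then w $ i else M x $ i $ j))" for x
  have pM: "polyfun (\<lambda>v. M v $ i $ j)" for i j
    using poly g(1) by (cases "i \<in> J") (auto simp: M_def intro: polyfun_const)
  have M0: "M x0 = (\<chi> i. b i)" using g(2) by (auto simp: M_def vec_eq_iff)
  have w0: "w $ i = 0" if "i \<in> J" for i
    using that y b(1) by (auto simp: w_def M0 matrix_vector_pairing perp_def)
  have solve: "M x *v Y x = \<Delta> x *s w" if "\<Delta> x \<noteq> 0" for x
  proof -
    have "M x *v ((1 / \<Delta> x) *s Y x) = w"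
      using cramer[of "M x" "(1 / \<Delta> x) *s Y x" w] that by (simp add: \<Delta>_def Y_def vec_eq_iff)
    then have "\<Delta> x *s (M x *v ((1 / \<Delta> x) *s Y x)) = \<Delta> x *s w" by simp
    then show ?thesis using that by (simp add: matrix_vector_mult_scaleR vec.scale vector_scalar_commute)
  qed
  have rows: "vec.independent ((\<lambda>i. M x $ i) ` UNIV)" "inj (\<lambda>i. M x $ i)" if "\<Delta> x \<noteq> 0" for x
  proof -
    let ?R = "range (\<lambda>i. M x $ i)"
    have "rows (M x) = ?R" by (auto simp: rows_def row_def)
    moreover have "invertible (M x)" using that invertible_det_nz by (auto simp: \<Delta>_def)
    ultimately have sp: "vec.span ?R = UNIV"
      using matrix_left_invertible_span_rows_gen[of "M x"] invertible_left_inverse[of "M x"] by auto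
    have c: "card ?R \<le> CARD('i)" by (rule card_image_le) simp
    show ind: "vec.independent ?R"
      by (rule vec.card_le_dim_spanning[of _ UNIV]) (use sp c vec_dim_card[where 'a='a and 'n='i] in auto)
    have "card ?R = CARD('i)"
      using vec.dim_eq_card[of ?R UNIV] sp ind vec_dim_card[where 'a='a and 'n='i] by simp
    then show "inj (\<lambda>i. M x $ i)" by (intro eq_card_imp_inj_on) simp_all
  qed
  have sub: "(\<lambda>i. M x $ i) ` J \<subseteq> V x" for x using g(1) by (auto simp: M_def V_def)
  have ind: "vec.independent ((\<lambda>i. M x $ i) ` J)" "card ((\<lambda>i. M x $ i) ` J) = vec.dim (V x0)"
    if "\<Delta> x \<noteq> 0" for x
  proof -
    show "vec.independent ((\<lambda>i. M x $ i) ` J)"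
      by (rule vec.independent_mono[OF rows(1)[OF that]]) auto
    show "card ((\<lambda>i. M x $ i) ` J) = vec.dim (V x0)"
      using card_image[OF inj_on_subset[OF rows(2)[OF that] subset_UNIV]] b(3) by auto
  qed
  show ?thesis
  proof (rule that[of Y \<Delta>])
    have "polyfun (\<lambda>v. if j = l then w $ i else M v $ i $ j)" for i j l
      by (cases "j = l") (simp_all add: pM polyfun_const)
    then show "\<forall>i. polyfun (\<lambda>v. Y v $ i)"
      unfolding Y_def by (simp add: polyfun_det)
    show "polyfun \<Delta>" unfolding \<Delta>_def[abs_def] by (intro polyfun_det pM)
    show D: "\<Delta> x0 \<noteq> 0" using b(4) invertible_det_nz by (auto simp: \<Delta>_def M0)
    show "Y x0 = \<Delta> x0 *s y"
    proof -
      have "y = (\<chi> l. det (\<chi> i j. if j = l then w $ i else M x0 $ i $ j) / \<Delta> x0)"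
        using cramer[of "M x0" y w] D by (simp add: \<Delta>_def w_def)
      then have "y $ l = Y x0 $ l / \<Delta> x0" for l by (simp add: Y_def vec_eq_iff)
      then show ?thesis using D by (simp add: vec_eq_iff)
    qed
    have "vec.dim (V x0) \<le> vec.dim (V x)" if "\<Delta> x \<noteq> 0" for x
      using vec.dim_subset[OF sub[of x]] vec.dim_eq_card_independent[OF ind(1)[OF that]] ind(2)[OF that] by simp
    then show "\<forall>x. \<Delta> x \<noteq> 0 \<longrightarrow> vec.dim (V x0) \<le> vec.dim (V x)" by blast
    have "Y x \<in> perp (V x)" if "\<Delta> x \<noteq> 0" "vec.dim (V x) \<le> vec.dim (V x0)" for x
    proof -
      \<comment> \<open>There are as many independent rows as the dimension of \<open>V x\<close>
        allows, so they span it.\<close>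
      have "V x \<subseteq> vec.span ((\<lambda>i. M x $ i) ` J)"
        by (rule vec.card_ge_dim_independent[OF sub ind(1)[OF that(1)]]) (use ind(2)[OF that(1)] that in simp)
      then have "perp ((\<lambda>i. M x $ i) ` J) \<subseteq> perp (V x)" using perp_mono perp_span by blast
      moreover have "Y x \<in> perp ((\<lambda>i. M x $ i) ` J)"
        using solve[OF that(1)] w0 by (auto simp: perp_def matrix_vector_pairing[symmetric])
      ultimately show ?thesis by auto
    qed
    then show "\<forall>x. \<Delta> x \<noteq> 0 \<longrightarrow> vec.dim (V x) \<le> vec.dim (V x0) \<longrightarrow> Y x \<in> perp (V x)" by blast
  qed
qed

text \<open>Induction on the coordinates: on the line \<open>p + s *s y\<close> each coordinate
  excludes finitely many \<open>s\<close>, and the field is infinite.\<close>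

lemma subspace_avoid_coordinates:
  fixes L :: "('a::field_char_0 ^ 'i::finite) set"
  assumes L: "vec.subspace L" and nz: "\<And>i. \<exists>y\<in>L. y $ i \<noteq> 0"
  shows "\<exists>p\<in>L. \<forall>i. p $ i \<noteq> 0"
proof -
  have "\<exists>p\<in>L. \<forall>i\<in>F. p $ i \<noteq> 0" if "finite F" for F
    using that
  proof induction
    case empty show ?case using vec.subspace_0[OF L] by auto
  next
    case (insert i F)
    then obtain p y where p: "p \<in> L" "\<forall>i\<in>F. p $ i \<noteq> 0" and y: "y \<in> L" "y $ i \<noteq> 0" using nz by metis
    have "finite {s. p $ j + s * y $ j = 0}" if "j \<in> insert i F" for j
    proof -
      have "[:p $ j, y $ j:] \<noteq> 0" using that p y by auto
      from poly_roots_finite[OF this] show ?thesis by (simp add: mult.commute)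
    qed
    then have "finite (\<Union>j\<in>insert i F. {s. p $ j + s * y $ j = 0})" using insert by blast
    then obtain s where "s \<notin> (\<Union>j\<in>insert i F. {s. p $ j + s * y $ j = 0})"
      using ex_new_if_finite[OF infinite_UNIV_char_0] by blast
    then show ?case
      using p y by (intro bexI[of _ "p + s *s y"] vec.subspace_add[OF L] vec.subspace_scale[OF L]) auto
  qed
  from this[of UNIV] show ?thesis by simp
qed

text \<open>Duality: the span is the complement of its complement, and pairing with
  \<open>axis i 1\<close> reads off coordinate \<open>i\<close>.\<close>

lemma axis_in_span_iff:
  fixes S :: "('a::field ^ 'i::finite) set"
  shows "axis i 1 \<in> vec.span S \<longleftrightarrow> (\<forall>y\<in>perp S. y $ i = 0)"
proof -
  have "axis i 1 \<in> perp (perp (vec.span S)) \<longleftrightarrow> (\<forall>y\<in>perp S. y $ i = 0)"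
    unfolding perp_span by (simp add: perp_def[of "perp S"] pairing_commute[of _ "axis i 1"] pairing_axis)
  then show ?thesis by (simp add: perp_perp vec.subspace_span)
qed


section \<open>Tangent spaces and smooth points\<close>

text \<open>The differentials at \<open>x\<close> of all equations of \<open>X\<close>;
  \<open>perp (conormal X x)\<close> is the Zariski tangent space of the affine cone.\<close>

definition conormal :: "('a::field_char_0 ^ 'i::finite) set \<Rightarrow> 'a ^ 'i \<Rightarrow> ('a ^ 'i) set" where
  "conormal X x = {grad g x | g. polyfun g \<and> (\<forall>v\<in>X. g v = 0)}"

lemma subspace_conormal: "vec.subspace (conormal X x)"
  unfolding vec.subspace_def
proof (intro conjI ballI allI)
  show "0 \<in> conormal X x"
    unfolding conormal_def by (auto intro!: exI[of _ "\<lambda>v. 0"] polyfun_const simp: grad_const)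
next
  fix u w assume "u \<in> conormal X x" "w \<in> conormal X x"
  then obtain f g where "u = grad f x" "polyfun f" "\<forall>v\<in>X. f v = 0" "w = grad g x" "polyfun g" "\<forall>v\<in>X. g v = 0"
    unfolding conormal_def by auto
  then show "u + w \<in> conormal X x" unfolding conormal_def
    by (intro CollectI exI[of _ "\<lambda>v. f v + g v"]) (simp add: grad_add polyfun_add)
next
  fix c u assume "u \<in> conormal X x"
  then obtain f where "u = grad f x" "polyfun f" "\<forall>v\<in>X. f v = 0"
    unfolding conormal_def by auto
  then show "c *s u \<in> conormal X x" unfolding conormal_def
    by (intro CollectI exI[of _ "\<lambda>v. c * f v"]) (simp add: grad_scale polyfun_mult polyfun_const)
qed

lemma pd_eq_vf: "pd i f = vf (\<lambda>j v. if j = i then 1 else 0) f"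
proof
  fix v
  have "(\<Sum>j\<in>UNIV. (if j = i then 1 else 0) * pd j f v) = (\<Sum>j\<in>UNIV. if j = i then pd j f v else 0)"
    by (rule sum.cong) auto
  then show "pd i f v = vf (\<lambda>j v. if j = i then 1 else 0) f v" by (simp add: vf_def)
qed

lemma polyfun_delta: "polyfun (\<lambda>v. if j = i then 1 else 0)"
  by (cases "j = i") (auto intro: polyfun_const)

lemma grad_mpow_2:
  assumes "mpow x 2 f"
  shows "grad f x = 0"
proof -
  have "mpow x (2 - 1) (pd i f)" for i
    unfolding pd_eq_vf by (intro mpow_vf polyfun_delta assms)
  then have "pd i f x = 0" for i using mpow_eval[of x 0] by simp
  then show ?thesis by (simp add: grad_def vec_eq_iff)
qed

lemma tangent_field_UNIV:
  fixes P :: "'i::finite \<Rightarrow> 'a::field_char_0 ^ 'i \<Rightarrow> 'a"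
  assumes "\<And>i. polyfun (P i)"
  shows "tangent_field UNIV P"
  unfolding tangent_field_def
proof (intro conjI allI impI ballI assms)
  fix f :: "'a ^ 'i \<Rightarrow> 'a" and v assume "\<forall>v\<in>UNIV. f v = 0"
  then have "f = (\<lambda>v. 0)" by auto
  then show "vf P f v = 0" by (simp add: vf_const)
qed

lemma vanish_order_mono: "vanish_order Y x q f \<Longrightarrow> X \<subseteq> Y \<Longrightarrow> vanish_order X x q f"
  unfolding vanish_order_def by blast

text \<open>The coordinate fields are a frame of the ambient affine space, so
  \<open>vanish_order_iff\<close> applies to \<open>UNIV\<close>; the order then passes to the
  subset \<open>X\<close>.\<close>

lemma vanish_order_2I:
  fixes f :: "'a::field_char_0 ^ 'i::finite \<Rightarrow> 'a"
  assumes "polyfun f" "f x = 0" "grad f x = 0"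
  shows "vanish_order X x 2 f"
proof -
  let ?P = "\<lambda>l j v. if j = l then 1 else (0::'a)"
  interpret local_frame UNIV x "UNIV :: 'i set" ?P "\<lambda>l v. v $ l - x $ l"
  proof
    show "tangent_field UNIV (?P l)" for l by (intro tangent_field_UNIV polyfun_delta)
    show "vanish_order UNIV x 2 (\<lambda>v. v $ i - x $ i - (\<Sum>l\<in>UNIV. (v $ l - x $ l) * ?P l i x))" for i
    proof (rule vanish_order_vanishing)
      show "v $ i - x $ i - (\<Sum>l\<in>UNIV. (v $ l - x $ l) * ?P l i x) = 0" for v
      proof -
        have "(\<Sum>l\<in>UNIV. (v $ l - x $ l) * ?P l i x) = (\<Sum>l\<in>UNIV. if i = l then v $ i - x $ i else 0)"
          by (rule sum.cong) auto
        then show ?thesis by simp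
      qed
    qed (intro polyfun_intros)
  qed (auto intro: polyfun_intros)
  have "iter_vf ?P w f x = 0" if "length w < 2" for w
  proof (cases w)
    case Nil then show ?thesis using assms by simp
  next
    case (Cons l w')
    then have "w' = []" using that by simp
    moreover have "pd l f x = 0" using assms(3) by (simp add: grad_def vec_eq_iff)
    ultimately show ?thesis using Cons by (simp add: pd_eq_vf)
  qed
  then have "vanish_order UNIV x 2 f" using vanish_order_iff[OF assms(1)] by blast
  then show ?thesis by (rule vanish_order_mono) simp
qed

text \<open>\<open>H * f - G\<close> is an equation of \<open>X\<close>; its gradient at
  \<open>x\<close> is \<open>H x\<close> times that of \<open>f\<close>, because
  \<open>f x = 0\<close> and \<open>G\<close> has order 2. Conversely, subtract from
  \<open>f\<close> an equation with the same gradient.\<close>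

lemma vanish_order_2_iff:
  assumes "polyfun f" "x \<in> X"
  shows "vanish_order X x 2 f \<longleftrightarrow> f x = 0 \<and> grad f x \<in> conormal X x"
proof
  assume v: "vanish_order X x 2 f"
  then have fx: "f x = 0" using vanish_order_eval[of X x 1 f] assms(2) by (simp add: numeral_2_eq_2)
  obtain H G where 1: "polyfun H" "H x \<noteq> 0" "mpow x 2 G" "\<forall>v\<in>X. H v * f v = G v"
    using v by (rule vanish_orderE)
  have G: "polyfun G" using 1 mpow_polyfun by blast
  have "grad (\<lambda>v. H v * f v - G v) x \<in> conormal X x"
    unfolding conormal_def using 1 G assms by (auto intro!: exI[of _ "\<lambda>v. H v * f v - G v"] polyfun_intros)
  moreover have "grad (\<lambda>v. H v * f v - G v) x = H x *s grad f x"
    using 1 G assms fx by (simp add: grad_diff grad_mult polyfun_mult grad_mpow_2)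
  ultimately have "(1 / H x) *s (H x *s grad f x) \<in> conormal X x"
    using vec.subspace_scale[OF subspace_conormal] by metis
  then show "f x = 0 \<and> grad f x \<in> conormal X x" using 1 fx by simp
next
  assume "f x = 0 \<and> grad f x \<in> conormal X x"
  then obtain g where g: "f x = 0" "grad f x = grad g x" "polyfun g" "\<forall>v\<in>X. g v = 0"
    unfolding conormal_def by auto
  have "vanish_order X x 2 (\<lambda>v. f v - g v)"
    by (rule vanish_order_2I) (use g assms in \<open>auto simp: grad_diff intro: polyfun_intros\<close>)
  then show "vanish_order X x 2 f"
    by (rule vanish_order_cong) (use g assms in auto)
qed

section \<open>Differentials of germs and the cotangent space\<close>

text \<open>The differential at \<open>x\<close> of a germ of degree \<open>0\<close> vanishing at \<open>x\<close>, well defined modulo the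
  conormal space.\<close>

definition germ_grad :: "('a::field_char_0 ^ 'i::finite) set \<Rightarrow> 'a ^ 'i \<Rightarrow> ('a ^ 'i \<Rightarrow> 'a) \<Rightarrow> 'a ^ 'i \<Rightarrow> bool" where
  "germ_grad X x s g \<longleftrightarrow> (\<exists>e F G U. form e F \<and> form e G \<and> openin zariski U \<and> x \<in> U \<and>
     (\<forall>v\<in>U \<inter> X. G v \<noteq> 0 \<and> s v = F v / G v) \<and> F x = 0 \<and> G x *s g = grad F x)"

lemma germ_gradI:
  "form e F \<Longrightarrow> form e G \<Longrightarrow> openin zariski U \<Longrightarrow> x \<in> U \<Longrightarrow>
    (\<And>v. v \<in> U \<Longrightarrow> v \<in> X \<Longrightarrow> G v \<noteq> 0 \<and> s v = F v / G v) \<Longrightarrow> F x = 0 \<Longrightarrow> G x *s g = grad F x \<Longrightarrow> germ_grad X x s g"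
  unfolding germ_grad_def by (intro exI[of _ e] exI[of _ F] exI[of _ G] exI[of _ U]) auto

lemma germ_gradE:
  assumes "germ_grad X x s g"
  obtains e F G U where "form e F" "form e G" "openin zariski U" "x \<in> U"
    "\<forall>v\<in>U \<inter> X. G v \<noteq> 0 \<and> s v = F v / G v" "F x = 0" "G x *s g = grad F x"
  using assms unfolding germ_grad_def by auto

lemma ex_germ_grad:
  assumes "s \<in> max_ideal X x" "x \<in> X"
  shows "\<exists>g. germ_grad X x s g"
proof -
  have "s \<in> stalk X 0 x" "s x = 0" using assms(1) by (auto simp: max_ideal_def)
  from this(1) obtain e F G U where 1: "form (0 + e) F" "form e G" "openin zariski U" "x \<in> U"
    "\<forall>v\<in>U \<inter> X. G v \<noteq> 0 \<and> s v = F v / G v" by (rule stalkE)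
  have Gx: "G x \<noteq> 0" "F x = 0" using bspec[OF 1(5), of x] 1(4) assms(2) \<open>s x = 0\<close> by auto
  have "germ_grad X x s ((1 / G x) *s grad F x)"
    by (rule germ_gradI[where e = e and F = F and G = G and U = U]) (use 1 Gx in auto)
  then show ?thesis by blast
qed

lemma germ_grad_diff:
  assumes "germ_grad X x s g" "germ_grad X x t h"
  shows "germ_grad X x (\<lambda>v. s v - c * t v) (g - c *s h)"
proof -
  obtain e F G U where 1: "form e F" "form e G" "openin zariski U" "x \<in> U"
    "\<forall>v\<in>U \<inter> X. G v \<noteq> 0 \<and> s v = F v / G v" "F x = 0" "G x *s g = grad F x" using assms(1) by (rule germ_gradE)
  obtain e' F' G' U' where 2: "form e' F'" "form e' G'" "openin zariski U'" "x \<in> U'"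
    "\<forall>v\<in>U' \<inter> X. G' v \<noteq> 0 \<and> t v = F' v / G' v" "F' x = 0" "G' x *s h = grad F' x" using assms(2) by (rule germ_gradE)
  have p: "polyfun F" "polyfun G" "polyfun F'" "polyfun G'" using 1 2 by (auto intro: form_polyfun)
  show ?thesis
  proof (rule germ_gradI[where e = "e + e'" and F = "\<lambda>v. F v * G' v + (- c) * (F' v * G v)" and G = "\<lambda>v. G v * G' v"
        and U = "U \<inter> U'"])
    show "form (e + e') (\<lambda>v. F v * G' v + (- c) * (F' v * G v))"
      using form_mult[OF 1(1) 2(2)] form_mult[OF 2(1) 1(2)] by (intro form_add form_scale) (auto simp: ac_simps)
    show "G v * G' v \<noteq> 0 \<and> s v - c * t v = (F v * G' v + (- c) * (F' v * G v)) / (G v * G' v)"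
      if "v \<in> U \<inter> U'" "v \<in> X" for v
    proof -
      have "G v \<noteq> 0 \<and> s v = F v / G v" "G' v \<noteq> 0 \<and> t v = F' v / G' v" using 1(5) 2(5) that by blast+
      then show ?thesis by (simp add: field_simps)
    qed
    have "grad (\<lambda>v. F v * G' v + (- c) * (F' v * G v)) x = G' x *s (G x *s g) - c *s (G x *s (G' x *s h))"
      unfolding 1(7) 2(7) using p 1(6) 2(6)
      by (simp only: grad_add grad_mult grad_scale polyfun_mult polyfun_const) (simp add: vec_eq_iff)
    then show "(G x * G' x) *s (g - c *s h) = grad (\<lambda>v. F v * G' v + (- c) * (F' v * G v)) x"
      by (simp add: vec_eq_iff algebra_simps)
  qed (use 1 2 in \<open>auto intro: form_mult\<close>)
qed

lemma germ_grad_zero: "x \<noteq> 0 \<Longrightarrow> germ_grad X x (\<lambda>v. 0) 0"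
  by (rule germ_gradI[where e = 0 and F = "\<lambda>v. 0" and G = "\<lambda>v. 1" and U = "{v. v \<noteq> 0}"])
    (auto simp: form_const form_zero openin_zariski_space grad_const)

lemma germ_grad_diff_sum:
  assumes "germ_grad X x s g" "\<And>q. q < d \<Longrightarrow> germ_grad X x (b q) (h q)"
  shows "germ_grad X x (\<lambda>v. s v - (\<Sum>q<(d::nat). c q * b q v)) (g - (\<Sum>q<d. c q *s h q))"
  using assms(2)
proof (induction d)
  case (Suc d)
  then have "germ_grad X x (\<lambda>v. s v - (\<Sum>q<d. c q * b q v)) (g - (\<Sum>q<d. c q *s h q))" by simp
  from germ_grad_diff[OF this, of "b d" "h d" "c d"] Suc.prems show ?case by (simp add: algebra_simps)
qed (use assms(1) in simp)

lemma germ_grad_max_ideal_power_iff: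
  assumes X: "cone X" "0 \<notin> X" "x \<in> X" and s: "germ_grad X x s g"
  shows "s \<in> max_ideal_power X 2 0 x \<longleftrightarrow> g \<in> conormal X x"
proof -
  obtain e F G U where 1: "form e F" "form e G" "openin zariski U" "x \<in> U"
    "\<forall>v\<in>U \<inter> X. G v \<noteq> 0 \<and> s v = F v / G v" "F x = 0" "G x *s g = grad F x" using s by (rule germ_gradE)
  have Gx: "G x \<noteq> 0" using 1 X by auto
  have "s \<in> max_ideal_power X 2 0 x \<longleftrightarrow> vanish_order X x 2 F"
    by (rule max_ideal_power_iff[OF X, where e = e and G = G and U = U]) (use 1 in auto)
  also have "\<dots> \<longleftrightarrow> G x *s g \<in> conormal X x"
    using vanish_order_2_iff[OF form_polyfun[OF 1(1)] X(3)] 1 by simp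
  also have "\<dots> \<longleftrightarrow> g \<in> conormal X x"
  proof
    assume "G x *s g \<in> conormal X x"
    from vec.subspace_scale[OF subspace_conormal this, of "1 / G x"] show "g \<in> conormal X x" using Gx by simp
  qed (rule vec.subspace_scale[OF subspace_conormal])
  finally show ?thesis .
qed

text \<open>Euler's identity for the numerator, which vanishes at \<open>x\<close>.\<close>

lemma germ_grad_orthogonal:
  assumes "germ_grad X x s g" "x \<in> X"
  shows "g \<in> perp {x}"
proof -
  obtain e F G U where 1: "form e F" "form e G" "openin zariski U" "x \<in> U"
    "\<forall>v\<in>U \<inter> X. G v \<noteq> 0 \<and> s v = F v / G v" "F x = 0" "G x *s g = grad F x" using assms(1) by (rule germ_gradE)
  have "G x * pairing g x = pairing (grad F x) x" by (simp add: 1(7)[symmetric] pairing_scale)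
  also have "\<dots> = 0" using euler_form[OF 1(1), of x] 1(6) by simp
  finally show ?thesis using 1(4,5) assms(2) by (auto simp: perp_def pairing_commute)
qed

lemma germ_grad_linear:
  fixes x :: "'a::field_char_0 ^ 'i::finite"
  assumes "h \<in> perp {x}" "x $ j \<noteq> 0"
  shows "germ_grad X x (\<lambda>v. pairing h v / v $ j) ((1 / x $ j) *s h)"
    and "x \<in> X \<Longrightarrow> (\<lambda>v. pairing h v / v $ j) \<in> max_ideal X x"
proof -
  have x0: "x \<noteq> 0" using assms(2) by auto
  have hx: "pairing h x = 0" using assms(1) by (simp add: perp_def pairing_commute)
  have U: "openin zariski {v::'a^'i. v \<noteq> 0 \<and> v $ j \<noteq> 0}" by (rule openin_zariski_basic[OF form_coord])
  show "germ_grad X x (\<lambda>v. pairing h v / v $ j) ((1 / x $ j) *s h)"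
    by (rule germ_gradI[OF form_pairing form_coord U]) (use x0 assms(2) hx in \<open>auto simp: grad_pairing\<close>)
  have f: "form (0 + 1) (pairing h)" using form_pairing by simp
  have "(\<lambda>v. pairing h v / v $ j) \<in> stalk X 0 x"
    by (rule stalkI[OF f form_coord U]) (use x0 assms(2) in auto)
  then show "(\<lambda>v. pairing h v / v $ j) \<in> max_ideal X x" using hx by (simp add: max_ideal_def)
qed

lemma dim_perp_singleton:
  fixes x :: "'a::field ^ 'i::finite"
  shows "x \<noteq> 0 \<Longrightarrow> vec.dim (perp {x}) + 1 = CARD('i)"
  using dim_perp[of "{x}"] by simp

text \<open>Differentials identify the cotangent space with \<open>perp {x}\<close> modulo the
  conormal space. So \<open>d\<close> differentials together with a conormal basis span
  \<open>perp {x}\<close>, of dimension \<open>CARD('i) - 1\<close>.\<close>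

lemma cotangent_dim_upper:
  fixes X :: "('a::field_char_0 ^ 'i::finite) set"
  assumes X: "cone X" "0 \<notin> X" "x \<in> X"
    and d: "quotient_dim (max_ideal X x) (max_ideal_power X 2 0 x) d"
  shows "CARD('i) \<le> vec.dim (conormal X x) + d + 1"
proof -
  have x0: "x \<noteq> 0" using X by auto
  then obtain j where j: "x $ j \<noteq> 0" by (auto simp: vec_eq_iff)
  from d obtain b where b: "\<forall>q<d. b q \<in> max_ideal X x"
    "\<forall>s\<in>max_ideal X x. \<exists>c. (\<lambda>v. s v - (\<Sum>q<d. c q * b q v)) \<in> max_ideal_power X 2 0 x"
    unfolding quotient_dim_def by auto
  have "\<forall>q\<in>{..<d}. \<exists>h. germ_grad X x (b q) h" using b(1) ex_germ_grad[OF _ X(3)] by blast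
  then obtain h where h: "\<And>q. q < d \<Longrightarrow> germ_grad X x (b q) (h q)" by (metis lessThan_iff)
  obtain B where B: "B \<subseteq> conormal X x" "vec.independent B" "conormal X x \<subseteq> vec.span B" "card B = vec.dim (conormal X x)"
    using vec.basis_exists[of "conormal X x"] by blast
  let ?S = "h ` {..<d} \<union> B"
  have "perp {x} \<subseteq> vec.span ?S"
  proof
    fix l assume l: "l \<in> perp {x}"
    let ?s = "\<lambda>v. pairing l v / v $ j"
    have s: "germ_grad X x ?s ((1 / x $ j) *s l)" "?s \<in> max_ideal X x"
      using germ_grad_linear[OF l j] X(3) by auto
    from bspec[OF b(2) s(2)] obtain c where
      c: "(\<lambda>v. ?s v - (\<Sum>q<d. c q * b q v)) \<in> max_ideal_power X 2 0 x" by auto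
    have "(1 / x $ j) *s l - (\<Sum>q<d. c q *s h q) \<in> conormal X x"
      using germ_grad_max_ideal_power_iff[OF X germ_grad_diff_sum[where d = d and c = c and b = b and h = h, OF s(1) h]] c
      by (simp only:)
    then have 1: "(1 / x $ j) *s l - (\<Sum>q<d. c q *s h q) \<in> vec.span ?S"
      using B(3) vec.span_mono[of B ?S] by auto
    have 2: "(\<Sum>q<d. c q *s h q) \<in> vec.span ?S"
      by (intro vec.span_sum vec.span_scale vec.span_base) auto
    have "(1 / x $ j) *s l \<in> vec.span ?S" using vec.span_add[OF 1 2] by simp
    from vec.span_scale[OF this, of "x $ j"] show "l \<in> vec.span ?S" using j by simp
  qed
  moreover have "finite B" using B(2) vec.finiteI_independent by blast
  ultimately have "vec.dim (perp {x}) \<le> card ?S" by (intro vec.dim_le_card) auto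
  also have "\<dots> \<le> card (h ` {..<d}) + card B" by (rule card_Un_le)
  also have "\<dots> \<le> d + card B" using card_image_le[of "{..<d}" h] by simp
  finally show ?thesis using B(4) dim_perp_singleton[OF x0] by simp
qed

text \<open>A basis of the conormal space is extended to one of \<open>perp {x}\<close>; the
  additional vectors, as linear forms divided by coordinate \<open>j\<close>, represent a basis of
  the cotangent space.\<close>

lemma cotangent_dim:
  fixes X :: "('a::field_char_0 ^ 'i::finite) set"
  assumes X: "cone X" "0 \<notin> X" "x \<in> X" and W: "conormal X x \<subseteq> perp {x}"
    and d: "vec.dim (conormal X x) + d + 1 = CARD('i)"
  shows "quotient_dim (max_ideal X x) (max_ideal_power X 2 0 x) d"
proof -
  let ?W = "conormal X x"
  have x0: "x \<noteq> 0" using X by auto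
  then obtain j where j: "x $ j \<noteq> 0" by (auto simp: vec_eq_iff)
  obtain B where B: "B \<subseteq> ?W" "vec.independent B" "?W \<subseteq> vec.span B" "card B = vec.dim ?W"
    using vec.basis_exists[of ?W] by blast
  obtain E where E: "B \<subseteq> E" "E \<subseteq> perp {x}" "vec.independent E" "perp {x} \<subseteq> vec.span E"
    using vec.maximal_independent_subset_extend[of B "perp {x}"] B W by blast
  have fE: "finite E" using E(3) vec.finiteI_independent by blast
  have spB: "vec.span B \<subseteq> ?W" by (rule vec.span_minimal[OF B(1) subspace_conormal])
  have "card E = vec.dim (perp {x})" by (rule vec.basis_card_eq_dim[OF E(2,4,3)])
  then have "card (E - B) = d"
    using dim_perp_singleton[OF x0] d B(4) E(1) fE by (simp add: card_Diff_subset finite_subset)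
  then obtain h where h: "bij_betw h {..<d} (E - B)"
    using finite_same_card_bij[of "{..<d}" "E - B"] fE by auto
  have hE: "h q \<in> perp {x}" "h q \<in> E - B" if "q < d" for q
    using h that E(2) by (auto simp: bij_betw_def)
  define b where "b q = (\<lambda>v. pairing (h q) v / v $ j)" for q
  have gb: "germ_grad X x (b q) ((1 / x $ j) *s h q)" if "q < d" for q
    unfolding b_def by (rule germ_grad_linear(1)[OF hE(1)[OF that] j])
  show ?thesis unfolding quotient_dim_def
  proof (intro exI[of _ b] conjI allI impI ballI)
    show "b q \<in> max_ideal X x" if "q < d" for q
      unfolding b_def by (rule germ_grad_linear(2)[OF hE(1)[OF that] j X(3)])
  next
    fix s assume s: "s \<in> max_ideal X x"
    obtain g where g: "germ_grad X x s g" using ex_germ_grad[OF s X(3)] by auto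
    have "g \<in> vec.span E" using germ_grad_orthogonal[OF g X(3)] E(4) by auto
    then have "x $ j *s g \<in> vec.span (id ` E)" using vec.span_scale by simp
    from span_image_sum[OF this fE] obtain c where c: "x $ j *s g = (\<Sum>l\<in>E. c l *s l)" by auto
    have "(\<Sum>l\<in>E. c l *s l) = (\<Sum>l\<in>E - B. c l *s l) + (\<Sum>l\<in>B. c l *s l)"
      using sum.subset_diff[OF E(1) fE] by auto
    also have "(\<Sum>l\<in>E - B. c l *s l) = (\<Sum>q<d. c (h q) *s h q)"
      using sum.reindex_bij_betw[OF h, of "\<lambda>l. c l *s l"] by simp
    finally have "x $ j *s g - (\<Sum>q<d. c (h q) *s h q) = (\<Sum>l\<in>B. c l *s l)" using c by simp
    also have "\<dots> \<in> ?W" using B(1) by (intro vec.subspace_sum vec.subspace_scale subspace_conormal) auto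
    finally have "(1 / x $ j) *s (x $ j *s g - (\<Sum>q<d. c (h q) *s h q)) \<in> ?W"
      by (rule vec.subspace_scale[OF subspace_conormal])
    then have "g - (\<Sum>q<d. c (h q) *s ((1 / x $ j) *s h q)) \<in> ?W"
      using j by (simp add: vec.scale_right_diff_distrib vec.scale_sum_right mult.commute)
    moreover have "germ_grad X x (\<lambda>v. s v - (\<Sum>q<d. c (h q) * b q v)) (g - (\<Sum>q<d. c (h q) *s ((1 / x $ j) *s h q)))"
      by (rule germ_grad_diff_sum[OF g gb])
    ultimately have "(\<lambda>v. s v - (\<Sum>q<d. c (h q) * b q v)) \<in> max_ideal_power X 2 0 x"
      using germ_grad_max_ideal_power_iff[OF X] by (simp only:)
    then show "\<exists>c. (\<lambda>v. s v - (\<Sum>q<d. c q * b q v)) \<in> max_ideal_power X 2 0 x"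
      by (rule exI[of _ "\<lambda>q. c (h q)"])
  next
    fix c q assume c: "(\<lambda>v. \<Sum>q<d. c q * b q v) \<in> max_ideal_power X 2 0 x" and q: "q < d"
    have "(\<lambda>v. 0 - (\<Sum>q<d. - c q * b q v)) = (\<lambda>v. \<Sum>q<d. c q * b q v)" by (simp add: sum_negf)
    moreover have "germ_grad X x (\<lambda>v. 0 - (\<Sum>q<d. - c q * b q v)) (0 - (\<Sum>q<d. - c q *s ((1 / x $ j) *s h q)))"
      by (rule germ_grad_diff_sum[OF germ_grad_zero[OF x0] gb])
    ultimately have "0 - (\<Sum>q<d. - c q *s ((1 / x $ j) *s h q)) \<in> ?W"
      using germ_grad_max_ideal_power_iff[OF X] c by (simp only:)
    then have "x $ j *s (0 - (\<Sum>q<d. - c q *s ((1 / x $ j) *s h q))) \<in> ?W"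
      by (rule vec.subspace_scale[OF subspace_conormal])
    moreover have "x $ j *s (0 - (\<Sum>q<d. - c q *s ((1 / x $ j) *s h q))) = (\<Sum>q<d. c q *s h q)"
      using j by (simp add: vec.scale_right_diff_distrib vec.scale_sum_right vec.scale_minus_left sum_negf)
    ultimately have "(\<Sum>q<d. c q *s h q) \<in> vec.span B" using B(3) by auto
    then have "(\<Sum>q<d. c q *s h q) \<in> vec.span (id ` B)" by simp
    from span_image_sum[OF this] obtain e where e: "(\<Sum>q<d. c q *s h q) = (\<Sum>l\<in>B. e l *s l)"
      using finite_subset[OF E(1) fE] by auto
    \<comment> \<open>One coefficient function on all of \<open>E\<close>, so that independence of
      the whole basis forces each \<open>c q\<close> to vanish.\<close>
    define u where "u l = (if l \<in> B then - e l else c (the_inv_into {..<d} h l))" for l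
    have "(\<Sum>l\<in>E. u l *s l) = (\<Sum>l\<in>E - B. u l *s l) + (\<Sum>l\<in>B. u l *s l)"
      using sum.subset_diff[OF E(1) fE] by auto
    also have "(\<Sum>l\<in>E - B. u l *s l) = (\<Sum>q<d. u (h q) *s h q)"
      using sum.reindex_bij_betw[OF h, of "\<lambda>l. u l *s l"] by simp
    also have "\<dots> = (\<Sum>q<d. c q *s h q)"
      using hE(2) h by (intro sum.cong) (auto simp: u_def bij_betw_def the_inv_into_f_f)
    also have "(\<Sum>l\<in>B. u l *s l) = - (\<Sum>l\<in>B. e l *s l)"
      by (simp add: u_def sum_negf vec.scale_minus_left)
    finally have "(\<Sum>l\<in>E. u l *s l) = 0" using e by simp
    then have "u (h q) = 0" using vec.independentD[OF E(3) fE order_refl] hE(2)[OF q] by blast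
    then show "c q = 0" using hE(2)[OF q] h q by (auto simp: u_def bij_betw_def the_inv_into_f_f)
  qed
qed

text \<open>The restriction of \<open>f\<close> has almost every parameter as a root, hence is the
  zero polynomial. The conclusion therefore holds at every \<open>s\<close>, including those where
  the curve leaves \<open>X\<close>.\<close>

lemma curve_tangent:
  fixes f :: "'a::field_char_0 ^ 'i::finite \<Rightarrow> 'a"
  assumes f: "polyfun f" "\<And>v. v \<in> X \<Longrightarrow> f v = 0" and fin: "finite {s. curve \<gamma> s \<notin> X}"
  shows "(\<Sum>i\<in>UNIV. pd i f (curve \<gamma> s) * poly (pderiv (\<gamma> i)) s) = 0"
proof -
  have "restr f \<gamma> = 0"
  proof (rule ccontr)
    assume "restr f \<gamma> \<noteq> 0"
    then have "finite {s. poly (restr f \<gamma>) s = 0}" by (rule poly_roots_finite)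
    moreover have "UNIV \<subseteq> {s. poly (restr f \<gamma>) s = 0} \<union> {s. curve \<gamma> s \<notin> X}"
      using f by (auto simp: poly_restr)
    ultimately have "finite (UNIV :: 'a set)" using fin by (meson finite_Un finite_subset)
    then show False using infinite_UNIV_char_0 by blast
  qed
  then show ?thesis using pderiv_restr[OF f(1), of \<gamma> s] by simp
qed

text \<open>\<open>x\<close> is the velocity at \<open>s = 0\<close> of the line
  \<open>(1 + s) *s x\<close>, which leaves the cone at most at \<open>s = -1\<close>.\<close>

lemma conormal_cone:
  fixes X :: "('a::field_char_0 ^ 'i::finite) set"
  assumes "cone X" "x \<in> X"
  shows "conormal X x \<subseteq> perp {x}"
proof
  fix h assume "h \<in> conormal X x"
  then obtain g where g: "h = grad g x" "polyfun g" "\<forall>v\<in>X. g v = 0" unfolding conormal_def by auto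
  let ?\<gamma> = "\<lambda>i. [:x $ i, x $ i:]"
  have c: "curve ?\<gamma> s = (1 + s) *s x" for s by (simp add: curve_def vec_eq_iff algebra_simps)
  have "curve ?\<gamma> s \<in> X" if "s \<noteq> -1" for s
  proof -
    have "1 + s \<noteq> 0" using that by (simp add: add_eq_0_iff)
    then show ?thesis unfolding c using assms unfolding cone_def by blast
  qed
  then have "{s. curve ?\<gamma> s \<notin> X} \<subseteq> {-1}" by blast
  then have fin: "finite {s. curve ?\<gamma> s \<notin> X}" by (rule finite_subset) simp
  have "(\<Sum>i\<in>UNIV. pd i g (curve ?\<gamma> 0) * poly (pderiv (?\<gamma> i)) 0) = 0"
    by (rule curve_tangent[OF g(2) _ fin]) (use g in auto)
  then show "h \<in> perp {x}"
    by (simp add: curve_line_0 perp_def pairing_def g(1) grad_def pderiv_pCons mult.commute)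
qed


text \<open>Dual coordinates of a basis of the tangent space, shifted to vanish at \<open>x\<close>,
  are recombined to match the given fields. The error in each coordinate has its gradient in the
  conormal space, hence has order 2.\<close>

lemma local_frame_exists:
  fixes X :: "('a::field_char_0 ^ 'i::finite) set" and L :: "'l set"
  assumes x: "x \<in> X" and L: "finite L" and P: "\<And>l. l \<in> L \<Longrightarrow> tangent_field X (P l)"
    and span: "perp (conormal X x) \<subseteq> vec.span ((\<lambda>l. \<chi> i. P l i x) ` L)"
  shows "\<exists>u. local_frame X x L P u"
proof -
  let ?V = "perp (conormal X x)"
  obtain b k :: "'i \<Rightarrow> 'a ^ 'i" and J
    where b: "b ` J \<subseteq> ?V" "?V \<subseteq> vec.span (b ` J)" "\<forall>v. v = (\<Sum>j\<in>UNIV. pairing (k j) v *s b j)"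
      "\<forall>i j. pairing (k i) (b j) = (if i = j then 1 else 0)"
    by (rule adapted_basis[of ?V])
  have "\<forall>j\<in>J. \<exists>c. b j = (\<Sum>l\<in>L. c l *s (\<chi> i. P l i x))"
    using span_image_sum[OF _ L] b(1) span by blast
  then obtain c where c: "\<And>j. j \<in> J \<Longrightarrow> b j = (\<Sum>l\<in>L. c j l *s (\<chi> i. P l i x))" by metis
  define u where "u l v = (\<Sum>j\<in>J. c j l * (pairing (k j) v - pairing (k j) x))" for l v
  \<comment> \<open>Coordinate \<open>i\<close> minus its expansion in the tangent basis; this
    covector annihilates the tangent space.\<close>
  define h where "h i = axis i 1 - (\<Sum>j\<in>J. b j $ i *s k j)" for i
  have ph: "pairing (h i) v = v $ i - (\<Sum>j\<in>J. b j $ i * pairing (k j) v)" for i v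
    unfolding h_def pairing_diff pairing_axis
    by (simp add: pairing_commute[of _ v] pairing_sum_right pairing_scale_right)
  have hW: "h i \<in> conormal X x" for i
  proof -
    have "pairing (h i) v = 0" if "v \<in> ?V" for v
    proof -
      have z: "pairing (k j) v = 0" if "j \<notin> J" for j
        using adapted_basis_span[OF _ b(4) that] b(2) \<open>v \<in> ?V\<close> by auto
      have "v = (\<Sum>j\<in>J. pairing (k j) v *s b j)"
        by (subst b(3)[rule_format, of v], rule sum.mono_neutral_right) (auto simp: z)
      then have "v $ i = (\<Sum>j\<in>J. pairing (k j) v *s b j) $ i" by simp
      then show ?thesis by (simp add: ph mult.commute)
    qed
    then have "h i \<in> perp ?V" by (auto simp: perp_def pairing_commute)
    then show ?thesis by (simp add: perp_perp subspace_conormal)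
  qed
  have fr: "v $ i - x $ i - (\<Sum>l\<in>L. u l v * P l i x) = pairing (h i) v - pairing (h i) x" for i v
  proof -
    have "(\<Sum>l\<in>L. u l v * P l i x) = (\<Sum>j\<in>J. (pairing (k j) v - pairing (k j) x) * (\<Sum>l\<in>L. c j l * P l i x))"
      unfolding u_def sum_distrib_right sum_distrib_left
      by (subst sum.swap) (simp add: ac_simps)
    also have "\<dots> = (\<Sum>j\<in>J. (pairing (k j) v - pairing (k j) x) * b j $ i)"
      by (rule sum.cong) (simp_all add: c)
    finally show ?thesis by (simp add: ph algebra_simps sum_subtractf)
  qed
  have "local_frame X x L P u"
  proof
    show "polyfun (u l)" for l unfolding u_def[abs_def] by (intro polyfun_intros polyfun_pairing)
    show "u l x = 0" for l by (simp add: u_def)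
    show "vanish_order X x 2 (\<lambda>v. v $ i - x $ i - (\<Sum>l\<in>L. u l v * P l i x))" for i
      unfolding fr
    proof (subst vanish_order_2_iff[OF _ x])
      show p: "polyfun (\<lambda>v. pairing (h i) v - pairing (h i) x)" by (intro polyfun_intros polyfun_pairing)
      have "grad (\<lambda>v. pairing (h i) v - pairing (h i) x) x = h i"
        by (simp add: grad_diff polyfun_pairing polyfun_const grad_const grad_pairing)
      then show "pairing (h i) x - pairing (h i) x = 0 \<and> grad (\<lambda>v. pairing (h i) v - pairing (h i) x) x \<in> conormal X x"
        using hW by simp
    qed
  qed (use x L P in auto)
  then show ?thesis by blast
qed


section \<open>Higher duals of rationally connected cones\<close>

text \<open>For a cone this is the kernel of the \<open>k\<close>-jet map; \<open>Suc k\<close>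
  appears because a \<open>k\<close>-jet is taken modulo the power \<open>k + 1\<close>.\<close>

definition contact :: "('a::field ^ 'i::finite) set \<Rightarrow> nat \<Rightarrow> 'a ^ 'i \<Rightarrow> ('a ^ 'i) set" where
  "contact X k x = {h. vanish_order X x (Suc k) (pairing h)}"

lemma subspace_contact:
  fixes X :: "('a::field ^ 'i::finite) set"
  shows "vec.subspace (contact X k x)"
proof -
  have "pairing (g + h) = (\<lambda>v. pairing g v + pairing h v)" "pairing (c *s h) = (\<lambda>v. c * pairing h v)"
    "pairing (0 :: 'a ^ 'i) = (\<lambda>v. 0)" for g h :: "'a ^ 'i" and c
    by (auto simp: pairing_add pairing_scale pairing_0)
  then show ?thesis unfolding vec.subspace_def contact_def
    by (auto intro: vanish_order_add vanish_order_polyfun_mult vanish_order_vanishing polyfun_const)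
qed

lemma iter_vf_sum:
  assumes "\<And>l i. l \<in> set w \<Longrightarrow> polyfun (P l i)" "\<And>i. i \<in> A \<Longrightarrow> polyfun (f i)"
  shows "iter_vf P w (\<lambda>v. \<Sum>i\<in>A. c i * f i v) = (\<lambda>v. \<Sum>i\<in>A. c i * iter_vf P w (f i) v)"
  using assms
proof (induction w arbitrary: f)
  case (Cons l w)
  have "vf (P l) (\<lambda>v. \<Sum>i\<in>A. c i * f i v) = (\<lambda>v. \<Sum>i\<in>A. c i * vf (P l) (f i) v)"
  proof -
    have "vf (P l) (\<lambda>v. \<Sum>i\<in>A. c i * f i v) = (\<lambda>v. \<Sum>i\<in>A. vf (P l) (\<lambda>v. c i * f i v) v)"
      by (rule vf_sum) (intro polyfun_intros Cons.prems)
    then show ?thesis using Cons.prems by (simp add: vf_scale)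
  qed
  then show ?case using Cons by (simp add: polyfun_vf)
qed simp

lemma iter_vf_pairing:
  assumes "\<And>l i. l \<in> set w \<Longrightarrow> polyfun (P l i)"
  shows "iter_vf P w (pairing h) v = pairing (\<chi> i. iter_vf P w (\<lambda>v. v $ i) v) h"
proof -
  have "pairing h = (\<lambda>v. \<Sum>i\<in>UNIV. h $ i * v $ i)" by (simp add: pairing_def fun_eq_iff)
  then have "iter_vf P w (pairing h) = (\<lambda>v. \<Sum>i\<in>UNIV. h $ i * iter_vf P w (\<lambda>v. v $ i) v)"
    using iter_vf_sum[of w P UNIV "\<lambda>i v. v $ i" "\<lambda>i. h $ i"] assms by (simp add: polyfun_coord)
  then show ?thesis by (simp add: pairing_def mult.commute)
qed

lemma osculating_space_eq:
  assumes "cone X" "0 \<notin> X" "x \<in> X"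
  shows "osculating_space X k x = perp (contact X k x)"
  unfolding osculating_space_def jet_eq_jet_0_iff[OF assms] perp_def contact_def by auto

lemma jet_rank_eq:
  fixes X :: "('a::field ^ 'i::finite) set"
  assumes "cone X" "0 \<notin> X" "x \<in> X"
  shows "jet_rank X k x + vec.dim (contact X k x) = CARD('i)"
  using dim_perp[of "contact X k x"] by (simp add: jet_rank_def osculating_space_eq[OF assms])

text \<open>The osculating space is the complement of the contact space, and a second complement
  gives the contact space back.\<close>

lemma osculating_space_subset_iff:
  assumes "cone X" "0 \<notin> X" "x \<in> X"
  shows "osculating_space X k x \<subseteq> {v. pairing y v = 0} \<longleftrightarrow> y \<in> contact X k x"
proof -
  have "osculating_space X k x \<subseteq> {v. pairing y v = 0} \<longleftrightarrow> y \<in> perp (perp (contact X k x))"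
    unfolding osculating_space_eq[OF assms] by (auto simp: perp_def[of "perp _"] pairing_commute)
  then show ?thesis by (simp add: perp_perp subspace_contact)
qed

text \<open>\<open>S\<close> will be the torus orbit. The comparison of contact hyperplanes at a
  boundary point with those over \<open>S\<close> uses only these properties and the ranks on
  \<open>S\<close>.\<close>

locale rational_cone =
  fixes S X :: "('a::field_char_0 ^ 'i::finite) set"
  assumes cone: "cone S" and connected: "rationally_connected S" and nz: "0 \<notin> S" and ne: "S \<noteq> {}"
    and X: "X = zariski closure_of S"
begin

lemma S_subset: "S \<subseteq> X"
  unfolding X using nz by (intro closure_of_subset) (auto simp: topspace_zariski)

lemma closedin_X: "closedin zariski X"
  unfolding X by (rule closedin_closure_of)

lemma cone_X: "cone X" "0 \<notin> X"
  using closedin_cone[OF closedin_X] closedin_subset[OF closedin_X] by (auto simp: topspace_zariski)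

lemma vanish: "polyfun f \<Longrightarrow> (\<And>v. v \<in> S \<Longrightarrow> f v = 0) \<Longrightarrow> x \<in> X \<Longrightarrow> f x = 0"
  unfolding X by (rule polyfun_vanishing_closure[OF _ cone])

text \<open>Density and primality: an identity needs to be checked only at points of
  \<open>S\<close> where a polynomial that is not identically zero on \<open>X\<close> is nonzero;
  here these will be Cramer determinants.\<close>

lemma vanish_off_zeros:
  assumes "polyfun \<Delta>" "x0 \<in> X" "\<Delta> x0 \<noteq> 0" "polyfun f" "\<And>v. v \<in> S \<Longrightarrow> \<Delta> v \<noteq> 0 \<Longrightarrow> f v = 0" "x \<in> X"
  shows "f x = 0"
proof -
  have "(\<forall>v\<in>S. \<Delta> v = 0) \<or> (\<forall>v\<in>S. f v = 0)"
    by (rule prime_vanishing[OF connected assms(1,4)]) (use assms(5) in auto)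
  moreover have "\<not> (\<forall>v\<in>S. \<Delta> v = 0)" using vanish[OF assms(1) _ assms(2)] assms(3) by auto
  ultimately show ?thesis using vanish[OF assms(4) _ assms(6)] by auto
qed

text \<open>The conormal rank at \<open>x0\<close> is not below its values on \<open>S\<close>.
  Hence \<open>polynomial_section\<close> extends a tangent vector at \<open>x0\<close> to a field
  that is tangent at the points of \<open>S\<close> where \<open>\<Delta>\<close> is nonzero, and
  density makes it tangent along \<open>X\<close>.\<close>

lemma local_frame_smooth:
  assumes x0: "x0 \<in> X" and dim: "\<And>s. s \<in> S \<Longrightarrow> vec.dim (conormal X s) \<le> vec.dim (conormal X x0)"
  shows "\<exists>(J::'i set) P u. local_frame X x0 J P u"
proof -
  let ?V = "perp (conormal X x0)"
  let ?G = "grad ` {g. polyfun g \<and> (\<forall>v\<in>X. g v = 0)}"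
  have V: "(\<lambda>\<gamma>. \<gamma> x) ` ?G = conormal X x" for x by (auto simp: conormal_def)
  obtain b k :: "'i \<Rightarrow> 'a ^ 'i" and J
    where b: "b ` J \<subseteq> ?V" "?V \<subseteq> vec.span (b ` J)"
    by (rule adapted_basis[of ?V])
  have "\<exists>Y \<Delta>. (\<forall>i. polyfun (\<lambda>v. Y v $ i)) \<and> \<Delta> x0 \<noteq> 0 \<and> Y x0 = \<Delta> x0 *s b j \<and> tangent_field X (\<lambda>i v. Y v $ i)"
    if j: "j \<in> J" for j
  proof -
    have bj: "b j \<in> perp ((\<lambda>\<gamma>. \<gamma> x0) ` ?G)" using b(1) j V by auto
    have pG: "polyfun (\<lambda>v. \<gamma> v $ i)" if "\<gamma> \<in> ?G" for \<gamma> i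
      using that by (auto simp: grad_def polyfun_pd)
    obtain Y \<Delta> where Y': "\<forall>i. polyfun (\<lambda>v. Y v $ i)" "polyfun \<Delta>" "\<Delta> x0 \<noteq> 0" "Y x0 = \<Delta> x0 *s b j"
      "\<forall>x. \<Delta> x \<noteq> 0 \<longrightarrow> vec.dim ((\<lambda>\<gamma>. \<gamma> x) ` ?G) \<le> vec.dim ((\<lambda>\<gamma>. \<gamma> x0) ` ?G)
        \<longrightarrow> Y x \<in> perp ((\<lambda>\<gamma>. \<gamma> x) ` ?G)"
      by (rule polynomial_section[OF pG bj])
    note Y = Y'(1)[rule_format] Y'(2-4) Y'(5)[unfolded V, rule_format]
    have "tangent_field X (\<lambda>i v. Y v $ i)"
      unfolding tangent_field_def
    proof (intro conjI allI impI ballI Y(1))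
      fix f v assume f: "polyfun f" "\<forall>v\<in>X. f v = 0" and v: "v \<in> X"
      show "vf (\<lambda>i v. Y v $ i) f v = 0"
      proof (rule vanish_off_zeros[OF Y(2) x0 Y(3) _ _ v])
        show "polyfun (vf (\<lambda>i v. Y v $ i) f)" by (rule polyfun_vf[OF Y(1) f(1)])
        fix s assume s: "s \<in> S" "\<Delta> s \<noteq> 0"
        have "grad f s \<in> conormal X s" using f by (auto simp: conormal_def)
        then have "pairing (grad f s) (Y s) = 0" using Y(5)[OF s(2) dim[OF s(1)]] by (simp add: perp_def)
        moreover have "(\<chi> i. Y s $ i) = Y s" by (simp add: vec_eq_iff)
        ultimately show "vf (\<lambda>i v. Y v $ i) f s = 0" unfolding vf_eq_grad by simp
      qed
    qed
    then show ?thesis using Y by blast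
  qed
  then obtain Y \<Delta> where Y: "\<And>j. j \<in> J \<Longrightarrow> \<Delta> j x0 \<noteq> 0 \<and> Y j x0 = \<Delta> j x0 *s b j \<and> tangent_field X (\<lambda>i v. Y j v $ i)"
    by metis
  let ?P = "\<lambda>j i v. Y j v $ i"
  have "b j \<in> vec.span ((\<lambda>l. \<chi> i. ?P l i x0) ` J)" if "j \<in> J" for j
  proof -
    have "(\<chi> i. ?P j i x0) = \<Delta> j x0 *s b j" using Y[OF that] by (simp add: vec_eq_iff)
    then have "b j = (1 / \<Delta> j x0) *s (\<chi> i. ?P j i x0)" using Y[OF that] by simp
    then show ?thesis using that by (metis (no_types, lifting) vec.span_scale vec.span_base imageI)
  qed
  then have "vec.span (b ` J) \<subseteq> vec.span ((\<lambda>l. \<chi> i. ?P l i x0) ` J)"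
    by (intro vec.span_minimal vec.subspace_span) auto
  then have "\<exists>u. local_frame X x0 J ?P u"
    using b(2) Y by (intro local_frame_exists x0) auto
  then show ?thesis by blast
qed

text \<open>Away from \<open>x0\<close> the fields \<open>P\<close> need not be a frame, so iterated
  derivatives give only necessary conditions for contact. The comparison of dimensions makes them
  sufficient on \<open>S\<close> where \<open>\<Delta>\<close> is nonzero; there \<open>Y\<close> is
  a section of contact hyperplanes, and at \<open>x0\<close> it is a multiple of
  \<open>y\<close>.\<close>

lemma contact_in_closure:
  fixes L :: "'l set"
  assumes "local_frame X x0 L P u" and dim: "\<And>s. s \<in> S \<Longrightarrow> vec.dim (contact X k x0) \<le> vec.dim (contact X k s)"
    and y: "y \<in> contact X k x0" "y \<noteq> 0"
  shows "y \<in> zariski closure_of {h. h \<noteq> 0 \<and> (\<exists>s\<in>S. h \<in> contact X k s)}"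
proof -
  interpret local_frame X x0 L P u by fact
  define row where "row w v = (\<chi> i. iter_vf P w (\<lambda>v. v $ i) v)" for w v
  let ?W = "{w \<in> lists L. length w < Suc k}"
  let ?G = "row ` ?W"
  define V where "V x = (\<lambda>\<gamma>. \<gamma> x) ` ?G" for x
  have iter: "iter_vf P w (pairing h) v = pairing (row w v) h" if "w \<in> ?W" for w h v
    unfolding row_def by (rule iter_vf_pairing) (use that pP in auto)
  have V0: "contact X k x0 = perp (V x0)"
    unfolding contact_def vanish_order_iff[OF polyfun_pairing] V_def perp_def
    using iter by auto
  have sub: "contact X k s \<subseteq> perp (V s)" if "s \<in> X" for s
  proof
    fix h assume "h \<in> contact X k s"
    then have "iter_vf P w (pairing h) s = 0" if "w \<in> ?W" for w
      using that \<open>s \<in> X\<close> tangent by (intro iter_vf_eval[where X = X and q = "Suc k"]) (auto simp: contact_def)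
    then show "h \<in> perp (V s)" using iter by (auto simp: V_def perp_def)
  qed
  \<comment> \<open>\<open>perp (V s)\<close> contains the contact space at \<open>s\<close>, which
    is at least as large as \<open>perp (V x0)\<close>; complements reverse the inequality.\<close>
  have dV: "vec.dim (V s) \<le> vec.dim (V x0)" if "s \<in> S" for s
    using dim_perp[of "V s"] dim_perp[of "V x0"] vec.dim_subset[OF sub[of s]] dim[OF that] that S_subset
    unfolding V0 by auto
  have poly: "polyfun (\<lambda>v. \<gamma> v $ i)" if "\<gamma> \<in> ?G" for \<gamma> i
    using that by (auto simp: row_def intro!: polyfun_iter_vf pP polyfun_coord)
  obtain Y \<Delta> where Y': "\<forall>i. polyfun (\<lambda>v. Y v $ i)" "polyfun \<Delta>" "\<Delta> x0 \<noteq> 0" "Y x0 = \<Delta> x0 *s y"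
    "\<forall>x. \<Delta> x \<noteq> 0 \<longrightarrow> vec.dim (V x) \<le> vec.dim (V x0) \<longrightarrow> Y x \<in> perp (V x)"
    "\<forall>x. \<Delta> x \<noteq> 0 \<longrightarrow> vec.dim (V x0) \<le> vec.dim (V x)"
    unfolding V_def by (rule polynomial_section[OF poly y(1)[unfolded V0 V_def]])
  note Y = Y'(1)[rule_format] Y'(2-4) Y'(5,6)[rule_format]
  have YH: "Y s \<in> contact X k s" if s: "s \<in> S" "\<Delta> s \<noteq> 0" for s
  proof -
    have "contact X k s = perp (V s)"
      using sub[of s] s S_subset dim[OF s(1)] Y(6)[OF s(2)] dim_perp[of "V s"] dim_perp[of "V x0"]
      by (intro vec.subspace_dim_equal subspace_contact subspace_perp) (auto simp: V0)
    then show ?thesis using Y(5)[OF s(2) dV[OF s(1)]] by simp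
  qed
  show ?thesis unfolding zariski_closure_eq
  proof (intro CollectI conjI allI impI y(2))
    fix d f assume f: "form d f" "\<forall>s\<in>{h. h \<noteq> 0 \<and> (\<exists>s\<in>S. h \<in> contact X k s)}. s \<noteq> 0 \<longrightarrow> f s = 0"
    obtain i where i: "y $ i \<noteq> 0" using y(2) by (auto simp: vec_eq_iff)
    \<comment> \<open>\<open>Y s\<close> may be zero, where nothing is known about \<open>f\<close>.
      The factor is a coordinate of \<open>Y\<close> that is nonzero at \<open>x0\<close>, and it
      removes these points.\<close>
    have "f (Y x0) * Y x0 $ i = 0"
    proof (rule vanish_off_zeros[OF Y(2) xX Y(3) _ _ xX])
      show "polyfun (\<lambda>v. f (Y v) * Y v $ i)"
        by (intro polyfun_mult polyfun_compose[OF form_polyfun[OF f(1)]] Y(1))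
      fix s assume s: "s \<in> S" "\<Delta> s \<noteq> 0"
      show "f (Y s) * Y s $ i = 0"
      proof (cases "Y s = 0")
        case False
        then have "f (Y s) = 0" using f(2) YH[OF s] s(1) by auto
        then show ?thesis by simp
      qed simp
    qed
    then show "f y = 0" using i Y(3) by (simp add: Y(4) form_homogeneous[OF f(1)])
  qed
qed

text \<open>The points of \<open>S\<close> are smooth of constant rank, which gives one inclusion.
  Any other point of the constant rank locus has a neighbourhood meeting \<open>S\<close>, so its
  contact space has dimension \<open>c\<close> as well; its smoothness supplies the conormal bound
  for \<open>local_frame_smooth\<close>.\<close>

lemma dual_variety_eq:
  assumes S: "openin (subtopology zariski X) S"
    and d: "zariski_dim X = ereal (real d)" "\<And>s. s \<in> S \<Longrightarrow> vec.dim (conormal X s) + d + 1 = CARD('i)"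
    and c: "\<And>s. s \<in> S \<Longrightarrow> vec.dim (contact X k s) = c"
  shows "dual_variety X k = zariski closure_of {h. h \<noteq> 0 \<and> (\<exists>s\<in>S. h \<in> contact X k s)}"
proof -
  note oss = osculating_space_subset_iff[OF cone_X]
  have smooth: "smooth_point X s" if "s \<in> S" for s
    unfolding smooth_point_def
    using cotangent_dim[OF cone_X _ conormal_cone[OF cone_X(1)] d(2)[OF that]] d(1) that S_subset by auto
  have rank: "jet_rank X k s = CARD('i) - c" if "s \<in> S" for s
    using jet_rank_eq[OF cone_X, of s k] c[OF that] that S_subset by auto
  have S1: "S \<subseteq> constant_rank_locus X k"
    unfolding constant_rank_locus_def using S smooth rank by blast
  have closure: "h \<in> zariski closure_of {h. h \<noteq> 0 \<and> (\<exists>s\<in>S. h \<in> contact X k s)}"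
    if x0: "x0 \<in> constant_rank_locus X k" and h: "h \<noteq> 0" "h \<in> contact X k x0" for x0 h
  proof -
    obtain U r where U: "openin (subtopology zariski X) U" "x0 \<in> U" "\<forall>x\<in>U. smooth_point X x" "\<forall>x\<in>U. jet_rank X k x = r"
      using x0 unfolding constant_rank_locus_def by auto
    obtain T where T: "openin zariski T" "U = T \<inter> X" using U(1) unfolding openin_subtopology by auto
    have xX: "x0 \<in> X" "x0 \<in> T" using U(2) T(2) by auto
    obtain e g where g: "form e g" "g x0 \<noteq> 0" "{v. v \<noteq> 0 \<and> g v \<noteq> 0} \<subseteq> T"
      using openin_zariski_nbhd[OF T(1) xX(2)] by auto
    obtain s where s: "s \<in> S" "g s \<noteq> 0" using vanish[OF form_polyfun[OF g(1)] _ xX(1)] g(2) by blast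
    then have "s \<in> U" using g(3) nz S_subset T(2) by auto
    then have "jet_rank X k x0 = jet_rank X k s" using U by simp
    then have "vec.dim (contact X k x0) = c"
      using jet_rank_eq[OF cone_X, of x0 k] jet_rank_eq[OF cone_X, of s k] xX(1) s(1) S_subset c[OF s(1)] by auto
    obtain d' where d': "quotient_dim (max_ideal X x0) (max_ideal_power X 2 0 x0) d'" "zariski_dim X = ereal (real d')"
      using U(2,3) unfolding smooth_point_def by auto
    then have "d' = d" using d(1) by simp
    then have "CARD('i) \<le> vec.dim (conormal X x0) + d + 1"
      using cotangent_dim_upper[OF cone_X xX(1)] d'(1) by simp
    then have "vec.dim (conormal X s) \<le> vec.dim (conormal X x0)" if "s \<in> S" for s
      using d(2)[OF that] by linarith
    from local_frame_smooth[OF xX(1) this]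
    obtain J :: "'i set" and P u where fr: "local_frame X x0 J P u" by auto
    show ?thesis
      by (rule contact_in_closure[OF fr _ h(2,1)]) (use c \<open>vec.dim (contact X k x0) = c\<close> in simp)
  qed
  have 1: "{y. y \<noteq> 0 \<and> (\<exists>x\<in>constant_rank_locus X k. osculating_space X k x \<subseteq> {v. pairing y v = 0})}
     \<subseteq> zariski closure_of {h. h \<noteq> 0 \<and> (\<exists>s\<in>S. h \<in> contact X k s)}"
  proof clarify
    fix y x assume y: "y \<noteq> 0" "x \<in> constant_rank_locus X k" "osculating_space X k x \<subseteq> {v. pairing y v = 0}"
    have "x \<in> X" using y(2) unfolding constant_rank_locus_def smooth_point_def by auto
    then show "y \<in> zariski closure_of {h. h \<noteq> 0 \<and> (\<exists>s\<in>S. h \<in> contact X k s)}"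
      using closure[OF y(2,1)] oss y(3) by blast
  qed
  have 2: "{h. h \<noteq> 0 \<and> (\<exists>s\<in>S. h \<in> contact X k s)}
     \<subseteq> {y. y \<noteq> 0 \<and> (\<exists>x\<in>constant_rank_locus X k. osculating_space X k x \<subseteq> {v. pairing y v = 0})}"
    using oss S1 S_subset by blast
  show ?thesis unfolding dual_variety_def
    by (intro equalityI closure_of_minimal[OF 1 closedin_closure_of] closure_of_mono[OF 2])
qed

end


section \<open>Dimension\<close>

definition irreducible_chain :: "('a::field ^ 'i::finite) set \<Rightarrow> nat \<Rightarrow> (nat \<Rightarrow> ('a ^ 'i) set) \<Rightarrow> bool" where
  "irreducible_chain X m Z \<longleftrightarrow>
     (\<forall>q\<le>m. closedin (subtopology zariski X) (Z q) \<and> zariski_irreducible (Z q)) \<and> (\<forall>q<m. Z q \<subset> Z (Suc q))"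

lemma zariski_dim_eq: "zariski_dim X = Sup {ereal (real m) | m. \<exists>Z. irreducible_chain X m Z}"
  by (simp add: zariski_dim_def irreducible_chain_def)

lemma zariski_dim_ge: "irreducible_chain X m Z \<Longrightarrow> ereal (real m) \<le> zariski_dim X"
  unfolding zariski_dim_eq by (intro Sup_upper) auto

lemma zariski_dim_le: "(\<And>m Z. irreducible_chain X m Z \<Longrightarrow> m \<le> n) \<Longrightarrow> zariski_dim X \<le> ereal (real n)"
  unfolding zariski_dim_eq by (intro Sup_least) auto

text \<open>Hence a proper closed subset of an irreducible closed set has smaller dimension as soon
  as dimensions are finite.\<close>

lemma irreducible_chain_Suc:
  assumes "irreducible_chain X m Z" "closedin zariski X" "closedin zariski Y" "zariski_irreducible Y" "X \<subset> Y"
  shows "irreducible_chain Y (Suc m) (Z(Suc m := Y))"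
proof -
  have Z: "closedin zariski (Z q)" "Z q \<subseteq> X" "zariski_irreducible (Z q)" if "q \<le> m" for q
    using assms(1) that closedin_closed_subtopology[OF assms(2)] by (auto simp: irreducible_chain_def)
  have "closedin (subtopology zariski Y) ((Z(Suc m := Y)) q) \<and> zariski_irreducible ((Z(Suc m := Y)) q)" if "q \<le> Suc m" for q
    using that Z[of q] assms(3,4,5) closedin_subset[OF assms(3)] closedin_closed_subtopology[OF assms(3)] by (cases "q = Suc m") auto
  moreover have "(Z(Suc m := Y)) q \<subset> (Z(Suc m := Y)) (Suc q)" if "q < Suc m" for q
  proof (cases "q = m")
    case True
    then show ?thesis using Z(2)[of m] assms(5) by auto
  next
    case False
    then show ?thesis using assms(1) that by (auto simp: irreducible_chain_def)
  qed
  ultimately show ?thesis unfolding irreducible_chain_def by blast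
qed

lemma irreducible_prime:
  assumes Z: "zariski_irreducible Z" "0 \<notin> Z" and f: "form d f" and g: "form e g"
    and 0: "\<And>v. v \<in> Z \<Longrightarrow> f v * g v = 0"
  shows "(\<forall>v\<in>Z. f v = 0) \<or> (\<forall>v\<in>Z. g v = 0)"
proof -
  have "Z \<subseteq> {v. v \<noteq> 0 \<and> f v = 0} \<union> {v. v \<noteq> 0 \<and> g v = 0}" using Z(2) 0 by auto
  then have "Z \<subseteq> {v. v \<noteq> 0 \<and> f v = 0} \<or> Z \<subseteq> {v. v \<noteq> 0 \<and> g v = 0}"
    using Z(1) closedin_zariski_zeros[OF f] closedin_zariski_zeros[OF g] unfolding zariski_irreducible_def by blast
  then show ?thesis by blast
qed

section \<open>Hilbert functions along chains of irreducible closed sets\<close>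

text \<open>The Hilbert function of \<open>Z\<close> in degree \<open>d\<close> is at least \<open>r\<close>.\<close>

definition hilbert_ge :: "('a::field ^ 'i::finite) set \<Rightarrow> nat \<Rightarrow> nat \<Rightarrow> bool" where
  "hilbert_ge Z d r \<longleftrightarrow> (\<exists>f. (\<forall>q<r. form d (f q)) \<and>
     (\<forall>c. (\<forall>v\<in>Z. (\<Sum>q<r. c q * f q v) = 0) \<longrightarrow> (\<forall>q<r. c q = 0)))"

lemma hilbert_ge_mono:
  assumes "hilbert_ge Z d r" "r' \<le> r" "Z \<subseteq> Z'"
  shows "hilbert_ge Z' d r'"
proof -
  obtain f where f: "\<forall>q<r. form d (f q)" "\<forall>c. (\<forall>v\<in>Z. (\<Sum>q<r. c q * f q v) = 0) \<longrightarrow> (\<forall>q<r. c q = 0)"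
    using assms(1) unfolding hilbert_ge_def by auto
  have "c q = 0" if c: "\<forall>v\<in>Z'. (\<Sum>q<r'. c q * f q v) = 0" and q: "q < r'" for c q
  proof -
    have "(\<Sum>q<r. (if q < r' then c q else 0) * f q v) = (\<Sum>q<r'. c q * f q v)" for v
      using assms(2) by (intro sum.mono_neutral_cong_right) auto
    then have "\<forall>v\<in>Z. (\<Sum>q<r. (if q < r' then c q else 0) * f q v) = 0" using c assms(3) by auto
    from f(2)[rule_format, of "\<lambda>q. if q < r' then c q else 0", OF this[rule_format], of q]
    show ?thesis using q assms(2) by simp
  qed
  then show ?thesis unfolding hilbert_ge_def
    by (intro exI[of _ f]) (use f(1) assms(2) in auto)
qed

lemma hilbert_ge_1:
  assumes "x \<in> Z" "x \<noteq> 0"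
  shows "hilbert_ge Z d 1"
proof -
  obtain j where j: "x $ j \<noteq> 0" using assms(2) by (auto simp: vec_eq_iff)
  have "form d (\<lambda>v. v $ j ^ d)" using form_power[OF form_coord, of d] by simp
  then show ?thesis unfolding hilbert_ge_def
    by (intro exI[of _ "\<lambda>_ v. v $ j ^ d"]) (use assms(1) j in auto)
qed

text \<open>Multiplication by \<open>F\<close> embeds forms on \<open>Z'\<close> into those
  vanishing on \<open>Z\<close>, and it is injective because \<open>Z'\<close> is irreducible. These
  products are independent of forms that stay independent on \<open>Z\<close>.\<close>

lemma hilbert_ge_step:
  assumes Z': "zariski_irreducible Z'" "0 \<notin> Z'" "Z \<subseteq> Z'"
    and F: "form e F" "\<And>v. v \<in> Z \<Longrightarrow> F v = 0" "x \<in> Z'" "F x \<noteq> 0"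
    and r: "hilbert_ge Z (e + d) r" and r': "hilbert_ge Z' d r'"
  shows "hilbert_ge Z' (e + d) (r + r')"
proof -
  obtain f where f: "\<forall>q<r. form (e + d) (f q)" "\<forall>c. (\<forall>v\<in>Z. (\<Sum>q<r. c q * f q v) = 0) \<longrightarrow> (\<forall>q<r. c q = 0)"
    using r unfolding hilbert_ge_def by auto
  obtain g where g: "\<forall>q<r'. form d (g q)" "\<forall>c. (\<forall>v\<in>Z'. (\<Sum>q<r'. c q * g q v) = 0) \<longrightarrow> (\<forall>q<r'. c q = 0)"
    using r' unfolding hilbert_ge_def by auto
  define k where "k q v = (if q < r then f q v else F v * g (q - r) v)" for q v
  have split: "(\<Sum>q<r + r'. c q * k q v) = (\<Sum>q<r. c q * f q v) + F v * (\<Sum>q<r'. c (q + r) * g q v)" for c v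
  proof -
    have "(\<Sum>q<r + r'. c q * k q v) = (\<Sum>q<r. c q * k q v) + (\<Sum>q\<in>{r..<r + r'}. c q * k q v)"
      by (subst sum.union_disjoint[symmetric]) (auto intro!: sum.cong)
    also have "(\<Sum>q\<in>{r..<r + r'}. c q * k q v) = (\<Sum>q<r'. c (q + r) * (F v * g q v))"
      by (rule sum.reindex_bij_witness[of _ "\<lambda>q. q + r" "\<lambda>q. q - r"]) (auto simp: k_def)
    also have "(\<Sum>q<r. c q * k q v) = (\<Sum>q<r. c q * f q v)" by (simp add: k_def)
    finally show ?thesis by (simp add: sum_distrib_left ac_simps)
  qed
  have "c q = 0" if c: "\<forall>v\<in>Z'. (\<Sum>q<r + r'. c q * k q v) = 0" and q: "q < r + r'" for c q
  proof -
    have "(\<Sum>q<r. c q * f q v) = 0" if "v \<in> Z" for v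
    proof -
      have "v \<in> Z'" using that Z'(3) by auto
      from bspec[OF c this] show ?thesis unfolding split using F(2)[OF that] by simp
    qed
    then have 1: "\<forall>q<r. c q = 0" using f(2) by blast
    then have "F v * (\<Sum>q<r'. c (q + r) * g q v) = 0" if "v \<in> Z'" for v
      using c that unfolding split by auto
    then have "(\<forall>v\<in>Z'. F v = 0) \<or> (\<forall>v\<in>Z'. (\<Sum>q<r'. c (q + r) * g q v) = 0)"
      using g(1) by (intro irreducible_prime[OF Z'(1,2) F(1)] form_sum form_scale) auto
    then have "\<forall>v\<in>Z'. (\<Sum>q<r'. c (q + r) * g q v) = 0" using F(3,4) by auto
    from g(2)[rule_format, of "\<lambda>q. c (q + r)", OF this[rule_format], of "q - r"] 1 q
    show ?thesis by (cases "q < r") auto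
  qed
  moreover have "form (e + d) (k q)" if "q < r + r'" for q
    using f(1) g(1) form_mult[OF F(1), of d "g (q - r)"] that
    unfolding k_def by (cases "q < r") auto
  ultimately show ?thesis unfolding hilbert_ge_def by (intro exI[of _ k]) auto
qed

text \<open>Each step of the chain adds Hilbert functions as Pascal's rule adds binomial
  coefficients, so length \<open>m\<close> forces growth of degree \<open>m\<close>. The factor
  \<open>E\<close> collects the degrees of the separating forms.\<close>

lemma hilbert_ge_chain:
  assumes "\<And>q. q \<le> m \<Longrightarrow> closedin zariski (Z q) \<and> zariski_irreducible (Z q)" "\<And>q. q < m \<Longrightarrow> Z q \<subset> Z (Suc q)"
  shows "\<exists>E\<ge>1. \<forall>s. hilbert_ge (Z m) (E * s) ((s + m) choose m)"
  using assms
proof (induction m)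
  case 0
  then have "Z 0 \<noteq> {}" "Z 0 \<subseteq> {v. v \<noteq> 0}"
    using closedin_subset[of zariski "Z 0"] by (simp_all add: zariski_irreducible_def topspace_zariski)
  then obtain x where "x \<in> Z 0" "x \<noteq> 0" by auto
  then have "hilbert_ge (Z 0) d 1" for d by (rule hilbert_ge_1)
  then show ?case by (intro exI[of _ 1]) simp
next
  case (Suc m)
  let ?Z = "Z m" and ?Z' = "Z (Suc m)"
  have IH: "\<exists>E\<ge>1. \<forall>s. hilbert_ge ?Z (E * s) ((s + m) choose m)"
    using Suc.prems by (intro Suc.IH) simp_all
  then obtain E where E: "\<And>s. hilbert_ge ?Z (E * s) ((s + m) choose m)" "E \<ge> 1" by auto
  have cl: "closedin zariski ?Z" "zariski_irreducible ?Z" "closedin zariski ?Z'" "zariski_irreducible ?Z'" "?Z \<subset> ?Z'"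
    using Suc.prems(1)[of m] Suc.prems(1)[of "Suc m"] Suc.prems(2)[of m] by simp_all
  have nz: "0 \<notin> ?Z'" using closedin_subset[OF cl(3)] by (auto simp: topspace_zariski)
  obtain x where x: "x \<in> ?Z'" "x \<notin> ?Z" using cl(5) by auto
  then have "x \<noteq> 0" using nz by auto
  obtain e h where h: "form e h" "h x \<noteq> 0" "\<forall>v\<in>?Z. h v = 0"
    using closedin_zariski_separate[OF cl(1) \<open>x \<noteq> 0\<close> x(2)] by auto
  obtain z where z: "z \<in> ?Z" using cl(2) unfolding zariski_irreducible_def by auto
  \<comment> \<open>A form of degree 0 is constant and cannot vanish on \<open>Z m\<close> without
    vanishing at \<open>x\<close>.\<close>
  have e: "e \<ge> 1"
  proof (rule ccontr)
    assume "\<not> e \<ge> 1"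
    then have "e = 0" by simp
    then have "h 0 = h x" "h 0 = h z" using form_homogeneous[OF h(1), of 0] by simp_all
    then show False using h(2,3) z by simp
  qed
  \<comment> \<open>The power \<open>E\<close> makes the degree a multiple of \<open>E\<close>, the
    spacing at which the bound for \<open>Z m\<close> is known.\<close>
  have F: "form (E * e) (\<lambda>v. h v ^ E)" by (rule form_power[OF h(1)])
  have "hilbert_ge ?Z' (E * e * s) ((s + Suc m) choose Suc m)" for s
  proof (induction s)
    case 0 then show ?case using hilbert_ge_1[OF x(1) \<open>x \<noteq> 0\<close>] by simp
  next
    case (Suc s)
    have "Suc s \<le> e * Suc s" using mult_le_mono1[OF e, of "Suc s"] by simp
    then have 1: "hilbert_ge ?Z (E * (e * Suc s)) ((Suc s + m) choose m)"
      by (intro hilbert_ge_mono[OF E(1)[of "e * Suc s"] _ order_refl] binomial_right_mono) simp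
    have "hilbert_ge ?Z' (E * e + E * e * s) (((Suc s + m) choose m) + ((s + Suc m) choose Suc m))"
    proof (rule hilbert_ge_step[OF cl(4) nz _ F _ x(1) _ _ Suc.IH])
      show "?Z \<subseteq> ?Z'" using cl(5) by auto
      show "hilbert_ge ?Z (E * e + E * e * s) ((Suc s + m) choose m)"
        using 1 by (simp add: algebra_simps)
    qed (use h E(2) in auto)
    moreover have "((Suc s + m) choose m) + ((s + Suc m) choose Suc m) = (Suc s + Suc m) choose Suc m"
      by simp
    ultimately show ?case by (simp add: algebra_simps)
  qed
  moreover have "E * e \<ge> 1" using e E(2) by simp
  ultimately show ?case by blast
qed

text \<open>The left side is at least \<open>((s + m) / m) ^ m\<close>, of degree \<open>m\<close>
  in \<open>s\<close>, against degree \<open>n\<close> on the right.\<close>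

lemma polynomial_growth:
  fixes m n B E :: nat
  assumes "\<And>s. (s + m) choose m \<le> (B * (E * s) + 1) ^ n"
  shows "m \<le> n"
proof (rule ccontr)
  assume "\<not> m \<le> n"
  then have mn: "Suc n \<le> m" "m > 0" by auto
  \<comment> \<open>Chosen so that the estimates end in \<open>?s ^ Suc n \<le> K * ?s ^ n\<close>,
    which fails for \<open>?s = K + 1\<close>.\<close>
  define K where "K = m ^ m * (B * E + 1) ^ n"
  let ?s = "K + 1"
  have "(of_nat (?s + m) / of_nat m :: real) ^ m \<le> of_nat ((?s + m) choose m)"
    by (rule binomial_ge_n_over_k_pow_k) simp
  then have "real (?s + m) ^ m \<le> real m ^ m * real ((?s + m) choose m)"
    using mn by (simp add: power_divide field_simps)
  then have "real ((?s + m) ^ m) \<le> real (m ^ m * ((?s + m) choose m))" by simp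
  then have 1: "(?s + m) ^ m \<le> m ^ m * ((?s + m) choose m)" by (rule of_nat_le_iff[THEN iffD1])
  have "?s * ?s ^ n = ?s ^ Suc n" by simp
  also have "\<dots> \<le> ?s ^ m" using mn by (intro power_increasing) auto
  also have "\<dots> \<le> (?s + m) ^ m" by (intro power_mono) auto
  also have "\<dots> \<le> m ^ m * ((?s + m) choose m)" by (rule 1)
  also have "\<dots> \<le> m ^ m * (B * (E * ?s) + 1) ^ n" by (intro mult_left_mono assms) simp
  also have "\<dots> \<le> m ^ m * ((B * E + 1) * ?s) ^ n"
    by (intro mult_left_mono power_mono) (auto simp: algebra_simps)
  also have "\<dots> = K * ?s ^ n" by (subst power_mult_distrib) (simp only: K_def mult.assoc)
  finally have "?s * ?s ^ n \<le> K * ?s ^ n" .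
  then show False by simp
qed

lemma zariski_dim_le_hilbert:
  assumes X: "closedin zariski X" and B: "\<And>d r. hilbert_ge X d r \<Longrightarrow> r \<le> (B * d + 1) ^ n"
  shows "zariski_dim X \<le> ereal (real n)"
proof (rule zariski_dim_le)
  fix m Z assume "irreducible_chain X m Z"
  then have Z: "\<And>q. q \<le> m \<Longrightarrow> closedin zariski (Z q) \<and> zariski_irreducible (Z q)" "\<And>q. q < m \<Longrightarrow> Z q \<subset> Z (Suc q)"
    "Z m \<subseteq> X"
    using closedin_closed_subtopology[OF X] by (auto simp: irreducible_chain_def)
  from hilbert_ge_chain[of m Z, OF Z(1,2)]
  obtain E where E: "\<And>s. hilbert_ge (Z m) (E * s) ((s + m) choose m)" by auto
  show "m \<le> n"
    by (rule polynomial_growth[where B = B and E = E]) (rule B[OF hilbert_ge_mono[OF E order_refl Z(3)]])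
qed

text \<open>Gaussian elimination by induction on the equations \<open>B\<close>: an unknown with
  nonzero coefficient in equation \<open>b0\<close> is eliminated from the others.\<close>

lemma underdetermined_system:
  fixes A :: "'q \<Rightarrow> 'b \<Rightarrow> 'a::field"
  assumes "finite B" "finite Q" "card Q > card B"
  shows "\<exists>c. (\<exists>q\<in>Q. c q \<noteq> 0) \<and> (\<forall>b\<in>B. (\<Sum>q\<in>Q. c q * A q b) = 0)"
  using assms
proof (induction B arbitrary: Q A)
  case empty
  then obtain q where "q \<in> Q" by fastforce
  then show ?case by (intro exI[of _ "\<lambda>_. 1"]) auto
next
  case (insert b0 B)
  show ?case
  proof (cases "\<forall>q\<in>Q. A q b0 = 0")
    case True
    have "\<exists>c. (\<exists>q\<in>Q. c q \<noteq> 0) \<and> (\<forall>b\<in>B. (\<Sum>q\<in>Q. c q * A q b) = 0)"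
      using insert.prems insert.hyps by (intro insert.IH) simp_all
    then obtain c where "\<exists>q\<in>Q. c q \<noteq> 0" "\<forall>b\<in>B. (\<Sum>q\<in>Q. c q * A q b) = 0" by auto
    then show ?thesis using True by (intro exI[of _ c]) simp
  next
    case False
    then obtain p where p: "p \<in> Q" "A p b0 \<noteq> 0" by auto
    let ?Q = "Q - {p}" and ?A = "\<lambda>q b. A q b - A q b0 / A p b0 * A p b"
    have "\<exists>c. (\<exists>q\<in>?Q. c q \<noteq> 0) \<and> (\<forall>b\<in>B. (\<Sum>q\<in>?Q. c q * ?A q b) = 0)"
    proof (rule insert.IH)
      show "card B < card ?Q" using insert.prems insert.hyps p(1) by simp
    qed (use insert.prems in simp)
    then obtain c where c: "\<exists>q\<in>?Q. c q \<noteq> 0" "\<forall>b\<in>B. (\<Sum>q\<in>?Q. c q * ?A q b) = 0" by auto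
    \<comment> \<open>The value at the eliminated unknown \<open>p\<close> is dictated by equation
      \<open>b0\<close>.\<close>
    define c' where "c' = c(p := - (\<Sum>q\<in>?Q. c q * A q b0) / A p b0)"
    have split: "(\<Sum>q\<in>Q. c' q * A q b) = (\<Sum>q\<in>?Q. c q * ?A q b)" for b
    proof -
      have "(\<Sum>q\<in>Q. c' q * A q b) = c' p * A p b + (\<Sum>q\<in>?Q. c' q * A q b)"
        using insert.prems(1) p(1) by (rule sum.remove)
      also have "(\<Sum>q\<in>?Q. c' q * A q b) = (\<Sum>q\<in>?Q. c q * A q b)"
        by (rule sum.cong) (auto simp: c'_def)
      also have "c' p * A p b = - (\<Sum>q\<in>?Q. c q * (A q b0 / A p b0 * A p b))"
        by (simp add: c'_def sum_distrib_right sum_divide_distrib sum_negf mult.assoc)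
      finally show ?thesis by (simp add: right_diff_distrib sum_subtractf)
    qed
    have "(\<Sum>q\<in>Q. c' q * A q b0) = 0" unfolding split using p(2) by simp
    moreover have "\<exists>q\<in>Q. c' q \<noteq> 0" using c(1) by (auto simp: c'_def)
    ultimately show ?thesis using c(2) by (intro exI[of _ c']) (simp add: split)
  qed
qed


section \<open>Linear isomorphisms\<close>

lemma form_linear:
  fixes f :: "'a::field_char_0 ^ 'i::finite \<Rightarrow> 'a" and \<phi> :: "'a ^ 'j::finite \<Rightarrow> 'a ^ 'i"
  assumes \<phi>: "Vector_Spaces.linear (*s) (*s) \<phi>" and f: "form d f"
  shows "form d (\<lambda>v. f (\<phi> v))"
proof -
  have "\<phi> v $ i = pairing (matrix \<phi> $ i) v" for v i
    using matrix_works[OF \<phi>] by (simp add: matrix_vector_pairing[symmetric])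
  then have "polyfun (\<lambda>v. f (\<phi> v))"
    by (intro polyfun_compose[OF form_polyfun[OF f]]) (simp add: polyfun_pairing)
  then show ?thesis
    by (simp add: form_iff_homogeneous form_homogeneous[OF f] vec.linear_scale[OF \<phi>])
qed

text \<open>The inverse is a parameter, so that every inclusion proved for one map yields the
  reverse one through \<open>swap\<close>.\<close>

locale linear_iso =
  fixes \<phi> \<psi> :: "'a::field_char_0 ^ 'i::finite \<Rightarrow> 'a ^ 'i"
  assumes \<phi>: "Vector_Spaces.linear (*s) (*s) \<phi>" and \<psi>: "Vector_Spaces.linear (*s) (*s) \<psi>"
    and inv: "\<And>v. \<psi> (\<phi> v) = v" "\<And>v. \<phi> (\<psi> v) = v"
begin

lemma swap: "linear_iso \<psi> \<phi>"
  by (rule linear_iso.intro[OF \<psi> \<phi> inv(2,1)])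

lemma nonzero: "v \<noteq> 0 \<Longrightarrow> \<phi> v \<noteq> 0"
  by (metis inv(1) vec.linear_0[OF \<psi>])

lemma image_inverse: "\<psi> ` (\<phi> ` S) = S"
  by (auto simp: image_image inv)

lemma closure_subset: "\<phi> ` (zariski closure_of S) \<subseteq> zariski closure_of (\<phi> ` S)"
proof
  fix w assume "w \<in> \<phi> ` (zariski closure_of S)"
  then obtain v where v: "w = \<phi> v" "v \<in> zariski closure_of S" by auto
  show "w \<in> zariski closure_of (\<phi> ` S)"
    unfolding zariski_closure_eq
  proof (intro CollectI conjI allI impI)
    show "w \<noteq> 0" using v nonzero by (simp add: zariski_closure_eq)
    fix d f assume f: "form d f" "\<forall>s\<in>\<phi> ` S. s \<noteq> 0 \<longrightarrow> f s = 0"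
    then have fS: "\<forall>s\<in>S. s \<noteq> 0 \<longrightarrow> f (\<phi> s) = 0" using nonzero by auto
    have "\<forall>d f. form d f \<longrightarrow> (\<forall>s\<in>S. s \<noteq> 0 \<longrightarrow> f s = 0) \<longrightarrow> f v = 0"
      using v(2) by (simp add: zariski_closure_eq)
    from spec[OF spec[OF this, of d], of "\<lambda>v. f (\<phi> v)"]
    show "f w = 0" using fS v(1) form_linear[OF \<phi> f(1)] by simp
  qed
qed

lemma closure_image: "\<phi> ` (zariski closure_of S) = zariski closure_of (\<phi> ` S)"
proof
  have "\<psi> ` (zariski closure_of (\<phi> ` S)) \<subseteq> zariski closure_of S"
    using linear_iso.closure_subset[OF swap, of "\<phi> ` S"] by (simp add: image_inverse)
  then have "\<phi> ` \<psi> ` (zariski closure_of (\<phi> ` S)) \<subseteq> \<phi> ` (zariski closure_of S)" by (rule image_mono)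
  then show "zariski closure_of (\<phi> ` S) \<subseteq> \<phi> ` (zariski closure_of S)"
    using linear_iso.image_inverse[OF swap] by simp
qed (rule closure_subset)

lemma closedin_image: "closedin zariski C \<Longrightarrow> closedin zariski (\<phi> ` C)"
  by (metis closure_image closure_of_closedin closedin_closure_of)

lemma irreducible_image:
  assumes "zariski_irreducible Z"
  shows "zariski_irreducible (\<phi> ` Z)"
  unfolding zariski_irreducible_def
proof (intro conjI allI impI)
  show "\<phi> ` Z \<noteq> {}" using assms by (simp add: zariski_irreducible_def)
  fix C D assume CD: "closedin zariski C" "closedin zariski D" "\<phi> ` Z \<subseteq> C \<union> D"
  then have "\<psi> ` \<phi> ` Z \<subseteq> \<psi> ` C \<union> \<psi> ` D" by blast
  then have "Z \<subseteq> \<psi> ` C \<union> \<psi> ` D" by (simp only: image_inverse)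
  then have "Z \<subseteq> \<psi> ` C \<or> Z \<subseteq> \<psi> ` D"
    using assms linear_iso.closedin_image[OF swap CD(1)] linear_iso.closedin_image[OF swap CD(2)]
    by (simp add: zariski_irreducible_def)
  then have "\<phi> ` Z \<subseteq> \<phi> ` \<psi> ` C \<or> \<phi> ` Z \<subseteq> \<phi> ` \<psi> ` D" by blast
  then show "\<phi> ` Z \<subseteq> C \<or> \<phi> ` Z \<subseteq> D" by (simp add: linear_iso.image_inverse[OF swap])
qed

lemma chain_image:
  assumes X: "closedin zariski X" and Z: "irreducible_chain X m Z"
  shows "irreducible_chain (\<phi> ` X) m (\<lambda>q. \<phi> ` Z q)"
proof -
  have inj: "inj \<phi>" by (metis injI inv(1))
  have "closedin zariski (Z q)" "Z q \<subseteq> X" "zariski_irreducible (Z q)" if "q \<le> m" for q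
    using Z that closedin_closed_subtopology[OF X] by (auto simp: irreducible_chain_def)
  then have "closedin (subtopology zariski (\<phi> ` X)) (\<phi> ` Z q) \<and> zariski_irreducible (\<phi> ` Z q)" if "q \<le> m" for q
    using that closedin_closed_subtopology[OF closedin_image[OF X]] by (auto intro: closedin_image irreducible_image)
  moreover have "\<phi> ` Z q \<subset> \<phi> ` Z (Suc q)" if "q < m" for q
    using Z that inj by (auto simp: irreducible_chain_def psubset_eq inj_image_eq_iff)
  ultimately show ?thesis by (simp add: irreducible_chain_def)
qed

lemma dim_image:
  assumes X: "closedin zariski X"
  shows "zariski_dim (\<phi> ` X) = zariski_dim X"
proof -
  have "(\<exists>Z. irreducible_chain (\<phi> ` X) m Z) \<longleftrightarrow> (\<exists>Z. irreducible_chain X m Z)" for m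
  proof
    assume "\<exists>Z. irreducible_chain (\<phi> ` X) m Z"
    then obtain Z where "irreducible_chain (\<phi> ` X) m Z" by auto
    from linear_iso.chain_image[OF swap closedin_image[OF X] this]
    show "\<exists>Z. irreducible_chain X m Z" unfolding image_inverse by (rule exI[of _ "\<lambda>q. \<psi> ` Z q"])
  next
    assume "\<exists>Z. irreducible_chain X m Z"
    then obtain Z where "irreducible_chain X m Z" by auto
    from chain_image[OF X this] show "\<exists>Z. irreducible_chain (\<phi> ` X) m Z" by (rule exI[of _ "\<lambda>q. \<phi> ` Z q"])
  qed
  then show ?thesis by (simp add: zariski_dim_eq)
qed

end

lemma linear_iso_bij:
  fixes \<phi> :: "'a::field_char_0 ^ 'i::finite \<Rightarrow> 'a ^ 'i"
  assumes "Vector_Spaces.linear (*s) (*s) \<phi>" "bij \<phi>"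
  shows "linear_iso \<phi> (inv \<phi>)"
proof -
  have "Vector_Spaces.linear (*s) (*s) (inv \<phi>)"
  proof (intro Vector_Spaces.linear_iff[THEN iffD2] conjI allI vec.vector_space_axioms)
    show "inv \<phi> (x + y) = inv \<phi> x + inv \<phi> y" for x y
      using assms by (intro inv_f_eq) (auto simp: bij_def vec.linear_add surj_f_inv_f)
    show "inv \<phi> (c *s x) = c *s inv \<phi> x" for c x
      using assms by (intro inv_f_eq) (auto simp: bij_def vec.linear_scale surj_f_inv_f)
  qed
  from linear_iso.intro[OF assms(1) this] show ?thesis using assms(2) by (simp add: bij_def surj_f_inv_f)
qed


section \<open>Orbits of monomial parametrizations\<close>

text \<open>A torus of dimension \<open>n + 1\<close> acting on the cone: \<open>t 0\<close> has
  exponent 1 in every coordinate and scales. A whole set of base points is allowed because the dual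
  variety is swept out by the orbits of all kernel vectors.\<close>

definition orbit :: "nat \<Rightarrow> ('i \<Rightarrow> nat \<Rightarrow> int) \<Rightarrow> ('a::field ^ 'i::finite) set \<Rightarrow> ('a ^ 'i) set" where
  "orbit n c P = {(\<chi> i. p $ i * (\<Prod>j\<le>n. t j powi homogenised c i j)) | p t. p \<in> P \<and> (\<forall>j\<le>n. t j \<noteq> 0)}"

lemma orbitI: "p \<in> P \<Longrightarrow> (\<And>j. j \<le> n \<Longrightarrow> t j \<noteq> 0) \<Longrightarrow> (\<chi> i. p $ i * (\<Prod>j\<le>n. t j powi homogenised c i j)) \<in> orbit n c P"
  unfolding orbit_def by auto

lemma orbitE:
  assumes "x \<in> orbit n c P"
  obtains p t where "p \<in> P" "\<forall>j\<le>n. t j \<noteq> 0" "x = (\<chi> i. p $ i * (\<Prod>j\<le>n. t j powi homogenised c i j))"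
  using assms unfolding orbit_def by auto

lemma prod_homogenised:
  "(\<Prod>j\<le>n. t j powi homogenised c i j) = t 0 * (\<Prod>j<n. t (Suc j) powi c i j)"
  unfolding lessThan_Suc_atMost[symmetric] prod.lessThan_Suc_shift by (simp add: homogenised_def)

lemma orbit_cone: "cone (orbit n c P)"
  unfolding cone_def
proof (intro ballI allI impI)
  fix v and r :: 'a assume "v \<in> orbit n c P" "r \<noteq> 0"
  then obtain p t where 1: "p \<in> P" "\<forall>j\<le>n. t j \<noteq> 0" "v = (\<chi> i. p $ i * (\<Prod>j\<le>n. t j powi homogenised c i j))"
    by (elim orbitE)
  have "r *s v = (\<chi> i. p $ i * (\<Prod>j\<le>n. (t(0 := r * t 0)) j powi homogenised c i j))"
    unfolding 1(3) prod_homogenised by (simp add: vec_eq_iff)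
  also have "\<dots> \<in> orbit n c P" using 1 \<open>r \<noteq> 0\<close> by (intro orbitI) auto
  finally show "r *s v \<in> orbit n c P" .
qed

lemma orbit_nonzero: "(\<And>p. p \<in> P \<Longrightarrow> p \<noteq> 0) \<Longrightarrow> 0 \<notin> orbit n c P"
proof
  assume P: "\<And>p. p \<in> P \<Longrightarrow> p \<noteq> 0" and "0 \<in> orbit n c P"
  then obtain p t where 1: "p \<in> P" "\<forall>j\<le>n. t j \<noteq> 0" "0 = (\<chi> i. p $ i * (\<Prod>j\<le>n. t j powi homogenised c i j))"
    by (elim orbitE)
  have "p $ i * (\<Prod>j\<le>n. t j powi homogenised c i j) = 0" for i using 1(3) by (simp add: vec_eq_iff)
  then have "p $ i = 0" for i using 1(2) by (simp add: prod_zero_iff)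
  then show False using P[OF 1(1)] by (simp add: vec_eq_iff)
qed

text \<open>The extra parameter \<open>t 0\<close> only rescales a point, and the zeros of forms are
  invariant under nonzero scalars.\<close>

lemma closure_orbit:
  fixes p :: "'a::field_char_0 ^ 'i::finite"
  shows "zariski closure_of {(\<chi> i. p $ i * (\<Prod>j<n. t j powi c i j)) | t. t \<in> torus n} = zariski closure_of (orbit n c {p})"
    (is "zariski closure_of ?T = _")
proof (rule equalityI[OF closure_of_mono])
  show "?T \<subseteq> orbit n c {p}"
  proof clarify
    fix t :: "nat \<Rightarrow> 'a" assume "t \<in> torus n"
    then have "(\<chi> i. p $ i * (\<Prod>j\<le>n. case_nat 1 t j powi homogenised c i j)) \<in> orbit n c {p}"
      by (intro orbitI) (auto simp: torus_def split: nat.split)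
    then show "(\<chi> i. p $ i * (\<Prod>j<n. t j powi c i j)) \<in> orbit n c {p}" by (simp add: prod_homogenised)
  qed
  show "zariski closure_of (orbit n c {p}) \<subseteq> zariski closure_of ?T"
  proof
    fix v assume v: "v \<in> zariski closure_of (orbit n c {p})"
    show "v \<in> zariski closure_of ?T" unfolding zariski_closure_eq
    proof (intro CollectI conjI allI impI)
      show "v \<noteq> 0" using v by (simp add: zariski_closure_eq)
      fix d f assume f: "form d f" "\<forall>s\<in>?T. s \<noteq> 0 \<longrightarrow> f s = 0"
      have "f s = 0" if "s \<in> orbit n c {p}" "s \<noteq> 0" for s
      proof -
        obtain t where t: "\<forall>j\<le>n. t j \<noteq> 0" "s = (\<chi> i. p $ i * (\<Prod>j\<le>n. t j powi homogenised c i j))"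
          using \<open>s \<in> orbit n c {p}\<close> by (auto elim: orbitE)
        let ?s = "\<chi> i. p $ i * (\<Prod>j<n. t (Suc j) powi c i j)"
        have s: "s = t 0 *s ?s" unfolding t(2) prod_homogenised by (simp add: vec_eq_iff)
        have "(\<lambda>j. t (Suc j)) \<in> torus n" using t(1) by (auto simp: torus_def)
        then have "?s \<in> ?T" by (intro CollectI exI[of _ "\<lambda>j. t (Suc j)"]) simp
        moreover have "?s \<noteq> 0" using s \<open>s \<noteq> 0\<close> by auto
        ultimately have "f ?s = 0" using f(2) by blast
        then show ?thesis unfolding s by (simp add: form_homogeneous[OF f(1)])
      qed
      moreover have "\<forall>d f. form d f \<longrightarrow> (\<forall>s\<in>orbit n c {p}. s \<noteq> 0 \<longrightarrow> f s = 0) \<longrightarrow> f v = 0"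
        using v by (simp add: zariski_closure_eq)
      ultimately show "f v = 0" using f(1) by simp
    qed
  qed
qed

lemma exponent_bound:
  fixes c :: "'i::finite \<Rightarrow> nat \<Rightarrow> int"
  obtains B :: nat where "\<forall>i. \<forall>j\<le>n. \<bar>homogenised c i j\<bar> \<le> int B"
proof -
  have "\<bar>homogenised c i j\<bar> \<le> (\<Sum>i\<in>UNIV. \<Sum>j\<le>n. \<bar>homogenised c i j\<bar>)" if "j \<le> n" for i j
  proof -
    have "\<bar>homogenised c i j\<bar> \<le> (\<Sum>j\<le>n. \<bar>homogenised c i j\<bar>)"
      using that by (intro member_le_sum[of j "{..n}" "\<lambda>j. \<bar>homogenised c i j\<bar>"]) auto
    also have "\<dots> \<le> (\<Sum>i\<in>UNIV. \<Sum>j\<le>n. \<bar>homogenised c i j\<bar>)"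
      by (intro member_le_sum[of i UNIV "\<lambda>i. \<Sum>j\<le>n. \<bar>homogenised c i j\<bar>"]) (auto intro: sum_nonneg)
    finally show ?thesis .
  qed
  then show ?thesis by (intro that[of "nat (\<Sum>i\<in>UNIV. \<Sum>j\<le>n. \<bar>homogenised c i j\<bar>)"]) force
qed

lemma powi_shift:
  fixes t :: "'a::field"
  assumes "t \<noteq> 0" "\<bar>b\<bar> \<le> int B"
  shows "t powi b * t ^ B = t ^ nat (b + int B)"
proof -
  have "t powi b * t powi int B = t powi (b + int B)" using assms(1) by (simp add: power_int_add)
  also have "\<dots> = t ^ nat (b + int B)" using assms(2) by (simp add: power_int_def)
  finally show ?thesis by simp
qed

text \<open>Rescaling the degree parameter makes all exponents nonnegative.\<close>

lemma orbit_eq_nat: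
  fixes P :: "('a::field ^ 'i::finite) set"
  assumes B: "\<forall>i. \<forall>j\<le>n. \<bar>homogenised c i j\<bar> \<le> int B"
  shows "orbit n c P = {(\<chi> i. p $ i * (t 0 * (\<Prod>j<n. t (Suc j) ^ nat (c i j + int B)))) | p t. p \<in> P \<and> (\<forall>j\<le>n. t j \<noteq> 0)}"
proof -
  have Bc: "\<bar>c i j\<bar> \<le> int B" if "j < n" for i j
    using B[rule_format, of "Suc j" i] that by (simp add: homogenised_def)
  have key: "(\<Prod>j<n. t (Suc j) powi c i j) * (\<Prod>j<n. t (Suc j) ^ B) = (\<Prod>j<n. t (Suc j) ^ nat (c i j + int B))"
    if "\<forall>j\<le>n. t j \<noteq> 0" for t :: "nat \<Rightarrow> 'a" and i
    unfolding prod.distrib[symmetric] using that Bc by (intro prod.cong powi_shift) auto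
  show ?thesis
  proof (intro equalityI subsetI)
    fix x assume "x \<in> orbit n c P"
    then obtain p t where 1: "p \<in> P" "\<forall>j\<le>n. t j \<noteq> 0" "x = (\<chi> i. p $ i * (\<Prod>j\<le>n. t j powi homogenised c i j))"
      by (elim orbitE)
    define Q where "Q = (\<Prod>j<n. t (Suc j) ^ B)"
    have Q: "Q \<noteq> 0" using 1(2) by (auto simp: Q_def prod_zero_iff)
    have k: "(\<Prod>j<n. t (Suc j) powi c i j) * Q = (\<Prod>j<n. t (Suc j) ^ nat (c i j + int B))" for i
      unfolding Q_def by (rule key[OF 1(2)])
    let ?t = "t(0 := t 0 / Q)"
    have "x = (\<chi> i. p $ i * (?t 0 * (\<Prod>j<n. ?t (Suc j) ^ nat (c i j + int B))))"
      unfolding 1(3) prod_homogenised using Q by (simp add: vec_eq_iff k[symmetric])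
    moreover have "\<forall>j\<le>n. ?t j \<noteq> 0" using 1(2) Q by simp
    ultimately show "x \<in> {(\<chi> i. p $ i * (t 0 * (\<Prod>j<n. t (Suc j) ^ nat (c i j + int B)))) | p t. p \<in> P \<and> (\<forall>j\<le>n. t j \<noteq> 0)}"
      using 1(1) by blast
  next
    fix x assume "x \<in> {(\<chi> i. p $ i * (t 0 * (\<Prod>j<n. t (Suc j) ^ nat (c i j + int B)))) | p t. p \<in> P \<and> (\<forall>j\<le>n. t j \<noteq> 0)}"
    then obtain p t where 1: "p \<in> P" "\<forall>j\<le>n. t j \<noteq> 0" "x = (\<chi> i. p $ i * (t 0 * (\<Prod>j<n. t (Suc j) ^ nat (c i j + int B))))"
      by blast
    define Q where "Q = (\<Prod>j<n. t (Suc j) ^ B)"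
    have Q: "Q \<noteq> 0" using 1(2) by (auto simp: Q_def prod_zero_iff)
    have k: "(\<Prod>j<n. t (Suc j) powi c i j) * Q = (\<Prod>j<n. t (Suc j) ^ nat (c i j + int B))" for i
      unfolding Q_def by (rule key[OF 1(2)])
    let ?t = "t(0 := t 0 * Q)"
    have "x = (\<chi> i. p $ i * (\<Prod>j\<le>n. ?t j powi homogenised c i j))"
      unfolding 1(3) prod_homogenised k[symmetric] by (simp add: vec_eq_iff ac_simps)
    also have "\<dots> \<in> orbit n c P" using 1 Q by (intro orbitI) auto
    finally show "x \<in> orbit n c P" .
  qed
qed

lemma line_component: "(p + s *s (q - p)) $ i = p $ i + s * (q $ i - p $ (i::'i::finite) :: 'a::field)"
  by (simp add: algebra_simps)

text \<open>With nonnegative exponents, moving the base point and the torus parameters along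
  straight lines gives a polynomial curve. It can leave the orbit only where a parameter becomes
  zero or the base point leaves \<open>P\<close>.\<close>

lemma orbit_connected:
  fixes P :: "('a::field_char_0 ^ 'i::finite) set"
  assumes P: "\<And>p q. p \<in> P \<Longrightarrow> q \<in> P \<Longrightarrow> finite {s. p + s *s (q - p) \<notin> P}"
  shows "rationally_connected (orbit n c P)"
  unfolding rationally_connected_def
proof (intro ballI)
  fix x y assume xy: "x \<in> orbit n c P" "y \<in> orbit n c P"
  obtain B :: nat where B: "\<forall>i. \<forall>j\<le>n. \<bar>homogenised c i j\<bar> \<le> int B" by (rule exponent_bound)
  let ?e = "\<lambda>i j. nat (c i j + int B)"
  note O = orbit_eq_nat[OF B, of P]
  obtain p t where 1: "p \<in> P" "\<forall>j\<le>n. t j \<noteq> 0" "x = (\<chi> i. p $ i * (t 0 * (\<Prod>j<n. t (Suc j) ^ ?e i j)))"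
    using xy(1) unfolding O by blast
  obtain q r where 2: "q \<in> P" "\<forall>j\<le>n. r j \<noteq> 0" "y = (\<chi> i. q $ i * (r 0 * (\<Prod>j<n. r (Suc j) ^ ?e i j)))"
    using xy(2) unfolding O by blast
  let ?l = "\<lambda>j. [:t j, r j - t j:]"
  let ?\<gamma> = "\<lambda>i. [:p $ i, q $ i - p $ i:] * (?l 0 * (\<Prod>j<n. ?l (Suc j) ^ ?e i j))"
  let ?t = "\<lambda>s j. t j + s * (r j - t j)"
  have c: "curve ?\<gamma> s = (\<chi> i. (p + s *s (q - p)) $ i * (?t s 0 * (\<Prod>j<n. ?t s (Suc j) ^ ?e i j)))" for s
    unfolding curve_def line_component by (simp add: poly_prod del: mult_pCons_left mult_pCons_right)
  have "{s. curve ?\<gamma> s \<notin> orbit n c P} \<subseteq> {s. p + s *s (q - p) \<notin> P} \<union> (\<Union>j\<le>n. {s. poly (?l j) s = 0})"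
  proof clarify
    fix s assume s: "curve ?\<gamma> s \<notin> orbit n c P" "s \<notin> (\<Union>j\<le>n. {s. poly (?l j) s = 0})" "p + s *s (q - p) \<in> P"
    have "\<forall>j\<le>n. ?t s j \<noteq> 0" using s(2) by auto
    with s(3) have "curve ?\<gamma> s \<in> orbit n c P" unfolding c O
      by (intro CollectI exI[of _ "p + s *s (q - p)"] exI[of _ "?t s"] conjI refl)
    then show False using s(1) by blast
  qed
  moreover have "finite (\<Union>j\<le>n. {s. poly (?l j) s = 0})"
    using 1(2) by (intro finite_UN_I poly_roots_finite) auto
  ultimately have "finite {s. curve ?\<gamma> s \<notin> orbit n c P}" using P[OF 1(1) 2(1)] by (meson finite_Un finite_subset)
  moreover have "curve ?\<gamma> 0 = x" unfolding c 1(3) by simp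
  moreover have "curve ?\<gamma> 1 = y" unfolding c 2(3) by simp
  ultimately show "\<exists>\<gamma>. curve \<gamma> 0 = x \<and> curve \<gamma> 1 = y \<and> finite {s. curve \<gamma> s \<notin> orbit n c P}" by blast
qed

lemma orbit_connected_singleton: "rationally_connected (orbit n c {p :: 'a::field_char_0 ^ 'i::finite})"
  by (rule orbit_connected) simp

text \<open>The line from \<open>p\<close> to \<open>q\<close> stays in \<open>L\<close>, and a
  coordinate with \<open>p $ i \<noteq> 0\<close> lets it meet 0 for finitely many \<open>s\<close>
  only.\<close>

lemma orbit_connected_subspace:
  fixes L :: "('a::field_char_0 ^ 'i::finite) set"
  assumes "vec.subspace L"
  shows "rationally_connected (orbit n c (L - {0}))"
proof (rule orbit_connected)
  fix p q assume pq: "p \<in> L - {0}" "q \<in> L - {0}"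
  obtain i where i: "p $ i \<noteq> 0" using pq by (auto simp: vec_eq_iff)
  have "{s. p + s *s (q - p) \<notin> L - {0}} \<subseteq> {s. poly [:p $ i, q $ i - p $ i:] s = 0}"
  proof
    fix s assume "s \<in> {s. p + s *s (q - p) \<notin> L - {0}}"
    moreover have "p + s *s (q - p) \<in> L"
      using pq by (intro vec.subspace_add[OF assms] vec.subspace_scale[OF assms] vec.subspace_diff[OF assms]) auto
    ultimately have "p + s *s (q - p) = 0" by blast
    then have "p $ i + s * (q $ i - p $ i) = 0" unfolding line_component[symmetric] by simp
    then show "s \<in> {s. poly [:p $ i, q $ i - p $ i:] s = 0}" by simp
  qed
  moreover have "finite {s. poly [:p $ i, q $ i - p $ i:] s = 0}" using i by (intro poly_roots_finite) simp
  ultimately show "finite {s. p + s *s (q - p) \<notin> L - {0}}" by (rule finite_subset)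
qed

lemma powi_sum: "t \<noteq> 0 \<Longrightarrow> (t :: 'a::field) powi (\<Sum>i\<in>I. f i) = (\<Prod>i\<in>I. t powi f i)"
  by (induction I rule: infinite_finite_induct) (simp_all add: power_int_add)

lemma prod_powi: "(\<Prod>i\<in>I. f i :: 'a::field) powi k = (\<Prod>i\<in>I. f i powi k)"
  by (induction I rule: infinite_finite_induct) (simp_all add: power_int_mult_distrib)

lemma powi_nat_parts: "t \<noteq> 0 \<Longrightarrow> (t :: 'a::field) powi z * t ^ nat (- z) = t ^ nat z"
  by (cases "z \<ge> 0") (simp_all add: power_int_def power_mult_distrib[symmetric])

section \<open>Binomial equations and monomials on orbits\<close>

text \<open>The homogeneous form of the binomial relation \<open>x\<^sup>z = 1\<close>.\<close>

definition binomial_form :: "('i \<Rightarrow> int) \<Rightarrow> 'a::field ^ 'i::finite \<Rightarrow> 'a" where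
  "binomial_form z v = (\<Prod>i\<in>UNIV. v $ i ^ nat (z i)) - (\<Prod>i\<in>UNIV. v $ i ^ nat (- z i))"

lemma polyfun_binomial_form: "polyfun (binomial_form z)"
  unfolding binomial_form_def[abs_def] by (intro polyfun_intros)

text \<open>Exponents with sum zero have positive and negative parts of the same total
  degree.\<close>

lemma form_binomial_form:
  assumes "(\<Sum>i\<in>UNIV. z i) = 0"
  shows "form (\<Sum>i\<in>UNIV. nat (z i)) (binomial_form z :: 'a::field ^ 'i::finite \<Rightarrow> 'a)"
proof -
  define d e where "d = (\<Sum>i\<in>UNIV. nat (z i))" and "e = (\<Sum>i\<in>UNIV. nat (- z i))"
  have "int d - int e = (\<Sum>i\<in>UNIV. z i)"
    unfolding d_def e_def of_nat_sum sum_subtractf[symmetric] by (rule sum.cong) auto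
  then have eq: "(\<Sum>i\<in>UNIV. nat (- z i)) = (\<Sum>i\<in>UNIV. nat (z i))"
    unfolding d_def[symmetric] e_def[symmetric] using assms by simp
  have 1: "form (\<Sum>i\<in>UNIV. nat (z i)) (\<lambda>v::'a^'i. (-1) * (\<Prod>i\<in>UNIV. v $ i ^ nat (- z i)))"
    using form_scale[OF form_monomial[of "\<lambda>i. nat (- z i)"], of "-1"] unfolding eq .
  have "(\<lambda>v::'a^'i. (\<Prod>i\<in>UNIV. v $ i ^ nat (z i)) + (-1) * (\<Prod>i\<in>UNIV. v $ i ^ nat (- z i))) = binomial_form z"
    by (simp add: binomial_form_def fun_eq_iff)
  then show ?thesis using form_add[OF form_monomial[of "\<lambda>i. nat (z i)"] 1] by simp
qed

lemma binomial_form_eq_0_iff: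
  assumes "\<And>i. v $ i \<noteq> 0"
  shows "binomial_form z v = 0 \<longleftrightarrow> (\<Prod>i\<in>UNIV. v $ i powi z i) = 1"
proof -
  let ?M = "\<Prod>i\<in>UNIV. v $ i ^ nat (- z i)"
  have "(\<Prod>i\<in>UNIV. v $ i powi z i) * ?M = (\<Prod>i\<in>UNIV. v $ i ^ nat (z i))"
    unfolding prod.distrib[symmetric] using assms by (intro prod.cong refl powi_nat_parts)
  then have "binomial_form z v = ((\<Prod>i\<in>UNIV. v $ i powi z i) - 1) * ?M"
    by (simp add: binomial_form_def algebra_simps)
  moreover have "?M \<noteq> 0" using assms by (simp add: prod_zero_iff)
  ultimately show ?thesis using assms by simp
qed

lemma orbit_monomial:
  assumes "\<forall>j\<le>n. t j \<noteq> 0"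
  shows "(\<Prod>i\<in>UNIV. (\<Prod>j\<le>n. t j powi homogenised c i j) powi z i)
    = (\<Prod>j\<le>n. (t j :: 'a::field) powi (\<Sum>i\<in>UNIV. z i * homogenised c (i::'i::finite) j))"
proof -
  have "(\<Prod>i\<in>UNIV. (\<Prod>j\<le>n. t j powi homogenised c i j) powi z i)
     = (\<Prod>i\<in>UNIV. \<Prod>j\<le>n. t j powi (z i * homogenised c i j))"
    by (simp add: prod_powi power_int_mult[symmetric] mult.commute)
  also have "\<dots> = (\<Prod>j\<le>n. \<Prod>i\<in>UNIV. t j powi (z i * homogenised c i j))" by (rule prod.swap)
  also have "\<dots> = (\<Prod>j\<le>n. t j powi (\<Sum>i\<in>UNIV. z i * homogenised c i j))"
    using assms by (intro prod.cong refl powi_sum[symmetric]) auto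
  finally show ?thesis .
qed

text \<open>The logarithmic derivative is linear in the exponents, which turns binomial equations
  into linear conditions on the quotients \<open>P i s / s $ i\<close>.\<close>

lemma vf_monomial:
  fixes s :: "'a::field_char_0 ^ 'i::finite"
  assumes "\<And>i. s $ i \<noteq> 0"
  shows "vf P (\<lambda>v. \<Prod>i\<in>I. v $ i ^ \<alpha> i) s = (\<Sum>i\<in>I. of_nat (\<alpha> i) * P i s / s $ i) * (\<Prod>i\<in>I. s $ i ^ \<alpha> i)"
proof (induction I rule: infinite_finite_induct)
  case (insert i I)
  have pow: "vf P (\<lambda>v. v $ i ^ m) s = of_nat m * P i s / s $ i * s $ i ^ m" for m
  proof (induction m)
    case (Suc m)
    have "vf P (\<lambda>v. v $ i * v $ i ^ m) s = s $ i * vf P (\<lambda>v. v $ i ^ m) s + s $ i ^ m * P i s"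
      by (simp add: vf_mult polyfun_intros vf_coord)
    then show ?case using assms[of i] by (simp add: Suc field_simps)
  qed (simp add: vf_const)
  have "vf P (\<lambda>v. \<Prod>i\<in>insert i I. v $ i ^ \<alpha> i) s = vf P (\<lambda>v. v $ i ^ \<alpha> i * (\<Prod>i\<in>I. v $ i ^ \<alpha> i)) s"
    using insert.hyps by simp
  also have "\<dots> = s $ i ^ \<alpha> i * vf P (\<lambda>v. \<Prod>i\<in>I. v $ i ^ \<alpha> i) s + (\<Prod>i\<in>I. s $ i ^ \<alpha> i) * vf P (\<lambda>v. v $ i ^ \<alpha> i) s"
    by (subst vf_mult) (auto intro!: polyfun_intros)
  finally show ?case unfolding insert.IH pow using insert.hyps by (simp add: algebra_simps)
qed (simp_all add: vf_const)


section \<open>Toric varieties\<close>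

lemma independent_family:
  fixes f :: "'l \<Rightarrow> 'a::field ^ 'i::finite"
  assumes "finite J" "\<And>c. (\<Sum>j\<in>J. c j *s f j) = 0 \<Longrightarrow> \<forall>j\<in>J. c j = 0"
  shows "vec.dim (f ` J) = card J"
proof -
  have inj: "inj_on f J"
  proof (rule inj_onI, rule ccontr)
    fix x y assume xy: "x \<in> J" "y \<in> J" "f x = f y" "x \<noteq> y"
    let ?c = "\<lambda>j. if j = x then 1 else if j = y then -1 else 0"
    have "(\<Sum>j\<in>J. ?c j *s f j) = (\<Sum>j\<in>{x, y}. ?c j *s f j)"
      using xy assms(1) by (intro sum.mono_neutral_right) auto
    also have "\<dots> = 0" using xy by (simp add: vec_eq_iff)
    finally show False using assms(2)[of ?c] xy by auto
  qed
  have "vec.independent (f ` J)"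
  proof (rule vec.independent_if_scalars_zero)
    fix c x assume c: "(\<Sum>x\<in>f ` J. c x *s x) = 0" and x: "x \<in> f ` J"
    have "(\<Sum>j\<in>J. c (f j) *s f j) = 0" using c by (simp add: sum.reindex[OF inj])
    then show "c x = 0" using assms(2)[of "\<lambda>j. c (f j)"] x by auto
  qed (use assms in simp)
  then show ?thesis using vec.dim_eq_card_independent card_image[OF inj] by metis
qed

locale toric =
  fixes n :: nat and a :: "'i::finite \<Rightarrow> nat \<Rightarrow> int" and X :: "('a::field_char_0 ^ 'i) set"
  assumes conf: "lattice_configuration n a" and X_eq: "X = toric_variety n a"
begin

abbreviation A :: "'i \<Rightarrow> nat \<Rightarrow> int" where "A \<equiv> homogenised a"

definition S :: "('a ^ 'i) set" where "S = orbit n a {\<chi> i. 1}"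

lemma X_closure: "X = zariski closure_of S"
  using closure_orbit[where p = "\<chi> i. 1" and n = n and c = a] by (simp add: S_def X_eq toric_variety_def)

sublocale rational_cone S X
proof
  show "cone S" "rationally_connected S" unfolding S_def by (rule orbit_cone orbit_connected_singleton)+
  show "0 \<notin> S" unfolding S_def by (rule orbit_nonzero) (simp add: vec_eq_iff)
  have "(\<chi> i. (\<chi> i. 1) $ i * (\<Prod>j\<le>n. 1 powi homogenised a i j)) \<in> S"
    unfolding S_def by (rule orbitI) simp_all
  then show "S \<noteq> {}" by auto
qed (rule X_closure)

lemma S_E:
  assumes "s \<in> S"
  obtains t where "\<forall>j\<le>n. t j \<noteq> 0" "s = (\<chi> i. \<Prod>j\<le>n. t j powi A i j)"
  using assms unfolding S_def by (auto elim!: orbitE)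

lemma S_I: "(\<And>j. j \<le> n \<Longrightarrow> t j \<noteq> 0) \<Longrightarrow> (\<chi> i. \<Prod>j\<le>n. t j powi A i j) \<in> S"
  using orbitI[of "\<chi> i. 1" "{\<chi> i. 1}" n t a] unfolding S_def by simp

lemma S_component_nonzero: "s \<in> S \<Longrightarrow> s $ i \<noteq> 0"
  by (elim S_E) (simp add: prod_zero_iff)

text \<open>The lattice hypothesis applied to the unit vectors. The monomial with exponents
  \<open>d j\<close> reads off the parameter \<open>t j\<close> from a point of the orbit.\<close>

lemma ex_dual_lattice_basis:
  obtains d :: "nat \<Rightarrow> 'i \<Rightarrow> int" where "\<forall>j\<le>n. \<forall>l\<le>n. (\<Sum>i\<in>UNIV. d j i * A i l) = (if j = l then 1 else 0)"
proof -
  have "\<exists>c::'i \<Rightarrow> int. \<forall>l\<le>n. (if j = l then 1 else 0) = (\<Sum>i\<in>UNIV. c i * A i l)" for j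
    using conf[unfolded lattice_configuration_def, THEN conjunct2, THEN spec, of "\<lambda>l. if j = l then 1 else 0"] .
  then obtain d :: "nat \<Rightarrow> 'i \<Rightarrow> int" where "\<And>j. \<forall>l\<le>n. (if j = l then 1 else 0) = (\<Sum>i\<in>UNIV. d j i * A i l)" by metis
  then show ?thesis by (intro that[of d]) metis
qed

text \<open>Integral affine relations of the configuration, the exponents of binomials vanishing on
  \<open>X\<close>.\<close>

definition relation :: "('i \<Rightarrow> int) \<Rightarrow> bool" where
  "relation z \<longleftrightarrow> (\<forall>j\<le>n. (\<Sum>i\<in>UNIV. z i * A i j) = 0)"

lemma binomial_form_vanishes:
  assumes "relation z" "x \<in> X"
  shows "binomial_form z x = 0"
proof (rule vanish[OF polyfun_binomial_form _ assms(2)])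
  fix s assume s: "s \<in> S"
  then obtain t where t: "\<forall>j\<le>n. t j \<noteq> 0" "s = (\<chi> i. \<Prod>j\<le>n. t j powi A i j)" by (rule S_E)
  have "(\<Prod>i\<in>UNIV. s $ i powi z i) = 1"
    using orbit_monomial[OF t(1), of a z] assms(1) by (simp add: t(2) relation_def)
  then show "binomial_form z s = 0" using binomial_form_eq_0_iff S_component_nonzero[OF s] by blast
qed

text \<open>\<open>A i\<close> is expanded in unit vectors, and \<open>d\<close> writes each of
  these as an integral combination of the configuration.\<close>

lemma relation_dual_basis:
  assumes d: "\<forall>j\<le>n. \<forall>l\<le>n. (\<Sum>i\<in>UNIV. d j i * A i l) = (if j = l then 1 else 0)"
  shows "relation (\<lambda>l. (\<Sum>j\<le>n. d j l * A i j) - (if l = i then 1 else 0))"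
  unfolding relation_def
proof (intro allI impI)
  fix m assume m: "m \<le> n"
  have "(\<Sum>l\<in>UNIV. (\<Sum>j\<le>n. d j l * A i j) * A l m) = (\<Sum>j\<le>n. A i j * (\<Sum>l\<in>UNIV. d j l * A l m))"
    unfolding sum_distrib_right sum_distrib_left by (subst sum.swap) (simp add: ac_simps)
  also have "\<dots> = (\<Sum>j\<le>n. if j = m then A i m else 0)"
    using d m by (intro sum.cong) auto
  also have "\<dots> = A i m" using m by simp
  finally have 1: "(\<Sum>l\<in>UNIV. (\<Sum>j\<le>n. d j l * A i j) * A l m) = A i m" .
  have "(\<Sum>l\<in>UNIV. (if l = i then 1 else 0) * A l m) = (\<Sum>l\<in>UNIV. if l = i then A i m else 0)"
    by (rule sum.cong) auto
  then have "(\<Sum>l\<in>UNIV. (if l = i then 1 else 0) * A l m) = A i m" by simp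
  then show "(\<Sum>l\<in>UNIV. ((\<Sum>j\<le>n. d j l * A i j) - (if l = i then 1 else 0)) * A l m) = 0"
    using 1 by (simp add: left_diff_distrib sum_subtractf)
qed

text \<open>Integrality of the dual basis is decisive: its monomials produce torus parameters for
  \<open>x\<close> without extracting roots, and the relations of \<open>relation_dual_basis\<close>
  confirm every coordinate.\<close>

lemma S_iff: "x \<in> S \<longleftrightarrow> x \<in> X \<and> (\<forall>i. x $ i \<noteq> 0)"
proof (intro iffI conjI allI)
  assume x: "x \<in> X \<and> (\<forall>i. x $ i \<noteq> 0)"
  obtain d :: "nat \<Rightarrow> 'i \<Rightarrow> int" where d: "\<forall>j\<le>n. \<forall>l\<le>n. (\<Sum>i\<in>UNIV. d j i * A i l) = (if j = l then 1 else 0)"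
    by (rule ex_dual_lattice_basis)
  define t where "t j = (\<Prod>l\<in>UNIV. x $ l powi d j l)" for j
  have "(\<Prod>j\<le>n. t j powi A i j) = x $ i" for i
  proof -
    let ?z = "\<lambda>l. (\<Sum>j\<le>n. d j l * A i j) - (if l = i then 1 else 0)"
    have "(\<Prod>l\<in>UNIV. x $ l powi ?z l) = 1"
      using binomial_form_vanishes[OF relation_dual_basis[OF d, of i]] binomial_form_eq_0_iff[of x ?z] x by blast
    then have "(\<Prod>l\<in>UNIV. x $ l powi ?z l) * (\<Prod>l\<in>UNIV. x $ l powi (if l = i then 1 else 0)) = x $ i"
    proof -
      have "(\<Prod>l\<in>UNIV. x $ l powi (if l = i then 1 else 0)) = (\<Prod>l\<in>UNIV. if l = i then x $ i else 1)"
        by (rule prod.cong) auto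
      then show ?thesis using \<open>(\<Prod>l\<in>UNIV. x $ l powi ?z l) = 1\<close> by simp
    qed
    moreover have "x $ l powi ?z l * x $ l powi (if l = i then 1 else 0) = (\<Prod>j\<le>n. x $ l powi (d j l * A i j))" for l
      using x by (simp add: power_int_add[symmetric] powi_sum del: power_int_add)
    ultimately have "(\<Prod>l\<in>UNIV. \<Prod>j\<le>n. x $ l powi (d j l * A i j)) = x $ i"
      by (simp add: prod.distrib[symmetric])
    then show ?thesis
      by (subst (asm) prod.swap) (simp add: t_def prod_powi power_int_mult)
  qed
  then have "x = (\<chi> i. \<Prod>j\<le>n. t j powi A i j)" by (simp add: vec_eq_iff)
  also have "\<dots> \<in> S" using x by (intro S_I) (auto simp: t_def prod_zero_iff)
  finally show "x \<in> S" .
qed (use S_subset S_component_nonzero in auto)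

lemma openin_S: "openin (subtopology zariski X) S"
proof -
  have "form (\<Sum>i\<in>(UNIV::'i set). 1) (\<lambda>v::'a^'i. \<Prod>i\<in>UNIV. v $ i ^ 1)" by (rule form_monomial)
  then have "openin zariski {v::'a^'i. v \<noteq> 0 \<and> (\<Prod>i\<in>UNIV. v $ i ^ 1) \<noteq> 0}" by (rule openin_zariski_basic)
  moreover have "S = {v. v \<noteq> 0 \<and> (\<Prod>i\<in>UNIV. v $ i ^ 1) \<noteq> 0} \<inter> X"
    using S_iff cone_X(2) by (auto simp: prod_zero_iff)
  ultimately show ?thesis unfolding openin_subtopology by blast
qed

text \<open>The infinitesimal action of the parameter \<open>t j\<close>; for \<open>j = 0\<close>
  it is the radial Euler field.\<close>

definition E :: "nat \<Rightarrow> 'i \<Rightarrow> 'a ^ 'i \<Rightarrow> 'a" where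
  "E j i v = of_int (A i j) * v $ i"

lemma S_scale:
  assumes s: "s \<in> S" and r: "r \<noteq> 0" and j: "j \<le> n"
  shows "(\<chi> i. s $ i * r powi A i j) \<in> S"
proof -
  obtain t where t: "\<forall>j\<le>n. t j \<noteq> 0" "s = (\<chi> i. \<Prod>j\<le>n. t j powi A i j)" using s by (rule S_E)
  have "(\<Prod>l\<le>n. (t(j := t j * r)) l powi A i l) = (\<Prod>l\<le>n. t l powi A i l) * r powi A i j" for i
  proof -
    have "(\<Prod>l\<le>n. (t(j := t j * r)) l powi A i l) = (\<Prod>l\<le>n. t l powi A i l * (if l = j then r powi A i j else 1))"
      by (rule prod.cong) (auto simp: power_int_mult_distrib)
    then show ?thesis using j by (simp add: prod.distrib)
  qed
  then have "(\<chi> i. s $ i * r powi A i j) = (\<chi> i. \<Prod>l\<le>n. (t(j := t j * r)) l powi A i l)"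
    unfolding t(2) by (simp add: vec_eq_iff)
  also have "\<dots> \<in> S" using t(1) r by (intro S_I) auto
  finally show ?thesis .
qed

text \<open>At a point of the orbit the field is the velocity of the curve on which parameter
  \<open>j\<close> is multiplied by \<open>1 + r\<close>; density extends tangency to
  \<open>X\<close>.\<close>

lemma tangent_E:
  assumes "j \<le> n"
  shows "tangent_field X (E j)"
  unfolding tangent_field_def
proof (intro conjI allI impI ballI)
  show pE: "polyfun (E j i)" for i unfolding E_def[abs_def] by (intro polyfun_intros)
  fix f v assume f: "polyfun f" "\<forall>v\<in>X. f v = 0" and v: "v \<in> X"
  show "vf (E j) f v = 0"
  proof (rule vanish[OF polyfun_vf[OF pE f(1)] _ v])
    fix s assume s: "s \<in> S"
    obtain B :: nat where B: "\<forall>i. \<forall>j\<le>n. \<bar>A i j\<bar> \<le> int B" by (rule exponent_bound)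
    let ?e = "\<lambda>i. nat (A i j + int B)"
    \<comment> \<open>The additional factor \<open>(1 + r) ^ B\<close> makes all exponents
      nonnegative and keeps the curve in the cone.\<close>
    let ?\<gamma> = "\<lambda>i. [:s $ i:] * [:1, 1:] ^ ?e i"
    have "curve ?\<gamma> r \<in> X" if "r \<noteq> -1" for r
    proof -
      have r: "1 + r \<noteq> 0" using that by (simp add: add_eq_0_iff)
      have "curve ?\<gamma> r = (1 + r) ^ B *s (\<chi> i. s $ i * (1 + r) powi A i j)"
        using powi_shift[OF r B[rule_format, OF assms]]
        by (simp add: curve_def vec_eq_iff) (simp add: mult.commute mult.left_commute)
      moreover have "(\<chi> i. s $ i * (1 + r) powi A i j) \<in> S" by (rule S_scale[OF s r assms])
      then have "(1 + r) ^ B *s (\<chi> i. s $ i * (1 + r) powi A i j) \<in> S"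
        using cone r unfolding cone_def by simp
      ultimately show ?thesis using S_subset by auto
    qed
    then have "{r. curve ?\<gamma> r \<notin> X} \<subseteq> {-1}" by blast
    then have "finite {r. curve ?\<gamma> r \<notin> X}" by (rule finite_subset) simp
    then have 1: "(\<Sum>i\<in>UNIV. pd i f (curve ?\<gamma> 0) * poly (pderiv (?\<gamma> i)) 0) = 0"
      using f by (intro curve_tangent) auto
    have 2: "curve ?\<gamma> 0 = s" by (simp add: curve_def vec_eq_iff)
    have 3: "poly (pderiv (?\<gamma> i)) 0 = of_nat (?e i) * s $ i" for i
      by (simp add: pderiv_smult pderiv_power pderiv_pCons)
    have "(of_nat (?e i) :: 'a) = of_int (A i j) + of_nat B" for i
    proof -
      have "int (?e i) = A i j + int B" using B[rule_format, OF assms, of i] by simp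
      then show ?thesis by (metis of_int_add of_int_of_nat_eq)
    qed
    then have "(\<Sum>i\<in>UNIV. pd i f s * ((of_int (A i j) + of_nat B) * s $ i)) = 0"
      using 1 unfolding 2 3 by simp
    \<comment> \<open>The additional factor contributed \<open>B\<close> times the radial direction,
      which the gradient of an equation annihilates.\<close>
    moreover have "pairing s (grad f s) = 0"
      using conormal_cone[OF cone_X(1), of s] s S_subset f unfolding conormal_def perp_def by blast
    then have "(\<Sum>i\<in>UNIV. pd i f s * (of_nat B * s $ i)) = 0"
      by (simp add: pairing_def grad_def mult.commute mult.left_commute sum_distrib_left[symmetric])
    ultimately show "vf (E j) f s = 0"
      by (simp add: vf_def E_def algebra_simps sum.distrib)
  qed
qed

text \<open>The gradients of the binomials impose on the quotients \<open>y $ i / s $ i\<close>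
  every integral relation of the configuration. The dual basis then supplies the coefficients
  \<open>\<tau> j\<close> of \<open>y\<close> in the Euler fields.\<close>

lemma perp_conormal:
  assumes s: "s \<in> S"
  shows "perp (conormal X s) \<subseteq> vec.span ((\<lambda>j. \<chi> i. E j i s) ` {..n})"
proof
  fix y assume y: "y \<in> perp (conormal X s)"
  note nz = S_component_nonzero[OF s]
  obtain d :: "nat \<Rightarrow> 'i \<Rightarrow> int" where d: "\<forall>j\<le>n. \<forall>l\<le>n. (\<Sum>i\<in>UNIV. d j i * A i l) = (if j = l then 1 else 0)"
    by (rule ex_dual_lattice_basis)
  have rel: "(\<Sum>i\<in>UNIV. of_int (z i) * (y $ i / s $ i)) = 0" if z: "relation z" for z
  proof -
    let ?P = "\<lambda>i (v::'a^'i). y $ i"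
    let ?M = "\<Prod>i\<in>UNIV. s $ i ^ nat (z i)" and ?M' = "\<Prod>i\<in>UNIV. s $ i ^ nat (- z i)"
    have "grad (binomial_form z) s \<in> conormal X s"
      unfolding conormal_def using polyfun_binomial_form binomial_form_vanishes[OF z] by blast
    then have "pairing (grad (binomial_form z) s) y = 0" using y by (simp add: perp_def)
    then have "vf ?P (binomial_form z) s = 0" unfolding vf_eq_grad by simp
    then have "(\<Sum>i\<in>UNIV. of_nat (nat (z i)) * y $ i / s $ i) * ?M - (\<Sum>i\<in>UNIV. of_nat (nat (- z i)) * y $ i / s $ i) * ?M' = 0"
      unfolding binomial_form_def[abs_def]
      by (subst (asm) vf_diff) (auto simp: vf_monomial[OF nz] intro!: polyfun_intros)
    moreover have "?M = ?M'" using binomial_form_vanishes[OF z, of s] s S_subset by (auto simp: binomial_form_def)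
    moreover have "?M \<noteq> 0" using nz by (simp add: prod_zero_iff)
    ultimately have "(\<Sum>i\<in>UNIV. of_nat (nat (z i)) * y $ i / s $ i) = (\<Sum>i\<in>UNIV. of_nat (nat (- z i)) * y $ i / s $ i)"
      using nz by simp
    moreover have "of_int (z i) * (y $ i / s $ i) = of_nat (nat (z i)) * y $ i / s $ i - of_nat (nat (- z i)) * y $ i / s $ i" for i
    proof -
      have "z i = int (nat (z i)) - int (nat (- z i))" by simp
      then have "(of_int (z i) :: 'a) = of_nat (nat (z i)) - of_nat (nat (- z i))"
        by (metis of_int_diff of_int_of_nat_eq)
      then show ?thesis by (simp add: left_diff_distrib diff_divide_distrib)
    qed
    ultimately show ?thesis by (simp add: sum_subtractf)
  qed
  define \<tau> where "\<tau> j = (\<Sum>l\<in>UNIV. of_int (d j l) * (y $ l / s $ l))" for j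
  have "y $ i = (\<Sum>j\<le>n. \<tau> j * (of_int (A i j) * s $ i))" for i
  proof -
    have "(\<Sum>l\<in>UNIV. of_int ((\<Sum>j\<le>n. d j l * A i j) - (if l = i then 1 else 0)) * (y $ l / s $ l)) = 0"
      by (rule rel[OF relation_dual_basis[OF d]])
    moreover have "(\<Sum>l\<in>UNIV. of_int ((\<Sum>j\<le>n. d j l * A i j) - (if l = i then 1 else 0)) * (y $ l / s $ l))
      = (\<Sum>l\<in>UNIV. (\<Sum>j\<le>n. of_int (d j l) * of_int (A i j)) * (y $ l / s $ l)) - (\<Sum>l\<in>UNIV. if l = i then y $ i / s $ i else 0)"
      unfolding sum_subtractf[symmetric] by (rule sum.cong) (auto simp: left_diff_distrib diff_divide_distrib)
    moreover have "(\<Sum>l\<in>UNIV. (\<Sum>j\<le>n. of_int (d j l) * of_int (A i j)) * (y $ l / s $ l)) = (\<Sum>j\<le>n. \<tau> j * of_int (A i j))"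
      unfolding \<tau>_def sum_distrib_right by (subst sum.swap) (simp add: ac_simps)
    ultimately have "y $ i / s $ i = (\<Sum>j\<le>n. \<tau> j * of_int (A i j))" by simp
    then have "y $ i = (\<Sum>j\<le>n. \<tau> j * of_int (A i j)) * s $ i" using nz[of i] by (simp add: field_simps)
    then show ?thesis by (simp add: sum_distrib_right mult.assoc)
  qed
  then have "y = (\<Sum>j\<le>n. \<tau> j *s (\<chi> i. E j i s))" by (simp add: vec_eq_iff E_def)
  also have "\<dots> \<in> vec.span ((\<lambda>j. \<chi> i. E j i s) ` {..n})"
    by (intro vec.span_sum vec.span_scale vec.span_base) auto
  finally show "y \<in> vec.span ((\<lambda>j. \<chi> i. E j i s) ` {..n})" .
qed

text \<open>The \<open>n + 1\<close> Euler fields span the tangent space of the cone, and they are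
  independent because the dual basis inverts their coefficient matrix.\<close>

lemma dim_conormal:
  assumes s: "s \<in> S"
  shows "vec.dim (conormal X s) + n + 1 = CARD('i)"
proof -
  let ?f = "\<lambda>j. \<chi> i. E j i s"
  obtain d :: "nat \<Rightarrow> 'i \<Rightarrow> int" where d: "\<forall>j\<le>n. \<forall>l\<le>n. (\<Sum>i\<in>UNIV. d j i * A i l) = (if j = l then 1 else 0)"
    by (rule ex_dual_lattice_basis)
  have "vec.dim (?f ` {..n}) = card {..n}"
  proof (rule independent_family)
    fix c assume c: "(\<Sum>j\<le>n. c j *s ?f j) = 0"
    have z: "(\<Sum>j\<le>n. c j * of_int (A i j)) = 0" for i
    proof -
      have "(\<Sum>j\<le>n. c j *s ?f j) $ i = (\<Sum>j\<le>n. c j * of_int (A i j)) * s $ i"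
        by (simp add: E_def sum_distrib_right mult.assoc)
      then show ?thesis using c S_component_nonzero[OF s, of i] by simp
    qed
    show "\<forall>j\<in>{..n}. c j = 0"
    proof
      fix l assume l: "l \<in> {..n}"
      have "(\<Sum>i\<in>UNIV. of_int (d l i) * (\<Sum>j\<le>n. c j * of_int (A i j))) = (\<Sum>j\<le>n. c j * of_int (\<Sum>i\<in>UNIV. d l i * A i j))"
        by (simp add: sum_distrib_left, subst sum.swap) (simp add: ac_simps)
      also have "\<dots> = (\<Sum>j\<le>n. if j = l then c l else 0)"
        using d l by (intro sum.cong) auto
      finally show "c l = 0" using z l by simp
    qed
  qed simp
  moreover have "vec.span (?f ` {..n}) = perp (conormal X s)"
  proof
    have "?f j \<in> perp (conormal X s)" if "j \<le> n" for j
    proof -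
      have "pairing g (?f j) = 0" if g: "g \<in> conormal X s" for g
      proof -
        obtain h where h: "g = grad h s" "polyfun h" "\<forall>v\<in>X. h v = 0" using g unfolding conormal_def by auto
        have "vf (E j) h s = 0" by (rule tangent_fieldD(2)[OF tangent_E[OF \<open>j \<le> n\<close>] h(2)]) (use h(3) s S_subset in auto)
        then show ?thesis unfolding h(1) vf_eq_grad .
      qed
      then show ?thesis by (simp add: perp_def)
    qed
    then show "vec.span (?f ` {..n}) \<subseteq> perp (conormal X s)"
      by (intro vec.span_minimal subspace_perp) auto
  qed (rule perp_conormal[OF s])
  then have "vec.dim (perp (conormal X s)) = vec.dim (?f ` {..n})" by (metis vec.dim_span)
  ultimately show ?thesis using dim_perp[of "conormal X s"] by simp
qed

end


lemma homogenised_0: "homogenised c i 0 = 1"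
  by (simp add: homogenised_def)

lemma homogenised_Suc: "homogenised c i (Suc j) = c i j"
  by (simp add: homogenised_def)

section \<open>Dimension of the toric variety\<close>

context toric
begin

text \<open>On the orbit a monomial of degree \<open>d\<close> becomes \<open>t 0 ^ d\<close> times
  a monomial in the other parameters with exponents at most \<open>2 * B * d\<close>. More forms
  than such monomials are linearly dependent on \<open>X\<close>.\<close>

lemma hilbert_bound:
  obtains M where "\<forall>d r. hilbert_ge X d r \<longrightarrow> r \<le> (M * d + 1) ^ n"
proof -
  obtain B :: nat where B: "\<forall>i. \<forall>j\<le>n. \<bar>A i j\<bar> \<le> int B" by (rule exponent_bound)
  define e where "e i j = nat (a i j + int B)" for i j
  have e: "e i j \<le> 2 * B" if "j < n" for i j
    using B[rule_format, of "Suc j" i] that by (simp add: e_def homogenised_def)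
  have "r \<le> (2 * B * d + 1) ^ n" if H: "hilbert_ge X d r" for d r
  proof (rule ccontr)
    assume r: "\<not> r \<le> (2 * B * d + 1) ^ n"
    obtain f where f: "\<forall>q<r. form d (f q)" "\<forall>c. (\<forall>v\<in>X. (\<Sum>q<r. c q * f q v) = 0) \<longrightarrow> (\<forall>q<r. c q = 0)"
      using H unfolding hilbert_ge_def by auto
    have "\<forall>q\<in>{..<r}. \<exists>C. f q = (\<lambda>v. \<Sum>\<alpha> | (\<Sum>i\<in>UNIV. \<alpha> i) = d. C \<alpha> * (\<Prod>i\<in>UNIV. v $ i ^ \<alpha> i))"
      using f(1) unfolding form_def by auto
    from bchoice[OF this] obtain C where
      C: "\<And>q. q < r \<Longrightarrow> f q = (\<lambda>v. \<Sum>\<alpha> | (\<Sum>i\<in>UNIV. \<alpha> i) = d. C q \<alpha> * (\<Prod>i\<in>UNIV. v $ i ^ \<alpha> i))" by auto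
    let ?D = "{\<alpha>::'i \<Rightarrow> nat. (\<Sum>i\<in>UNIV. \<alpha> i) = d}"
    let ?box = "{..<n} \<rightarrow>\<^sub>E {..2 * B * d}"
    define \<beta> where "\<beta> \<alpha> = restrict (\<lambda>j. \<Sum>i\<in>UNIV. e i j * \<alpha> i) {..<n}" for \<alpha> :: "'i \<Rightarrow> nat"
    have box: "\<beta> \<alpha> \<in> ?box" if "\<alpha> \<in> ?D" for \<alpha>
    proof -
      have "(\<Sum>i\<in>UNIV. e i j * \<alpha> i) \<le> 2 * B * d" if "j < n" for j
      proof -
        have "(\<Sum>i\<in>UNIV. e i j * \<alpha> i) \<le> (\<Sum>i\<in>UNIV. 2 * B * \<alpha> i)"
          using e[OF that] by (intro sum_mono mult_right_mono) auto
        then show ?thesis using \<open>\<alpha> \<in> ?D\<close> by (simp add: sum_distrib_left[symmetric])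
      qed
      then show ?thesis by (auto simp: \<beta>_def)
    qed
    have fin: "finite ?box" by (intro finite_PiE) auto
    have card: "card ?box = (2 * B * d + 1) ^ n" by (simp add: card_PiE)
    \<comment> \<open>The coefficient of form \<open>q\<close> at the parameter monomial
      \<open>b\<close>, collected over all monomials that restrict to it.\<close>
    define K where "K q b = (\<Sum>\<alpha> | \<alpha> \<in> ?D \<and> \<beta> \<alpha> = b. C q \<alpha>)" for q b
    obtain c where c: "\<exists>q\<in>{..<r}. c q \<noteq> 0" "\<forall>b\<in>?box. (\<Sum>q<r. c q * K q b) = 0"
      using underdetermined_system[OF fin, of "{..<r}" K] r card by auto
    have "(\<Sum>q<r. c q * f q v) = 0" if "v \<in> X" for v
    proof (rule vanish[OF _ _ that])
      show "polyfun (\<lambda>v. \<Sum>q<r. c q * f q v)"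
        using f(1) by (intro polyfun_sum polyfun_mult polyfun_const form_polyfun[of d]) auto
      fix s assume "s \<in> S"
      then obtain t where t: "s = (\<chi> i. t 0 * (\<Prod>j<n. t (Suc j) ^ e i j))"
        unfolding S_def orbit_eq_nat[OF B] e_def by auto
      define T where "T b = t 0 ^ d * (\<Prod>j<n. t (Suc j) ^ b j)" for b
      have mono: "(\<Prod>i\<in>UNIV. s $ i ^ \<alpha> i) = T (\<beta> \<alpha>)" if "\<alpha> \<in> ?D" for \<alpha>
      proof -
        have "(\<Prod>i\<in>UNIV. s $ i ^ \<alpha> i) = (\<Prod>i\<in>UNIV. t 0 ^ \<alpha> i) * (\<Prod>i\<in>UNIV. \<Prod>j<n. t (Suc j) ^ (e i j * \<alpha> i))"
          by (simp add: t power_mult_distrib prod.distrib prod_power_distrib power_mult)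
        also have "(\<Prod>i\<in>UNIV. t 0 ^ \<alpha> i) = t 0 ^ d" using that by (simp add: power_sum[symmetric])
        also have "(\<Prod>i\<in>UNIV. \<Prod>j<n. t (Suc j) ^ (e i j * \<alpha> i)) = (\<Prod>j<n. t (Suc j) ^ (\<Sum>i\<in>UNIV. e i j * \<alpha> i))"
          by (subst prod.swap) (simp add: power_sum)
        finally show ?thesis by (simp add: T_def \<beta>_def)
      qed
      have fq: "f q s = (\<Sum>b\<in>?box. K q b * T b)" if "q < r" for q
      proof -
        have "f q s = (\<Sum>\<alpha>\<in>?D. C q \<alpha> * T (\<beta> \<alpha>))" unfolding C[OF that] by (rule sum.cong) (simp_all add: mono)
        also have "\<dots> = (\<Sum>b\<in>?box. \<Sum>\<alpha> | \<alpha> \<in> ?D \<and> \<beta> \<alpha> = b. C q \<alpha> * T (\<beta> \<alpha>))"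
          using box by (intro sum.group[symmetric] finite_exponents fin) auto
        also have "\<dots> = (\<Sum>b\<in>?box. K q b * T b)" by (simp add: K_def sum_distrib_right)
        finally show ?thesis .
      qed
      have "(\<Sum>q<r. c q * f q s) = (\<Sum>q<r. \<Sum>b\<in>?box. c q * K q b * T b)"
        by (simp add: fq sum_distrib_left mult.assoc)
      also have "\<dots> = (\<Sum>b\<in>?box. (\<Sum>q<r. c q * K q b) * T b)"
        by (subst sum.swap) (simp add: sum_distrib_right)
      also have "\<dots> = 0" using c(2) by simp
      finally show "(\<Sum>q<r. c q * f q s) = 0" .
    qed
    then have "\<forall>q<r. c q = 0" using f(2) by blast
    then show False using c(1) by auto
  qed
  then show ?thesis by (intro that[of "2 * B"]) blast
qed

text \<open>The monomial dual to parameter \<open>l\<close> takes the value of that parameter, and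
  the value 1 on a subtorus where it does not occur.\<close>

lemma binomial_form_suborbit:
  assumes s: "s \<in> orbit q a {\<chi> i. 1}" and t: "\<forall>j\<le>q. t j \<noteq> 0" "s = (\<chi> i. \<Prod>j\<le>q. t j powi A i j)"
    and z: "\<And>j. j \<le> q \<Longrightarrow> (\<Sum>i\<in>UNIV. z i * A i j) = (if j = l then 1 else 0)"
  shows "binomial_form z s = 0 \<longleftrightarrow> (if l \<le> q then t l else 1) = 1"
proof -
  have "s $ i \<noteq> 0" for i using t by (simp add: prod_zero_iff)
  then have "binomial_form z s = 0 \<longleftrightarrow> (\<Prod>i\<in>UNIV. s $ i powi z i) = 1" by (rule binomial_form_eq_0_iff)
  also have "(\<Prod>i\<in>UNIV. s $ i powi z i) = (\<Prod>j\<le>q. t j powi (if j = l then 1 else 0))"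
    using orbit_monomial[OF t(1), of a z] z by (simp add: t(2))
  also have "\<dots> = (\<Prod>j\<le>q. if j = l then t l else 1)" by (rule prod.cong) auto
  finally show ?thesis by simp
qed

text \<open>In the subtori only the parameters up to \<open>q\<close> vary. The binomial dual to
  parameter \<open>Suc q\<close> vanishes on one subtorus and not on the next.\<close>

lemma chain_X: "irreducible_chain X n (\<lambda>q. zariski closure_of (orbit q a {\<chi> i. 1}))"
  unfolding irreducible_chain_def
proof (intro conjI allI impI)
  have step: "orbit q a {\<chi> i. (1::'a)} \<subseteq> orbit (Suc q) a {\<chi> i. 1}" for q
  proof
    fix x :: "'a ^ 'i" assume "x \<in> orbit q a {\<chi> i. 1}"
    then obtain t where t: "\<forall>j\<le>q. t j \<noteq> 0" "x = (\<chi> i. \<Prod>j\<le>q. t j powi A i j)" by (auto elim!: orbitE)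
    have "x = (\<chi> i. (\<chi> i. 1) $ i * (\<Prod>j\<le>Suc q. (t(Suc q := 1)) j powi A i j))"
      unfolding t(2) by (auto simp: vec_eq_iff intro!: prod.cong)
    also have "\<dots> \<in> orbit (Suc q) a {\<chi> i. 1}" using t(1) by (intro orbitI) (auto simp: le_Suc_eq)
    finally show "x \<in> orbit (Suc q) a {\<chi> i. 1}" .
  qed
  fix q
  assume q: "q < n"
  obtain d :: "nat \<Rightarrow> 'i \<Rightarrow> int" where d: "\<forall>j\<le>n. \<forall>l\<le>n. (\<Sum>i\<in>UNIV. d j i * A i l) = (if j = l then 1 else 0)"
    by (rule ex_dual_lattice_basis)
  let ?z = "d (Suc q)"
  have z: "(\<Sum>i\<in>UNIV. ?z i * A i j) = (if j = Suc q then 1 else 0)" if "j \<le> Suc q" for j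
    using d q that by auto
  have "(\<Sum>i\<in>UNIV. ?z i) = 0" using z[of 0] by (simp add: homogenised_def)
  then have form: "form (\<Sum>i\<in>UNIV. nat (?z i)) (binomial_form ?z :: 'a ^ 'i \<Rightarrow> 'a)" by (rule form_binomial_form)
  have 0: "binomial_form ?z s = 0" if so: "s \<in> orbit q a {\<chi> i. (1::'a)}" for s
  proof -
    obtain t where t: "\<forall>j\<le>q. t j \<noteq> 0" "s = (\<chi> i. \<Prod>j\<le>q. t j powi A i j)" using so by (auto elim!: orbitE)
    show ?thesis using binomial_form_suborbit[OF so t, of ?z "Suc q"] z by simp
  qed
  \<comment> \<open>The separating parameter must differ from 0 and 1; the value 2 does so in
    characteristic zero.\<close>
  define t :: "nat \<Rightarrow> 'a" where "t = (\<lambda>j. 1)(Suc q := 2)"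
  define s where "s = (\<chi> i. \<Prod>j\<le>Suc q. t j powi A i j)"
  have t: "\<forall>j\<le>Suc q. t j \<noteq> 0" by (simp add: t_def)
  have "s = (\<chi> i. (\<chi> i. 1) $ i * (\<Prod>j\<le>Suc q. t j powi A i j))" by (simp add: s_def vec_eq_iff)
  also have "\<dots> \<in> orbit (Suc q) a {\<chi> i. 1}" using t by (intro orbitI) auto
  finally have sO: "s \<in> orbit (Suc q) a {\<chi> i. 1}" .
  have "binomial_form ?z s \<noteq> 0"
    using binomial_form_suborbit[OF sO t s_def, of ?z "Suc q"] z by (simp add: t_def)
  then have "s \<notin> zariski closure_of (orbit q a {\<chi> i. 1})"
    using polyfun_vanishing_closure[OF polyfun_binomial_form orbit_cone 0] by blast
  moreover have "0 \<notin> orbit (Suc q) a {\<chi> i. (1::'a)}" by (rule orbit_nonzero) (simp add: vec_eq_iff)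
  then have "s \<in> zariski closure_of (orbit (Suc q) a {\<chi> i. 1})"
    using sO closure_of_subset[of "orbit (Suc q) a {\<chi> i. 1}" zariski] by (auto simp: topspace_zariski)
  ultimately show "zariski closure_of (orbit q a {\<chi> i. 1}) \<subset> zariski closure_of (orbit (Suc q) a {\<chi> i. (1::'a)})"
    using closure_of_mono[OF step[of q], of zariski] by blast
next
  fix q assume q: "q \<le> n"
  have "orbit q a {\<chi> i. (1::'a)} \<subseteq> S"
  proof
    fix x :: "'a ^ 'i" assume "x \<in> orbit q a {\<chi> i. 1}"
    then obtain t where t: "\<forall>j\<le>q. t j \<noteq> 0" "x = (\<chi> i. \<Prod>j\<le>q. t j powi A i j)" by (auto elim!: orbitE)
    have "(\<Prod>j\<le>n. (if j \<le> q then t j else 1) powi A i j) = (\<Prod>j\<le>q. t j powi A i j)" for i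
      using q by (intro prod.mono_neutral_cong_right) auto
    then have "x = (\<chi> i. \<Prod>j\<le>n. (if j \<le> q then t j else 1) powi A i j)" by (simp add: t(2))
    also have "\<dots> \<in> S" using t(1) by (intro S_I) auto
    finally show "x \<in> S" .
  qed
  then have "zariski closure_of (orbit q a {\<chi> i. (1::'a)}) \<subseteq> X" unfolding X_closure by (rule closure_of_mono)
  then show "closedin (subtopology zariski X) (zariski closure_of (orbit q a {\<chi> i. 1}))"
    using closedin_closed_subtopology[OF closedin_X] by simp
  show "zariski_irreducible (zariski closure_of (orbit q a {\<chi> i. (1::'a)}))"
  proof (rule irreducible_closure[OF orbit_connected_singleton])
    show "0 \<notin> orbit q a {\<chi> i. (1::'a)}" by (rule orbit_nonzero) (simp add: vec_eq_iff)
    have "(\<chi> i. (\<chi> i. 1) $ i * (\<Prod>j\<le>q. 1 powi homogenised a i j)) \<in> orbit q a {\<chi> i. (1::'a)}"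
      by (rule orbitI) simp_all
    then show "orbit q a {\<chi> i. (1::'a)} \<noteq> {}" by auto
  qed
qed

lemma dim_X: "zariski_dim X = ereal (real n)"
proof (rule antisym)
  obtain M where "\<forall>d r. hilbert_ge X d r \<longrightarrow> r \<le> (M * d + 1) ^ n" by (rule hilbert_bound)
  then show "zariski_dim X \<le> ereal (real n)" by (intro zariski_dim_le_hilbert[OF closedin_X]) blast
  show "ereal (real n) \<le> zariski_dim X" by (rule zariski_dim_ge[OF chain_X])
qed

section \<open>Contact hyperplanes over the torus orbit\<close>

definition power_rows :: "nat \<Rightarrow> ('i \<Rightarrow> int) set" where
  "power_rows k = {(\<lambda>i. \<Prod>j<n. a i j ^ \<beta> j) | \<beta>. (\<Sum>j<n. \<beta> j) \<le> k}"

text \<open>Iterated Euler fields produce words, whereas \<open>knap\<close> speaks of exponents.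
  The letter 0 contributes the factor 1, so words of length at most \<open>k\<close> also cover the
  products of fewer coordinates.\<close>

lemma power_rows_words:
  "power_rows k = {(\<lambda>i. prod_list (map (A i) w)) | w. w \<in> lists {..n} \<and> length w \<le> k}"
proof (intro equalityI subsetI)
  fix g assume "g \<in> power_rows k"
  then obtain \<beta> where \<beta>: "g = (\<lambda>i. \<Prod>j<n. a i j ^ \<beta> j)" "(\<Sum>j<n. \<beta> j) \<le> k" unfolding power_rows_def by auto
  have "\<exists>w\<in>lists {..n}. length w = m \<and> (\<lambda>i. \<Prod>j<n. a i j ^ \<beta> j) = (\<lambda>i. prod_list (map (A i) w))"
    if "(\<Sum>j<n. \<beta> j) = m" for m and \<beta> :: "nat \<Rightarrow> nat"
    using that
  proof (induction m arbitrary: \<beta>)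
    case 0
    then show ?case by (intro bexI[of _ "[]"]) auto
  next
    case (Suc m)
    then obtain l where l: "l < n" "\<beta> l \<noteq> 0" by (metis lessThan_iff sum.neutral nat.distinct(1))
    let ?\<beta> = "\<beta>(l := \<beta> l - 1)"
    have "(\<Sum>j<n. \<beta> j) = \<beta> l + (\<Sum>j\<in>{..<n} - {l}. \<beta> j)" using l by (intro sum.remove) auto
    moreover have "(\<Sum>j<n. ?\<beta> j) = ?\<beta> l + (\<Sum>j\<in>{..<n} - {l}. ?\<beta> j)" using l by (intro sum.remove) auto
    moreover have "(\<Sum>j\<in>{..<n} - {l}. ?\<beta> j) = (\<Sum>j\<in>{..<n} - {l}. \<beta> j)" by (rule sum.cong) auto
    ultimately have "(\<Sum>j<n. ?\<beta> j) = m" using Suc.prems l by simp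
    from Suc.IH[OF this] obtain w where w: "w \<in> lists {..n}" "length w = m"
      "(\<lambda>i. \<Prod>j<n. a i j ^ ?\<beta> j) = (\<lambda>i. prod_list (map (A i) w))" by auto
    have "(\<Prod>j<n. a i j ^ \<beta> j) = prod_list (map (A i) (Suc l # w))" for i
    proof -
      have "(\<Prod>j<n. a i j ^ \<beta> j) = a i l ^ \<beta> l * (\<Prod>j\<in>{..<n} - {l}. a i j ^ \<beta> j)" using l by (intro prod.remove) auto
      moreover have "(\<Prod>j<n. a i j ^ ?\<beta> j) = a i l ^ ?\<beta> l * (\<Prod>j\<in>{..<n} - {l}. a i j ^ ?\<beta> j)" using l by (intro prod.remove) auto
      moreover have "(\<Prod>j\<in>{..<n} - {l}. a i j ^ ?\<beta> j) = (\<Prod>j\<in>{..<n} - {l}. a i j ^ \<beta> j)" by (rule prod.cong) auto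
      moreover have "a i l ^ \<beta> l = a i l * a i l ^ (\<beta> l - 1)" using l(2) by (metis power_eq_if)
      ultimately have "(\<Prod>j<n. a i j ^ \<beta> j) = a i l * (\<Prod>j<n. a i j ^ ?\<beta> j)" by simp
      then show ?thesis using fun_cong[OF w(3), of i] by (simp add: homogenised_Suc)
    qed
    then show ?case using w(1,2) l(1) by (intro bexI[of _ "Suc l # w"]) auto
  qed
  from this[OF refl, of \<beta>] \<beta>
  show "g \<in> {(\<lambda>i. prod_list (map (A i) w)) | w. w \<in> lists {..n} \<and> length w \<le> k}" by auto
next
  fix g assume "g \<in> {(\<lambda>i. prod_list (map (A i) w)) | w. w \<in> lists {..n} \<and> length w \<le> k}"
  then obtain w where w: "g = (\<lambda>i. prod_list (map (A i) w))" "w \<in> lists {..n}" "length w \<le> k" by auto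
  have "\<exists>\<beta>. (\<Sum>j<n. \<beta> j) \<le> length w \<and> (\<lambda>i. prod_list (map (A i) w)) = (\<lambda>i. \<Prod>j<n. a i j ^ \<beta> j)"
    using w(2)
  proof (induction w)
    case Nil
    show ?case by (intro exI[of _ "\<lambda>_. 0"]) simp
  next
    case (Cons l w)
    then obtain \<beta> where \<beta>: "(\<Sum>j<n. \<beta> j) \<le> length w" "(\<lambda>i. prod_list (map (A i) w)) = (\<lambda>i. \<Prod>j<n. a i j ^ \<beta> j)" by auto
    show ?case
    proof (cases l)
      case 0
      then show ?thesis using \<beta> by (intro exI[of _ \<beta>]) (simp add: homogenised_0)
    next
      case (Suc j0)
      then have j0: "j0 < n" using Cons.hyps by simp
      let ?\<beta> = "\<lambda>j. \<beta> j + (if j = j0 then 1 else 0)"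
      have "(\<Sum>j<n. ?\<beta> j) = (\<Sum>j<n. \<beta> j) + 1" using j0 by (simp add: sum.distrib)
      moreover have "(\<Prod>j<n. a i j ^ ?\<beta> j) = (\<Prod>j<n. a i j ^ \<beta> j) * a i j0" for i
      proof -
        have "(\<Prod>j<n. a i j ^ ?\<beta> j) = (\<Prod>j<n. a i j ^ \<beta> j * (if j = j0 then a i j0 else 1))"
          by (rule prod.cong) (auto simp: power_add)
        then show ?thesis using j0 by (simp add: prod.distrib)
      qed
      ultimately show ?thesis using \<beta>(1) fun_cong[OF \<beta>(2)] Suc
        by (intro exI[of _ ?\<beta>]) (simp add: homogenised_Suc mult.commute)
    qed
  qed
  then show "g \<in> power_rows k" using w unfolding power_rows_def by fastforce
qed

definition kernel :: "nat \<Rightarrow> ('a ^ 'i) set" where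
  "kernel k = perp ((\<lambda>g. \<chi> i. of_int (g i)) ` power_rows k)"

lemma kernel_iff: "y \<in> kernel k \<longleftrightarrow> (\<forall>w\<in>lists {..n}. length w \<le> k \<longrightarrow> (\<Sum>i\<in>UNIV. of_int (prod_list (map (A i) w)) * y $ i) = 0)"
  unfolding kernel_def power_rows_words perp_def pairing_def by auto

text \<open>Coordinates are simultaneous eigenfunctions of the Euler fields; the constant
  \<open>c\<close> absorbs the eigenvalues during the induction.\<close>

lemma iter_E_coord: "iter_vf E w (\<lambda>v. c * v $ i) v = of_int (prod_list (map (A i) w)) * (c * v $ i)"
proof (induction w arbitrary: c)
  case (Cons j w)
  have "vf (E j) (\<lambda>v. c * v $ i) = (\<lambda>v. (c * of_int (A i j)) * v $ i)"
    by (simp add: vf_scale polyfun_coord vf_coord E_def mult.assoc)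
  then show ?case using Cons[of "c * of_int (A i j)"] by (simp add: ac_simps)
qed simp

text \<open>The Euler fields are a frame at \<open>s\<close>, so contact means that all words of
  length at most \<open>k\<close> vanish; their eigenvalues are the entries of the power
  rows.\<close>

lemma contact_S:
  assumes s: "s \<in> S"
  shows "contact X k s = {h. (\<chi> i. h $ i * s $ i) \<in> kernel k}"
proof -
  obtain u where "local_frame X s {..n} E u"
    using local_frame_exists[of s X "{..n}" E] s S_subset tangent_E perp_conormal[OF s] by auto
  then interpret local_frame X s "{..n}" E u .
  have "iter_vf E w (pairing h) s = (\<Sum>i\<in>UNIV. of_int (prod_list (map (A i) w)) * (h $ i * s $ i))"
    if "w \<in> lists {..n}" for w h
    using iter_vf_pairing[of w E h s] that pP iter_E_coord[of w 1]
    by (simp add: pairing_def ac_simps in_lists_conv_set)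
  then show ?thesis
    unfolding contact_def vanish_order_iff[OF polyfun_pairing] kernel_iff by (auto simp: less_Suc_eq_le)
qed

lemma subspace_kernel: "vec.subspace (kernel k)"
  unfolding kernel_def by (rule subspace_perp)

lemma dim_contact:
  assumes s: "s \<in> S"
  shows "vec.dim (contact X k s) = vec.dim (kernel k)"
proof -
  let ?\<phi> = "\<lambda>h::'a^'i. \<chi> i. h $ i * s $ i"
  have lin: "Vector_Spaces.linear (*s) (*s) ?\<phi>"
    by unfold_locales (simp_all add: vec_eq_iff algebra_simps)
  have inj: "inj ?\<phi>" using S_component_nonzero[OF s] by (auto simp: inj_def vec_eq_iff)
  have "?\<phi> ` contact X k s = kernel k"
  proof (intro equalityI subsetI)
    fix y assume y: "y \<in> kernel k"
    have "?\<phi> (\<chi> i. y $ i / s $ i) = y" using S_component_nonzero[OF s] by (simp add: vec_eq_iff)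
    then show "y \<in> ?\<phi> ` contact X k s" unfolding contact_S[OF s] using y by (intro image_eqI[of _ _ "\<chi> i. y $ i / s $ i"]) auto
  qed (use contact_S[OF s] in auto)
  then show ?thesis using vec.dim_image_eq[OF lin inj_on_subset[OF inj subset_UNIV]] by metis
qed

text \<open>The coordinates of \<open>s\<close> never vanish, so contact at \<open>s\<close> means
  \<open>h = y / s\<close> coordinatewise with \<open>y\<close> in the kernel, and inverting the
  coordinates of \<open>s\<close> negates the exponents.\<close>

lemma dual_orbit:
  "{h. h \<noteq> 0 \<and> (\<exists>s\<in>S. h \<in> contact X k s)} = orbit n (\<lambda>i j. - a i j) (kernel k - {0})"
proof (intro equalityI subsetI)
  fix h assume "h \<in> {h. h \<noteq> 0 \<and> (\<exists>s\<in>S. h \<in> contact X k s)}"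
  then obtain s where h: "h \<noteq> 0" and s: "s \<in> S" "h \<in> contact X k s" by auto
  let ?y = "\<chi> i. h $ i * s $ i"
  obtain t where t: "\<forall>j\<le>n. t j \<noteq> 0" "s = (\<chi> i. \<Prod>j\<le>n. t j powi A i j)" using s(1) by (rule S_E)
  have y: "?y \<in> kernel k - {0}"
    using s h contact_S[OF s(1)] S_component_nonzero[OF s(1)] by (auto simp: vec_eq_iff)
  \<comment> \<open>Negating \<open>a\<close> already inverts the contribution of every parameter
    except \<open>t 0\<close>, whose exponent remains 1; it is inverted separately.\<close>
  have inv: "(\<Prod>j\<le>n. (t(0 := inverse (t 0))) j powi homogenised (\<lambda>i j. - a i j) i j) = inverse (s $ i)" for i
    unfolding prod_homogenised t(2) by (simp add: prod_homogenised power_int_minus prod_inversef[symmetric])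
  have "h = (\<chi> i. ?y $ i * (\<Prod>j\<le>n. (t(0 := inverse (t 0))) j powi homogenised (\<lambda>i j. - a i j) i j))"
    unfolding inv using S_component_nonzero[OF s(1)] by (simp add: vec_eq_iff)
  also have "\<dots> \<in> orbit n (\<lambda>i j. - a i j) (kernel k - {0})" using y t(1) by (intro orbitI) auto
  finally show "h \<in> orbit n (\<lambda>i j. - a i j) (kernel k - {0})" .
next
  fix h assume "h \<in> orbit n (\<lambda>i j. - a i j) (kernel k - {0})"
  then obtain y t where y: "y \<in> kernel k - {0}" and t: "\<forall>j\<le>n. t j \<noteq> 0"
    and h: "h = (\<chi> i. y $ i * (\<Prod>j\<le>n. t j powi homogenised (\<lambda>i j. - a i j) i j))" by (elim orbitE)
  define s where "s = (\<chi> i. \<Prod>j\<le>n. (t(0 := inverse (t 0))) j powi A i j)"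
  have s: "s \<in> S" unfolding s_def using t by (intro S_I) auto
  have inv: "(\<Prod>j\<le>n. t j powi homogenised (\<lambda>i j. - a i j) i j) = inverse (s $ i)" for i
    unfolding prod_homogenised s_def by (simp add: prod_homogenised power_int_minus prod_inversef[symmetric])
  have "(\<chi> i. h $ i * s $ i) = y" unfolding h inv using S_component_nonzero[OF s] by (simp add: vec_eq_iff)
  then have "h \<in> contact X k s" using y contact_S[OF s] by simp
  moreover have "h \<noteq> 0" using orbit_nonzero[of "kernel k - {0}" n "\<lambda>i j. - a i j"] \<open>h \<in> orbit n (\<lambda>i j. - a i j) (kernel k - {0})\<close> by auto
  ultimately show "h \<in> {h. h \<noteq> 0 \<and> (\<exists>s\<in>S. h \<in> contact X k s)}" using s by blast
qed

theorem dual_variety_closure: "dual_variety X k = zariski closure_of (orbit n (\<lambda>i j. - a i j) (kernel k - {0}))"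
  unfolding dual_orbit[symmetric]
  by (rule dual_variety_eq[OF openin_S dim_X dim_conormal dim_contact])

end


section \<open>Self-duality\<close>

definition int_vectors :: "('i \<Rightarrow> int) set \<Rightarrow> ('a::field_char_0 ^ 'i::finite) set" where
  "int_vectors Z = (\<lambda>g. \<chi> i. of_int (g i)) ` Z"

text \<open>\<open>knap\<close> is stated over the reals while the kernel lives over the given
  field, so both are compared with the rationals. Rational combinations extend to the larger field,
  and a rational vector in the complement stays in it.\<close>

lemma axis_span_int_vectors:
  "(axis i 1 :: 'a::field_char_0 ^ 'i::finite) \<in> vec.span (int_vectors Z) \<longleftrightarrow>
   (axis i 1 :: rat ^ 'i) \<in> vec.span (int_vectors Z)"
proof
  let ?R = "\<lambda>v::rat ^ 'i. (\<chi> i. of_rat (v $ i)) :: 'a ^ 'i"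
  {
    assume *: "(axis i 1 :: rat ^ 'i) \<in> vec.span (int_vectors Z)"
    have "vec.subspace {v. ?R v \<in> vec.span (int_vectors Z)}"
    proof -
      have 0: "?R 0 = 0" by (simp add: vec_eq_iff)
      have add: "?R (x + y) = ?R x + ?R y" for x y by (simp add: vec_eq_iff of_rat_add)
      have scale: "?R (c *s x) = of_rat c *s ?R x" for c x by (simp add: vec_eq_iff of_rat_mult)
      show ?thesis unfolding vec.subspace_def mem_Collect_eq 0 add scale
        by (auto intro: vec.span_zero vec.span_add vec.span_scale)
    qed
    moreover have "int_vectors Z \<subseteq> {v. ?R v \<in> vec.span (int_vectors Z)}"
    proof
      fix v :: "rat ^ 'i" assume "v \<in> int_vectors Z"
      then obtain g where g: "g \<in> Z" "v = (\<chi> i. of_int (g i))" by (auto simp: int_vectors_def)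
      then have "?R v = (\<chi> i. of_int (g i))" by (simp add: vec_eq_iff)
      then show "v \<in> {v. ?R v \<in> vec.span (int_vectors Z)}" using g(1) by (auto simp: int_vectors_def intro!: vec.span_base)
    qed
    ultimately have "vec.span (int_vectors Z) \<subseteq> {v. ?R v \<in> vec.span (int_vectors Z)}" by (intro vec.span_minimal)
    then have "?R (axis i 1) \<in> vec.span (int_vectors Z)" using * by blast
    moreover have "?R (axis i 1) = axis i 1" by (simp add: vec_eq_iff axis_def)
    ultimately show "(axis i 1 :: 'a ^ 'i) \<in> vec.span (int_vectors Z)" by simp
  }
  {
    assume *: "(axis i 1 :: 'a ^ 'i) \<in> vec.span (int_vectors Z)"
    have "y $ i = 0" if y: "y \<in> perp (int_vectors Z)" for y :: "rat ^ 'i"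
    proof -
      have "pairing (\<chi> i. of_int (g i)) (?R y) = of_rat (pairing (\<chi> i. of_int (g i)) y)" for g :: "'i \<Rightarrow> int"
        by (simp add: pairing_def of_rat_sum of_rat_mult)
      then have "?R y \<in> perp (int_vectors Z)" using y by (auto simp: perp_def int_vectors_def)
      then have "?R y $ i = 0" using * axis_in_span_iff by blast
      then show ?thesis by simp
    qed
    then show "(axis i 1 :: rat ^ 'i) \<in> vec.span (int_vectors Z)" using axis_in_span_iff by blast
  }
qed

locale diagonal =
  fixes p :: "'a::field_char_0 ^ 'i::finite"
  assumes component_nonzero: "p $ i \<noteq> 0"
begin

sublocale linear_iso "\<lambda>v. \<chi> i. p $ i * v $ i" "\<lambda>v. \<chi> i. v $ i / p $ i"
proof (rule linear_iso.intro)
  show "Vector_Spaces.linear (*s) (*s) (\<lambda>v. \<chi> i. p $ i * v $ i)"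
    by unfold_locales (simp_all add: vec_eq_iff algebra_simps)
  show "Vector_Spaces.linear (*s) (*s) (\<lambda>v. \<chi> i. v $ i / p $ i)"
    by unfold_locales (simp_all add: vec_eq_iff add_divide_distrib)
qed (use component_nonzero in \<open>simp_all add: vec_eq_iff\<close>)

end

section \<open>The condition \<open>knap\<close> and the implications between the three
  statements\<close>

context toric
begin

lemma knap_iff: "knap k n a \<longleftrightarrow> (\<forall>i. \<exists>y\<in>kernel k. y $ i \<noteq> 0)"
proof -
  have 1: "{(\<chi> i'. real_of_int (\<Prod>j<n. a i' j ^ \<beta> j)) | \<beta>. (\<Sum>j<n. \<beta> j) \<le> k} = int_vectors (power_rows k)"
    by (simp add: int_vectors_def power_rows_def setcompr_eq_image image_image)
  have "(axis i 1 :: real ^ 'i) \<in> span (int_vectors (power_rows k)) \<longleftrightarrow> (axis i 1 :: 'a ^ 'i) \<in> vec.span (int_vectors (power_rows k))" for i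
    using axis_span_int_vectors[where 'a = real, of i "power_rows k"] axis_span_int_vectors[where 'a = 'a, of i "power_rows k"]
    by (simp add: span_vec_eq)
  then show ?thesis
    unfolding knap_def 1 axis_in_span_iff kernel_def int_vectors_def by auto
qed

text \<open>Independence of characters: since the Euler fields are tangent, the operators
  \<open>E (J m) - A m (J m)\<close> preserve linear forms vanishing on \<open>X\<close>; each
  removes one coordinate \<open>m\<close>, until only \<open>l\<close> is left.\<close>

lemma nondegenerate:
  assumes h: "\<And>v. v \<in> X \<Longrightarrow> pairing h v = 0"
  shows "h = 0"
proof -
  have "h $ l = 0" for l
  proof -
    have "\<forall>i. \<exists>j. i \<noteq> l \<longrightarrow> j \<le> n \<and> A i j \<noteq> A l j"
    proof
      fix i
      show "\<exists>j. i \<noteq> l \<longrightarrow> j \<le> n \<and> A i j \<noteq> A l j"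
      proof (cases "i = l")
        case False
        then obtain j where "j < n" "a i j \<noteq> a l j" using conf unfolding lattice_configuration_def by blast
        then show ?thesis by (intro exI[of _ "Suc j"]) (simp add: homogenised_def)
      qed simp
    qed
    \<comment> \<open>\<open>J i\<close> is a coordinate in which point \<open>i\<close> differs
      from point \<open>l\<close>, so that removing coordinate \<open>i\<close> leaves a nonzero
      factor at \<open>l\<close>.\<close>
    then obtain J where J: "\<And>i. i \<noteq> l \<Longrightarrow> J i \<le> n \<and> A i (J i) \<noteq> A l (J i)" by metis
    have vanish_product: "pairing (\<chi> i. h $ i * (\<Prod>m\<in>F. of_int (A i (J m) - A m (J m)))) v = 0"
      if "finite F" "l \<notin> F" "v \<in> X" for F v
      using that
    proof (induction F arbitrary: v)
      case empty
      then show ?case using h by simp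
    next
      case (insert m F)
      let ?g = "(\<chi> i. h $ i * (\<Prod>m\<in>F. of_int (A i (J m) - A m (J m)))) :: 'a ^ 'i"
      have m: "J m \<le> n" using J[of m] insert by auto
      have "vf (E (J m)) (pairing ?g) v = 0"
        using insert by (intro tangent_fieldD(2)[OF tangent_E[OF m] polyfun_pairing]) auto
      then have 1: "(\<Sum>i\<in>UNIV. ?g $ i * (of_int (A i (J m)) * v $ i)) = 0" by (simp add: vf_pairing E_def)
      have 2: "(\<Sum>i\<in>UNIV. ?g $ i * v $ i) = 0" using insert by (simp add: pairing_def)
      have "pairing (\<chi> i. h $ i * (\<Prod>m\<in>insert m F. of_int (A i (J m) - A m (J m)))) v
         = (\<Sum>i\<in>UNIV. ?g $ i * (of_int (A i (J m)) * v $ i)) - of_int (A m (J m)) * (\<Sum>i\<in>UNIV. ?g $ i * v $ i)"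
        unfolding pairing_def sum_distrib_left sum_subtractf[symmetric]
        using insert.hyps by (intro sum.cong) (simp_all add: algebra_simps)
      then show ?case unfolding 1 2 by simp
    qed
    obtain s where s: "s \<in> S" using ne by auto
    let ?F = "UNIV - {l}"
    have "(\<Sum>i\<in>UNIV. (h $ i * (\<Prod>m\<in>?F. of_int (A i (J m) - A m (J m)))) * s $ i) = 0"
      using vanish_product[of ?F s] s S_subset by (auto simp: pairing_def)
    also have "(\<Sum>i\<in>UNIV. (h $ i * (\<Prod>m\<in>?F. of_int (A i (J m) - A m (J m)))) * s $ i)
      = (\<Sum>i\<in>UNIV. if i = l then (h $ l * (\<Prod>m\<in>?F. of_int (A l (J m) - A m (J m)))) * s $ l else 0)"
      by (intro sum.cong) (auto simp: prod_zero_iff)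
    finally have "(h $ l * (\<Prod>m\<in>?F. of_int (A l (J m) - A m (J m)))) * s $ l = 0" by simp
    moreover have "A l (J m) \<noteq> A m (J m)" if "m \<noteq> l" for m using J[OF that] by metis
    then have "(\<Prod>m\<in>?F. of_int (A l (J m) - A m (J m)) :: 'a) \<noteq> 0" by (simp add: prod_zero_iff)
    ultimately show ?thesis using S_component_nonzero[OF s] by simp
  qed
  then show ?thesis by (simp add: vec_eq_iff)
qed

text \<open>A coordinate that vanishes on the kernel vanishes on all torus translates of its
  vectors.\<close>

lemma dual_variety_hyperplane:
  assumes "\<not> knap k n a"
  obtains i where "dual_variety X k \<subseteq> {y. y $ i = 0}"
proof -
  obtain i where i: "\<And>y. y \<in> kernel k \<Longrightarrow> y $ i = 0" using assms knap_iff by blast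
  have "y $ i = 0" if "y \<in> dual_variety X k" for y
    using that unfolding dual_variety_closure
  proof (rule polyfun_vanishing_closure[OF polyfun_coord orbit_cone, rotated])
    fix v assume "v \<in> orbit n (\<lambda>i j. - a i j) (kernel k - {0})"
    then show "v $ i = 0" using i by (auto elim!: orbitE)
  qed
  then show ?thesis by (intro that) auto
qed

text \<open>The dual action has negated exponents; inverting the parameters exchanges it with the
  original parametrization.\<close>

lemma diagonal_image:
  assumes "\<And>i. p $ i \<noteq> 0"
  shows "(\<lambda>v. \<chi> i. p $ i * v $ i) ` X = zariski closure_of {dual_action n a t p | t. t \<in> torus n}"
proof -
  interpret diagonal p by unfold_locales (rule assms)
  have "(\<lambda>v. \<chi> i. p $ i * v $ i) ` {(\<chi> i. \<Prod>j<n. t j powi a i j) | t. t \<in> torus n} = {dual_action n a t p | t. t \<in> torus n}"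
    (is "?L = ?R")
  proof (intro equalityI subsetI)
    fix y assume "y \<in> ?L"
    then obtain t where t: "t \<in> torus n" "y = (\<chi> i. p $ i * (\<chi> i. \<Prod>j<n. t j powi a i j) $ i)" by blast
    have "y = dual_action n a (\<lambda>j. inverse (t j)) p" by (simp add: t(2) dual_action_def vec_eq_iff power_int_minus power_int_inverse)
    moreover have "(\<lambda>j. inverse (t j)) \<in> torus n" using t(1) by (simp add: torus_def)
    ultimately show "y \<in> ?R" by blast
  next
    fix y assume "y \<in> ?R"
    then obtain t where t: "t \<in> torus n" "y = dual_action n a t p" by blast
    have "y = (\<chi> i. p $ i * (\<chi> i. \<Prod>j<n. inverse (t j) powi a i j) $ i)"
      by (simp add: t(2) dual_action_def vec_eq_iff power_int_minus power_int_inverse)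
    moreover have "(\<lambda>j. inverse (t j)) \<in> torus n" using t(1) by (simp add: torus_def)
    ultimately show "y \<in> ?L" by (intro image_eqI[of _ _ "\<chi> i. \<Prod>j<n. inverse (t j) powi a i j"]) auto
  qed
  then show ?thesis using closure_image[of "{(\<chi> i. \<Prod>j<n. t j powi a i j) | t. t \<in> torus n}"]
    by (simp add: X_eq toric_variety_def)
qed

text \<open>If a coordinate vanished on the dual variety, its pullback along the isomorphism would
  be a linear form vanishing on \<open>X\<close>, hence zero, against surjectivity.\<close>

lemma selfdual_imp_knap:
  assumes "selfdual X k"
  shows "zariski_dim X = zariski_dim (dual_variety X k)" and "knap k n a"
proof -
  obtain \<phi> where f: "Vector_Spaces.linear (*s) (*s) \<phi>" "bij \<phi>" "\<phi> ` X = dual_variety X k"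
    using assms unfolding selfdual_def by auto
  interpret linear_iso \<phi> "inv \<phi>" by (rule linear_iso_bij[OF f(1,2)])
  show "zariski_dim X = zariski_dim (dual_variety X k)" using dim_image[OF closedin_X] f(3) by simp
  show "knap k n a"
  proof (rule ccontr)
    assume "\<not> knap k n a"
    then obtain i where i: "dual_variety X k \<subseteq> {y. y $ i = 0}" by (rule dual_variety_hyperplane)
    have m: "\<phi> v $ i = pairing (matrix \<phi> $ i) v" for v
      using matrix_works[OF f(1)] by (simp add: matrix_vector_pairing[symmetric])
    have "matrix \<phi> $ i = 0"
    proof (rule nondegenerate)
      fix v assume "v \<in> X"
      then have "\<phi> v \<in> dual_variety X k" using f(3) by blast
      then show "pairing (matrix \<phi> $ i) v = 0" unfolding m[symmetric] using i by blast
    qed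
    then have "\<phi> v $ i = 0" for v using m by (simp add: pairing_0)
    then have "\<phi> (inv \<phi> (axis i 1)) $ i = 0" by blast
    then show False using linear_iso_bij[OF f(1,2)] by (simp add: linear_iso.inv(2))
  qed
qed

lemma knap_imp_orbit:
  assumes dim: "zariski_dim X = zariski_dim (dual_variety X k)" and "knap k n a"
  shows "\<exists>p. (\<forall>i. p $ i \<noteq> 0) \<and> dual_variety X k = zariski closure_of {dual_action n a t p | t. t \<in> torus n}"
proof -
  obtain p where p: "p \<in> kernel k" "\<And>i. p $ i \<noteq> 0"
    using subspace_avoid_coordinates[OF subspace_kernel[of k]] assms(2) knap_iff by blast
  interpret diagonal p by unfold_locales (rule p(2))
  let ?Z = "zariski closure_of {dual_action n a t p | t. t \<in> torus n}" and ?D = "dual_variety X k"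
  have Z: "?Z = (\<lambda>v. \<chi> i. p $ i * v $ i) ` X" using diagonal_image[of p] p(2) by simp
  have p0: "p \<noteq> 0" using p(2) by auto
  have "?Z = zariski closure_of (orbit n (\<lambda>i j. - a i j) {p})"
    using closure_orbit[where p = p and n = n and c = "\<lambda>i j. - a i j"] by (simp add: dual_action_def mult.commute)
  also have "\<dots> \<subseteq> ?D"
    unfolding dual_variety_closure using p(1) p0 by (intro closure_of_mono) (auto simp: orbit_def)
  finally have ZD: "?Z \<subseteq> ?D" .
  have "?Z = ?D"
  proof (rule ccontr)
    assume "?Z \<noteq> ?D"
    then have psub: "?Z \<subset> ?D" using ZD by blast
    have "p \<in> kernel k - {0}" using p(1) p0 by simp
    from orbitI[OF this, of n "\<lambda>_. 1"] have "orbit n (\<lambda>i j. - a i j) (kernel k - {0}) \<noteq> {}" by force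
    then have irr: "zariski_irreducible ?D"
      unfolding dual_variety_closure
      by (intro irreducible_closure orbit_connected_subspace subspace_kernel orbit_nonzero) auto
    have "irreducible_chain ?Z n (\<lambda>q. (\<lambda>v. \<chi> i. p $ i * v $ i) ` (zariski closure_of (orbit q a {\<chi> i. 1})))"
      unfolding Z by (rule chain_image[OF closedin_X chain_X])
    \<comment> \<open>The image of the chain of subtori, prolonged by the dual variety, would have
      length \<open>n + 1\<close>.\<close>
    from irreducible_chain_Suc[OF this _ _ irr psub]
    have "ereal (real (Suc n)) \<le> zariski_dim ?D"
      by (intro zariski_dim_ge) (simp add: dual_variety_def)
    also have "zariski_dim ?D = ereal (real n)" using dim dim_X by simp
    finally show False by simp
  qed
  then show ?thesis using p(2) by auto
qed

lemma orbit_imp_selfdual: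
  assumes "\<And>i. p $ i \<noteq> 0" and "dual_variety X k = zariski closure_of {dual_action n a t p | t. t \<in> torus n}"
  shows "selfdual X k"
proof -
  interpret diagonal p by unfold_locales (rule assms(1))
  have "bij (\<lambda>v. \<chi> i. p $ i * v $ i)"
    by (rule o_bij[of "\<lambda>v. \<chi> i. v $ i / p $ i"]) (use inv in \<open>auto simp: fun_eq_iff\<close>)
  then show ?thesis
    unfolding selfdual_def using \<phi> diagonal_image[of p] assms by blast
qed

end

theorem theorem2p7:
  fixes k n :: nat
    and a :: "'i::finite \<Rightarrow> nat \<Rightarrow> int"
    and X :: "('a::{alg_closed_field, field_char_0} ^ 'i) set"
  assumes "lattice_configuration n a"
    and X: "X = toric_variety n a"
  shows "(selfdual X k \<longleftrightarrow> zariski_dim X = zariski_dim (dual_variety X k) \<and> knap k n a) \<and>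
         (zariski_dim X = zariski_dim (dual_variety X k) \<and> knap k n a \<longleftrightarrow>
           (\<exists>p. (\<forall>i. p $ i \<noteq> 0) \<and>
             dual_variety X k = zariski closure_of {dual_action n a t p | t. t \<in> torus n}))"
proof -
  interpret toric n a X by unfold_locales (fact assms)+
  show ?thesis using selfdual_imp_knap[of k] knap_imp_orbit[of k] orbit_imp_selfdual[of _ k] by blast
qed

end
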